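(* Let $A$ and $B$ be lattices with zero. (1) If $A\otimes B$ is a lattice, then there is a natural embedding of $\mathrm{Con}_c A\otimes \mathrm{Con}_c B$ into $\mathrm{Con}_c(A\otimes B)$; namely, the unique $\{\vee,0\}$-homomorphism $\varepsilon\colon \mathrm{Con}_c A\otimes \mathrm{Con}_c B\to \mathrm{Con}_c(A\otimes B)$ such that $\varepsilon(\alpha\otimes\beta)=\alpha\odot\beta$ for all $\alpha\in\mathrm{Con}_c A$ and $\beta\in\mathrm{Con}_c B$ is injective. (2) If $A\otimes B$ is a capped tensor product, then $$\mathrm{Con}_c A\otimes \mathrm{Con}_c B\cong \mathrm{Con}_c(A\otimes B).$$
   Context: A $\{\vee,0\}$-semilattice is a join-semilattice with zero; a $\{\vee,0\}$-homomorphism is a join- and zero-preserving map. Let $A,B$ be $\{\vee,0\}$-semilattices and $\nabla_{A,B}=(A\times\{0\})\cup(\{0\}\times B)$. A bi-ideal of $A\times B$ is a subset $I\subseteq A\times B$ that is hereditary (downward closed), contains $\nabla_{A,B}$, and is closed under lateral joins: if $\langle a_0,b\rangle,\langle a_1,b\rangle\in I$ then $\langle a_0\vee a_1,b\rangle\in I$, and if $\langle a,b_0\rangle,\langle a,b_1\rangle\in I$ then $\langle a,b_0\vee b_1\rangle\in I$. The bi-ideals, ordered by containment, form an algebraic lattice $A\,\overline{\otimes}\,B$. The tensor product $A\otimes B$ is the $\{\vee,0\}$-semilattice of compact (equivalently, finitely generated) bi-ideals; it is generated by the pure tensors $a\otimes b=\nabla_{A,B}\cup\{\langle x,y\rangle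 : x\le a,\ y\le b\}$. A bi-ideal $I$ is capped if there is a finite $C\subseteq A\times B$ such that $I=\nabla_{A,B}\cup\{z\in A\times B: z\le c\text{ for some }c\in C\}$. The tensor product $A\otimes B$ is capped if every element of $A\otimes B$ (every compact bi-ideal) is capped; $A\otimes B$ is then a lattice. For a lattice $L$, $\mathrm{Con}\,L$ is its congruence lattice and $\mathrm{Con}_c L$ is the $\{\vee,0\}$-semilattice of compact (finitely generated) congruences of $L$; $\omega_L$ is the smallest congruence. For congruences $\alpha$ of $A$ and $\beta$ of $B$, $\alpha\,\square\,\beta$ is the relation on $A\otimes B$ given by: $H\equiv K$ iff for all $\langle x,y\rangle\in H$ there is $\langle x',y'\rangle\in K$ with $x\equiv_\alpha x'$ and $y\equiv_\beta y'$, and symmetrically with $H$ and $K$ interchanged. When $A\otimes B$ is a lattice this is a lattice congruence of $A\otimes B$. Set $\alpha\odot\beta=(\alpha\,\square\,\omega_B)\wedge(\omega_A\,\square\,\beta)$ (the meet, i.e. intersection, in $\mathrm{Con}(A\otimes B)$). *)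

theory Defs
  imports "HOL-Algebra.Complete_Lattice"
begin

text \<open>
  All structures are \<open>gorder\<close> records, so that the tensor product applies both to
  the given lattices and to the semilattices of compact congruences. The zero of \<open>L\<close> is
  \<open>\<bottom>\<^bsub>L\<^esub>\<close>, its join is \<open>\<squnion>\<^bsub>L\<^esub>\<close>.
\<close>

definition inclusion_order :: "'a set set \<Rightarrow> 'a set gorder" where
  "inclusion_order \<C> = \<lparr>carrier = \<C>, eq = (=), le = (\<subseteq>)\<rparr>"

definition compact_element :: "('a, 'm) gorder_scheme \<Rightarrow> 'a \<Rightarrow> bool" where
  "compact_element L c \<longleftrightarrow> c \<in> carrier L \<and>
     (\<forall>D. D \<subseteq> carrier L \<and> c \<sqsubseteq>\<^bsub>L\<^esub> \<Squnion>\<^bsub>L\<^esub>D \<longrightarrow>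
        (\<exists>F. finite F \<and> F \<subseteq> D \<and> c \<sqsubseteq>\<^bsub>L\<^esub> \<Squnion>\<^bsub>L\<^esub>F))"

definition compacts :: "('a, 'm) gorder_scheme \<Rightarrow> ('a, 'm) gorder_scheme" where
  "compacts L = L\<lparr>carrier := {c. compact_element L c}\<rparr>"

text \<open>
  Homomorphisms are extensional (\<open>\<rightarrow>\<^sub>E\<close>: undefined outside the carrier),
  so that uniqueness of a homomorphism is equality of functions.
\<close>

definition join_zero_hom ::
  "('a, 'm) gorder_scheme \<Rightarrow> ('b, 'n) gorder_scheme \<Rightarrow> ('a \<Rightarrow> 'b) set" where
  "join_zero_hom S T = {f \<in> carrier S \<rightarrow>\<^sub>E carrier T.
     f \<bottom>\<^bsub>S\<^esub> = \<bottom>\<^bsub>T\<^esub> \<and>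
     (\<forall>x\<in>carrier S. \<forall>y\<in>carrier S. f (x \<squnion>\<^bsub>S\<^esub> y) = f x \<squnion>\<^bsub>T\<^esub> f y)}"

definition join_zero_isomorphic ::
  "('a, 'm) gorder_scheme \<Rightarrow> ('b, 'n) gorder_scheme \<Rightarrow> bool" where
  "join_zero_isomorphic S T \<longleftrightarrow>
     (\<exists>f \<in> join_zero_hom S T. bij_betw f (carrier S) (carrier T))"


section \<open>Tensor products\<close>

definition nabla ::
  "('a, 'm) gorder_scheme \<Rightarrow> ('b, 'n) gorder_scheme \<Rightarrow> ('a \<times> 'b) set" where
  "nabla A B = (carrier A \<times> {\<bottom>\<^bsub>B\<^esub>}) \<union> ({\<bottom>\<^bsub>A\<^esub>} \<times> carrier B)"

definition bi_ideal ::
  "('a, 'm) gorder_scheme \<Rightarrow> ('b, 'n) gorder_scheme \<Rightarrow> ('a \<times> 'b) set \<Rightarrow> bool" where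
  "bi_ideal A B I \<longleftrightarrow>
     I \<subseteq> carrier A \<times> carrier B \<and>
     (\<forall>a b. \<forall>x\<in>carrier A. \<forall>y\<in>carrier B.
        (a, b) \<in> I \<and> x \<sqsubseteq>\<^bsub>A\<^esub> a \<and> y \<sqsubseteq>\<^bsub>B\<^esub> b \<longrightarrow> (x, y) \<in> I) \<and>
     nabla A B \<subseteq> I \<and>
     (\<forall>a\<^sub>0 a\<^sub>1 b. (a\<^sub>0, b) \<in> I \<and> (a\<^sub>1, b) \<in> I \<longrightarrow> (a\<^sub>0 \<squnion>\<^bsub>A\<^esub> a\<^sub>1, b) \<in> I) \<and>
     (\<forall>a b\<^sub>0 b\<^sub>1. (a, b\<^sub>0) \<in> I \<and> (a, b\<^sub>1) \<in> I \<longrightarrow> (a, b\<^sub>0 \<squnion>\<^bsub>B\<^esub> b\<^sub>1) \<in> I)"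

definition bi_ideal_lattice ::
  "('a, 'm) gorder_scheme \<Rightarrow> ('b, 'n) gorder_scheme \<Rightarrow> ('a \<times> 'b) set gorder" where
  "bi_ideal_lattice A B = inclusion_order {I. bi_ideal A B I}"

definition tensor ::
  "('a, 'm) gorder_scheme \<Rightarrow> ('b, 'n) gorder_scheme \<Rightarrow> ('a \<times> 'b) set gorder" where
  "tensor A B = compacts (bi_ideal_lattice A B)"

definition pure_tensor ::
  "('a, 'm) gorder_scheme \<Rightarrow> ('b, 'n) gorder_scheme \<Rightarrow> 'a \<Rightarrow> 'b \<Rightarrow> ('a \<times> 'b) set" where
  "pure_tensor A B a b = nabla A B \<union>
     {(x, y). x \<in> carrier A \<and> y \<in> carrier B \<and> x \<sqsubseteq>\<^bsub>A\<^esub> a \<and> y \<sqsubseteq>\<^bsub>B\<^esub> b}"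

definition capped_bi_ideal ::
  "('a, 'm) gorder_scheme \<Rightarrow> ('b, 'n) gorder_scheme \<Rightarrow> ('a \<times> 'b) set \<Rightarrow> bool" where
  "capped_bi_ideal A B I \<longleftrightarrow>
     (\<exists>C. finite C \<and> C \<subseteq> carrier A \<times> carrier B \<and>
        I = nabla A B \<union> {(x, y). x \<in> carrier A \<and> y \<in> carrier B \<and>
              (\<exists>(c, d) \<in> C. x \<sqsubseteq>\<^bsub>A\<^esub> c \<and> y \<sqsubseteq>\<^bsub>B\<^esub> d)})"

definition capped_tensor ::
  "('a, 'm) gorder_scheme \<Rightarrow> ('b, 'n) gorder_scheme \<Rightarrow> bool" where
  "capped_tensor A B \<longleftrightarrow> (\<forall>I \<in> carrier (tensor A B). capped_bi_ideal A B I)"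


section \<open>Congruences\<close>

definition lattice_congruence :: "('a, 'm) gorder_scheme \<Rightarrow> ('a \<times> 'a) set \<Rightarrow> bool" where
  "lattice_congruence L \<theta> \<longleftrightarrow> equiv (carrier L) \<theta> \<and>
     (\<forall>x x' y y'. (x, x') \<in> \<theta> \<and> (y, y') \<in> \<theta> \<longrightarrow>
        (x \<squnion>\<^bsub>L\<^esub> y, x' \<squnion>\<^bsub>L\<^esub> y') \<in> \<theta> \<and> (x \<sqinter>\<^bsub>L\<^esub> y, x' \<sqinter>\<^bsub>L\<^esub> y') \<in> \<theta>)"

definition Con :: "('a, 'm) gorder_scheme \<Rightarrow> ('a \<times> 'a) set gorder" where
  "Con L = inclusion_order {\<theta>. lattice_congruence L \<theta>}"

definition Con_c :: "('a, 'm) gorder_scheme \<Rightarrow> ('a \<times> 'a) set gorder" where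
  "Con_c L = compacts (Con L)"

definition box ::
  "('a, 'm) gorder_scheme \<Rightarrow> ('b, 'n) gorder_scheme \<Rightarrow>
     ('a \<times> 'a) set \<Rightarrow> ('b \<times> 'b) set \<Rightarrow> (('a \<times> 'b) set \<times> ('a \<times> 'b) set) set" where
  "box A B \<alpha> \<beta> =
     {(H, K). H \<in> carrier (tensor A B) \<and> K \<in> carrier (tensor A B) \<and>
        (\<forall>(x, y) \<in> H. \<exists>(x', y') \<in> K. (x, x') \<in> \<alpha> \<and> (y, y') \<in> \<beta>) \<and>
        (\<forall>(x', y') \<in> K. \<exists>(x, y) \<in> H. (x, x') \<in> \<alpha> \<and> (y, y') \<in> \<beta>)}"

text \<open>Here \<open>\<bottom>\<^bsub>Con L\<^esub>\<close> is the smallest congruence \<open>\<omega>\<close> of \<open>L\<close>.\<close>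

definition odot ::
  "('a, 'm) gorder_scheme \<Rightarrow> ('b, 'n) gorder_scheme \<Rightarrow>
     ('a \<times> 'a) set \<Rightarrow> ('b \<times> 'b) set \<Rightarrow> (('a \<times> 'b) set \<times> ('a \<times> 'b) set) set" where
  "odot A B \<alpha> \<beta> =
     box A B \<alpha> \<bottom>\<^bsub>Con B\<^esub> \<sqinter>\<^bsub>Con (tensor A B)\<^esub> box A B \<bottom>\<^bsub>Con A\<^esub> \<beta>"

definition canonical_homs ::
  "('a, 'm) gorder_scheme \<Rightarrow> ('b, 'n) gorder_scheme \<Rightarrow>
     ((('a \<times> 'a) set \<times> ('b \<times> 'b) set) set \<Rightarrow> (('a \<times> 'b) set \<times> ('a \<times> 'b) set) set) set" where
  "canonical_homs A B =
     {\<epsilon> \<in> join_zero_hom (tensor (Con_c A) (Con_c B)) (Con_c (tensor A B)).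
        \<forall>\<alpha> \<in> carrier (Con_c A). \<forall>\<beta> \<in> carrier (Con_c B).
          \<epsilon> (pure_tensor (Con_c A) (Con_c B) \<alpha> \<beta>) = odot A B \<alpha> \<beta>}"

end

theory Submission
  imports Defs "HOL.Hull"
begin

text \<open>
  For \<open>x' \<le> x\<close> in \<open>A\<close> and \<open>y' \<le> y\<close> in \<open>B\<close> call the interval from \<open>(x' \<otimes> y) \<squnion> (x \<otimes> y')\<close> to \<open>x \<otimes> y\<close>
  a corner. Everything rests on the fact that \<open>\<alpha> \<odot> \<beta>\<close> is the congruence of \<open>A \<otimes> B\<close> generated by the
  corners with \<open>(x', x) \<in> \<alpha>\<close> and \<open>(y', y) \<in> \<beta>\<close> (\<open>odot_subset_iff\<close>). Moreover, for a fixed congruence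
  \<open>\<psi>\<close> of \<open>A \<otimes> B\<close> and a fixed interval in one factor, the intervals of the other factor whose corner
  is collapsed by \<open>\<psi>\<close> are those collapsed by a congruence (\<open>slice_congruence\<close>), so corners of generators
  of \<open>\<alpha>\<close> and \<open>\<beta>\<close> suffice (\<open>collapses_span\<close>). Consequently \<open>\<alpha> \<odot> \<beta>\<close> is compact if \<open>\<alpha>\<close> and \<open>\<beta>\<close> are, and the
  map \<open>(\<alpha>, \<beta>) \<mapsto> \<alpha> \<odot> \<beta>\<close> preserves joins in each variable and vanishes on the axes
  (\<open>bi_ideal_odot_below\<close>). It therefore extends to the homomorphism \<open>\<epsilon>\<close>, which sends a bi-ideal \<open>I\<close>
  of compact congruences to the join of all \<open>\<alpha> \<odot> \<beta>\<close> with \<open>(\<alpha>, \<beta>) \<in> I\<close>; it is unique because pure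
  tensors generate.

  For injectivity, let \<open>(\<alpha>, \<beta>)\<close> lie outside the bi-ideal generated by finitely many pairs
  \<open>(\<alpha>\<^sub>j, \<beta>\<^sub>j)\<close>. Since congruence lattices of lattices are distributive (\<open>con_distrib\<close>), a combinatorial
  argument yields congruences \<open>P\<close> and \<open>Q\<close> such that \<open>\<alpha> \<subseteq> P\<close> and \<open>\<beta> \<subseteq> Q\<close> both fail, while for each \<open>j\<close> either
  \<open>\<alpha>\<^sub>j \<subseteq> P\<close> or \<open>\<beta>\<^sub>j \<subseteq> Q\<close> (\<open>separation\<close>). The congruence \<open>P \<box> Q\<close> then contains every \<open>\<alpha>\<^sub>j \<odot> \<beta>\<^sub>j\<close> but not
  \<open>\<alpha> \<odot> \<beta>\<close> (\<open>odot_subset_box_iff\<close>), so \<open>\<epsilon>\<close> reflects inclusion.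

  For surjectivity in the capped case, consider the principal congruence that collapses a compact
  bi-ideal \<open>H\<close> with \<open>H \<squnion> (c \<otimes> d)\<close>, where \<open>H\<close> is, up to \<open>\<nabla>\<close>, a finite union of sets \<open>a\<^sub>j \<otimes> b\<^sub>j\<close>. The interval
  is climbed through the pure tensors \<open>f \<otimes> d\<close> for \<open>f\<close> in a finite set of elements below \<open>c\<close> closed under
  meets with the \<open>a\<^sub>j\<close>; each step is equivalent to collapsing one corner (\<open>odot_condition_pure\<close>). Hence
  every compact congruence is a finite join of congruences \<open>\<alpha> \<odot> \<beta>\<close>.
\<close>

section \<open>Semilattices and lattices with zero\<close>

text \<open>
  The \<open>{\<or>,0}\<close>-semilattices; the tensor product is formed for these, since it is applied both to
  the given lattices and to their semilattices of compact congruences.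
\<close>

locale zero_semilattice = upper_semilattice L + weak_partial_order_bottom L
  for L :: "'a gorder" (structure)
begin

lemma join_le_iff:
  "\<lbrakk>x \<in> carrier L; y \<in> carrier L; z \<in> carrier L\<rbrakk> \<Longrightarrow> x \<squnion> y \<sqsubseteq> z \<longleftrightarrow> x \<sqsubseteq> z \<and> y \<sqsubseteq> z"
  by (meson join_closed join_le join_left join_right le_trans)

lemma join_eqI:
  "\<lbrakk>x \<in> carrier L; y \<in> carrier L; x \<sqsubseteq> y\<rbrakk> \<Longrightarrow> x \<squnion> y = y"
  by (meson join_closed join_le join_right le_antisym le_refl)

lemma join_commute: "x \<squnion> y = y \<squnion> x"
  by (simp add: join_def insert_commute)

lemma join_idem: "x \<in> carrier L \<Longrightarrow> x \<squnion> x = x"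
  by (simp add: join_eqI)

lemma le_joinI1:
  "\<lbrakk>x \<sqsubseteq> y; x \<in> carrier L; y \<in> carrier L; z \<in> carrier L\<rbrakk> \<Longrightarrow> x \<sqsubseteq> y \<squnion> z"
  by (meson join_closed join_left le_trans)

lemma le_joinI2:
  "\<lbrakk>x \<sqsubseteq> z; x \<in> carrier L; y \<in> carrier L; z \<in> carrier L\<rbrakk> \<Longrightarrow> x \<sqsubseteq> y \<squnion> z"
  by (meson join_closed join_right le_trans)

lemma bottom_in [simp, intro]: "\<bottom> \<in> carrier L"
  using bottom_least by blast

lemma bottom_le: "x \<in> carrier L \<Longrightarrow> \<bottom> \<sqsubseteq> x"
  using bottom_least least_le by metis

lemma le_bottom_iff: "x \<in> carrier L \<Longrightarrow> x \<sqsubseteq> \<bottom> \<longleftrightarrow> x = \<bottom>"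
  using bottom_le le_antisym le_refl bottom_in by metis

lemma bottom_join: "x \<in> carrier L \<Longrightarrow> \<bottom> \<squnion> x = x"
  by (simp add: bottom_le join_eqI)

end

locale zero_lattice = lattice L + weak_partial_order_bottom L
  for L :: "'a gorder" (structure)

sublocale zero_lattice \<subseteq> zero_semilattice ..

context zero_lattice
begin

lemma le_meet_iff:
  "\<lbrakk>x \<in> carrier L; y \<in> carrier L; z \<in> carrier L\<rbrakk> \<Longrightarrow> z \<sqsubseteq> x \<sqinter> y \<longleftrightarrow> z \<sqsubseteq> x \<and> z \<sqsubseteq> y"
  by (meson meet_closed meet_le meet_left meet_right le_trans)

lemma meet_eqI:
  "\<lbrakk>x \<in> carrier L; y \<in> carrier L; x \<sqsubseteq> y\<rbrakk> \<Longrightarrow> x \<sqinter> y = x"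
  by (meson meet_closed meet_le meet_left le_antisym le_refl)

lemma meet_eqI':
  "\<lbrakk>x \<in> carrier L; y \<in> carrier L; x \<sqsubseteq> y\<rbrakk> \<Longrightarrow> y \<sqinter> x = x"
  by (meson meet_closed meet_le meet_right le_antisym le_refl)

lemma meet_commute: "x \<sqinter> y = y \<sqinter> x"
  by (simp add: meet_def insert_commute)

lemma meet_mono:
  assumes "x \<sqsubseteq> x'" "y \<sqsubseteq> y'" "x \<in> carrier L" "y \<in> carrier L" "x' \<in> carrier L" "y' \<in> carrier L"
  shows "x \<sqinter> y \<sqsubseteq> x' \<sqinter> y'"
  by (meson assms meet_closed meet_le meet_left meet_right le_trans)

end


section \<open>Families of sets ordered by inclusion\<close>

lemma carrier_inclusion_order [simp]: "carrier (inclusion_order \<C>) = \<C>"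
  by (simp add: inclusion_order_def)

lemma le_inclusion_order [simp]: "X \<sqsubseteq>\<^bsub>inclusion_order \<C>\<^esub> Y \<longleftrightarrow> X \<subseteq> Y"
  by (simp add: inclusion_order_def)

lemma partial_order_inclusion_order: "partial_order (inclusion_order \<C>)"
  by unfold_locales (auto simp: inclusion_order_def)

lemma inclusion_order_lub_iff:
  "\<X> \<subseteq> \<C> \<Longrightarrow> least (inclusion_order \<C>) Z (Upper (inclusion_order \<C>) \<X>) \<longleftrightarrow>
     Z \<in> \<C> \<and> \<Union>\<X> \<subseteq> Z \<and> (\<forall>W\<in>\<C>. \<Union>\<X> \<subseteq> W \<longrightarrow> Z \<subseteq> W)"
proof -
  assume "\<X> \<subseteq> \<C>"
  then have "Upper (inclusion_order \<C>) \<X> = {W \<in> \<C>. \<Union>\<X> \<subseteq> W}"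
    unfolding Upper_def by (simp add: Sup_le_iff) blast
  then show ?thesis unfolding least_def by simp blast
qed

lemma inclusion_order_glb_iff:
  "\<X> \<subseteq> \<C> \<Longrightarrow> greatest (inclusion_order \<C>) Z (Lower (inclusion_order \<C>) \<X>) \<longleftrightarrow>
     Z \<in> \<C> \<and> (\<forall>X\<in>\<X>. Z \<subseteq> X) \<and> (\<forall>W\<in>\<C>. (\<forall>X\<in>\<X>. W \<subseteq> X) \<longrightarrow> W \<subseteq> Z)"
proof -
  assume "\<X> \<subseteq> \<C>"
  then have "Lower (inclusion_order \<C>) \<X> = {W \<in> \<C>. \<forall>X\<in>\<X>. W \<subseteq> X}"
    unfolding Lower_def by simp blast
  then show ?thesis unfolding greatest_def by simp blast
qed

lemma inclusion_order_Sup: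
  assumes "\<X> \<subseteq> \<C>" "Z \<in> \<C>" "\<Union>\<X> \<subseteq> Z" "\<And>W. W \<in> \<C> \<Longrightarrow> \<Union>\<X> \<subseteq> W \<Longrightarrow> Z \<subseteq> W"
  shows "\<Squnion>\<^bsub>inclusion_order \<C>\<^esub>\<X> = Z"
  unfolding sup_def inclusion_order_lub_iff[OF assms(1)]
  by (rule some_equality) (use assms in \<open>meson subset_antisym\<close>)+

lemma inclusion_order_join:
  assumes "X \<in> \<C>" "Y \<in> \<C>" "Z \<in> \<C>" "X \<subseteq> Z" "Y \<subseteq> Z"
    and "\<And>W. W \<in> \<C> \<Longrightarrow> X \<subseteq> W \<Longrightarrow> Y \<subseteq> W \<Longrightarrow> Z \<subseteq> W"
  shows "X \<squnion>\<^bsub>inclusion_order \<C>\<^esub> Y = Z"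
  unfolding join_def by (rule inclusion_order_Sup) (use assms in auto)

lemma inclusion_order_meet:
  assumes "X \<in> \<C>" "Y \<in> \<C>" "X \<inter> Y \<in> \<C>"
  shows "X \<sqinter>\<^bsub>inclusion_order \<C>\<^esub> Y = X \<inter> Y"
proof -
  have "{X, Y} \<subseteq> \<C>" using assms by simp
  show ?thesis
    unfolding meet_def inf_def inclusion_order_glb_iff[OF \<open>{X, Y} \<subseteq> \<C>\<close>]
    by (rule some_equality) (use assms in \<open>blast intro: subset_antisym\<close>)+
qed

lemma inclusion_order_bottom:
  assumes "Z \<in> \<C>" "\<And>W. W \<in> \<C> \<Longrightarrow> Z \<subseteq> W"
  shows "\<bottom>\<^bsub>inclusion_order \<C>\<^esub> = Z"
  unfolding bottom_def least_def
  by (rule some_equality) (use assms in \<open>simp_all add: subset_antisym\<close>)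


section \<open>Algebraic closure systems\<close>

text \<open>
  Bi-ideals and congruences are both given by closure systems closed under directed unions; the
  closed sets then form an algebraic lattice whose compact elements are the finitely generated
  closed sets.
\<close>

locale algebraic_closure_system =
  fixes U :: "'x set" and closed :: "'x set \<Rightarrow> bool"
  assumes closed_subset: "closed X \<Longrightarrow> X \<subseteq> U"
    and closed_carrier: "closed U"
    and closed_Inter: "\<X> \<noteq> {} \<Longrightarrow> (\<And>X. X \<in> \<X> \<Longrightarrow> closed X) \<Longrightarrow> closed (\<Inter>\<X>)"
    and closed_directed_Union: "\<X> \<noteq> {} \<Longrightarrow> (\<And>X. X \<in> \<X> \<Longrightarrow> closed X) \<Longrightarrow>
      (\<And>X Y. X \<in> \<X> \<Longrightarrow> Y \<in> \<X> \<Longrightarrow> \<exists>Z\<in>\<X>. X \<union> Y \<subseteq> Z) \<Longrightarrow> closed (\<Union>\<X>)"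
begin

text \<open>
  The least closed set containing \<open>X\<close>; meaningful for \<open>X \<subseteq> U\<close> only.
\<close>

definition span :: "'x set \<Rightarrow> 'x set" where
  "span X = closed hull X"

lemma closed_span: "X \<subseteq> U \<Longrightarrow> closed (span X)"
  unfolding span_def hull_def by (rule closed_Inter) (use closed_carrier in auto)

lemma span_superset: "X \<subseteq> span X"
  unfolding span_def by (rule hull_subset)

lemma span_subset_iff: "closed Y \<Longrightarrow> span X \<subseteq> Y \<longleftrightarrow> X \<subseteq> Y"
  unfolding span_def by (rule subset_hull)

lemma span_closed: "closed X \<Longrightarrow> span X = X"
  unfolding span_def by (rule hull_same)

lemma span_mono: "X \<subseteq> Y \<Longrightarrow> span X \<subseteq> span Y"
  unfolding span_def by (rule hull_mono)

lemma span_subset_carrier: "X \<subseteq> U \<Longrightarrow> span X \<subseteq> U"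
  by (simp add: closed_carrier span_subset_iff)

lemma closed_Int: "closed X \<Longrightarrow> closed Y \<Longrightarrow> closed (X \<inter> Y)"
  using closed_Inter[of "{X, Y}"] by auto

lemma span_Un: "span (span X \<union> span Y) = span (X \<union> Y)"
  unfolding span_def by (metis hull_Un_left hull_Un_right)

text \<open>
  The closure is finitary: the spans of the finite subsets of \<open>X\<close> form a directed family.
\<close>

lemma span_finitary:
  assumes "X \<subseteq> U" "finite G" "G \<subseteq> span X"
  obtains F where "finite F" "F \<subseteq> X" "G \<subseteq> span F"
proof -
  define \<X> where "\<X> = span ` {F. finite F \<and> F \<subseteq> X}"
  have "closed (\<Union>\<X>)"
  proof (rule closed_directed_Union)
    show "\<X> \<noteq> {}" unfolding \<X>_def by blast
    show "closed Y" if "Y \<in> \<X>" for Y using that assms closed_span unfolding \<X>_def by auto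
    fix Y Z assume "Y \<in> \<X>" "Z \<in> \<X>"
    then obtain F F' where F: "finite F" "F \<subseteq> X" "finite F'" "F' \<subseteq> X" "Y = span F" "Z = span F'"
      unfolding \<X>_def by auto
    then have "span (F \<union> F') \<in> \<X>" "Y \<union> Z \<subseteq> span (F \<union> F')"
      unfolding \<X>_def by (auto intro: span_mono[THEN subsetD])
    then show "\<exists>W\<in>\<X>. Y \<union> Z \<subseteq> W" by blast
  qed
  moreover have "X \<subseteq> \<Union>\<X>"
  proof
    fix x assume "x \<in> X"
    then have "span {x} \<in> \<X>" unfolding \<X>_def by auto
    moreover have "x \<in> span {x}" using span_superset by auto
    ultimately show "x \<in> \<Union>\<X>" by blast
  qed
  ultimately have "span X \<subseteq> \<Union>\<X>" by (simp add: span_subset_iff)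
  then have "\<forall>g\<in>G. \<exists>F. finite F \<and> F \<subseteq> X \<and> g \<in> span F" using assms unfolding \<X>_def by auto
  then obtain F where F: "\<And>g. g \<in> G \<Longrightarrow> finite (F g) \<and> F g \<subseteq> X \<and> g \<in> span (F g)" by metis
  show thesis
  proof (rule that)
    show "finite (\<Union>(F ` G))" using F assms by auto
    show "\<Union>(F ` G) \<subseteq> X" using F by auto
    show "G \<subseteq> span (\<Union>(F ` G))"
      using F by (meson SUP_upper span_mono subsetD subsetI)
  qed
qed

abbreviation closed_lattice :: "'x set gorder" where
  "closed_lattice \<equiv> inclusion_order {X. closed X}"

text \<open>
  The finitely generated closed sets. That the span is closed says that the generators lie in
  the carrier; phrased this way, the definition does not mention the carrier.
\<close>

definition fin_gen :: "'x set set" where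
  "fin_gen = {span F |F. finite F \<and> closed (span F)}"

lemma fin_genI: "finite F \<Longrightarrow> F \<subseteq> U \<Longrightarrow> span F \<in> fin_gen"
  unfolding fin_gen_def using closed_span by blast

lemma fin_genE:
  assumes "X \<in> fin_gen"
  obtains F where "finite F" "F \<subseteq> U" "X = span F" "F \<subseteq> X"
proof -
  obtain F where F: "finite F" "closed (span F)" "X = span F"
    using assms unfolding fin_gen_def by blast
  moreover have "F \<subseteq> span F" by (rule span_superset)
  ultimately show thesis using closed_subset that by blast
qed

lemma fin_gen_closed: "X \<in> fin_gen \<Longrightarrow> closed X"
  unfolding fin_gen_def by auto

lemma Sup_closed_lattice:
  assumes "\<X> \<subseteq> {X. closed X}"
  shows "\<Squnion>\<^bsub>closed_lattice\<^esub>\<X> = span (\<Union>\<X>)"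
proof (rule inclusion_order_Sup[OF assms])
  have "\<Union>\<X> \<subseteq> U" using assms closed_subset by blast
  then show "span (\<Union>\<X>) \<in> {X. closed X}" using closed_span by blast
qed (use span_superset span_subset_iff in auto)

lemma compact_iff_fin_gen: "compact_element closed_lattice X \<longleftrightarrow> X \<in> fin_gen"
proof
  assume X: "compact_element closed_lattice X"
  then have "closed X" unfolding compact_element_def by simp
  define D where "D = (\<lambda>x. span {x}) ` X"
  have D: "D \<subseteq> {X. closed X}"
    unfolding D_def using closed_span closed_subset[OF \<open>closed X\<close>] by auto
  have "X \<subseteq> \<Union>D" unfolding D_def using span_superset by blast
  then have "X \<subseteq> \<Squnion>\<^bsub>closed_lattice\<^esub>D"
    using Sup_closed_lattice[OF D] span_superset by blast
  with X D obtain E where E: "finite E" "E \<subseteq> D" "X \<subseteq> \<Squnion>\<^bsub>closed_lattice\<^esub>E"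
    unfolding compact_element_def by auto
  then obtain G where G: "finite G" "G \<subseteq> X" "E = (\<lambda>x. span {x}) ` G"
    unfolding D_def by (meson finite_subset_image)
  have "X \<subseteq> span (\<Union>E)"
    using E(3) Sup_closed_lattice[of E] E(2) D by auto
  moreover have "\<Union>E \<subseteq> span G" unfolding G(3) using span_mono by (simp add: UN_least)
  ultimately have "X \<subseteq> span G"
    using G(2) \<open>closed X\<close> closed_span closed_subset span_subset_iff by (meson subset_trans)
  moreover have "span G \<subseteq> X" using G \<open>closed X\<close> span_subset_iff by auto
  ultimately show "X \<in> fin_gen"
    using G \<open>closed X\<close> closed_subset fin_genI by (metis subset_antisym subset_trans)
next
  assume "X \<in> fin_gen"
  then obtain F where F: "finite F" "F \<subseteq> U" "X = span F" "F \<subseteq> X" by (rule fin_genE)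
  show "compact_element closed_lattice X"
    unfolding compact_element_def
  proof (intro conjI allI impI)
    show "X \<in> carrier closed_lattice" using F closed_span by simp
    fix D assume D: "D \<subseteq> carrier closed_lattice \<and> X \<sqsubseteq>\<^bsub>closed_lattice\<^esub> \<Squnion>\<^bsub>closed_lattice\<^esub>D"
    then have D': "D \<subseteq> {X. closed X}" by simp
    have "F \<subseteq> span (\<Union>D)"
      using D Sup_closed_lattice[OF D'] F(4) by auto
    moreover have "\<Union>D \<subseteq> U" using D' closed_subset by auto
    ultimately obtain G where G: "finite G" "G \<subseteq> \<Union>D" "F \<subseteq> span G"
      using span_finitary F(1) by metis
    then obtain E where E: "finite E" "E \<subseteq> D" "G \<subseteq> \<Union>E"
      using finite_subset_Union by metis
    have E': "E \<subseteq> {X. closed X}" using E D' by auto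
    then have "\<Union>E \<subseteq> U" using closed_subset by blast
    then have "X \<subseteq> span (\<Union>E)"
      unfolding F(3) using G(3) span_mono[OF E(3)] by (subst span_subset_iff[OF closed_span]) auto
    then have "X \<sqsubseteq>\<^bsub>closed_lattice\<^esub> \<Squnion>\<^bsub>closed_lattice\<^esub>E"
      using Sup_closed_lattice[OF E'] by simp
    with E show "\<exists>E. finite E \<and> E \<subseteq> D \<and> X \<sqsubseteq>\<^bsub>closed_lattice\<^esub> \<Squnion>\<^bsub>closed_lattice\<^esub>E"
      by blast
  qed
qed

lemma compacts_closed_lattice: "compacts closed_lattice = inclusion_order fin_gen"
  unfolding compacts_def compact_iff_fin_gen by (simp add: inclusion_order_def)

lemma meet_closed_lattice:
  assumes "closed X" "closed Y"
  shows "X \<sqinter>\<^bsub>closed_lattice\<^esub> Y = X \<inter> Y"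
  by (rule inclusion_order_meet) (use assms closed_Int in auto)

lemma bottom_closed_lattice: "\<bottom>\<^bsub>closed_lattice\<^esub> = span {}"
  by (rule inclusion_order_bottom) (use closed_span span_subset_iff in auto)

lemma fin_gen_span_Un: "X \<in> fin_gen \<Longrightarrow> Y \<in> fin_gen \<Longrightarrow> span (X \<union> Y) \<in> fin_gen"
  by (elim fin_genE) (simp add: span_Un fin_genI)

lemma fin_gen_span_Union:
  "finite \<X> \<Longrightarrow> \<X> \<subseteq> fin_gen \<Longrightarrow> span (\<Union>\<X>) \<in> fin_gen"
proof (induction rule: finite_induct)
  case empty
  then show ?case using fin_genI[of "{}"] by simp
next
  case (insert X \<X>)
  then have "span (X \<union> span (\<Union>\<X>)) \<in> fin_gen" by (intro fin_gen_span_Un) auto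
  then show ?case unfolding span_def by (simp add: hull_Un_right[symmetric])
qed

lemma fin_gen_join:
  assumes "X \<in> fin_gen" "Y \<in> fin_gen"
  shows "X \<squnion>\<^bsub>inclusion_order fin_gen\<^esub> Y = span (X \<union> Y)"
  using assms span_superset[of "X \<union> Y"]
  by (intro inclusion_order_join) (simp_all add: fin_gen_span_Un fin_gen_closed span_subset_iff)

lemma fin_gen_bottom: "\<bottom>\<^bsub>inclusion_order fin_gen\<^esub> = span {}"
  by (rule inclusion_order_bottom)
    (use fin_genI[of "{}"] span_subset_iff fin_gen_closed in auto)

lemma zero_semilattice_fin_gen: "zero_semilattice (inclusion_order fin_gen)"
proof -
  interpret partial_order "inclusion_order fin_gen" by (rule partial_order_inclusion_order)
  show ?thesis
  proof unfold_locales
    fix X Y assume "X \<in> carrier (inclusion_order fin_gen)" "Y \<in> carrier (inclusion_order fin_gen)"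
    then have XY: "X \<in> fin_gen" "Y \<in> fin_gen" by auto
    then have "least (inclusion_order fin_gen) (span (X \<union> Y)) (Upper (inclusion_order fin_gen) {X, Y})"
      using span_superset[of "X \<union> Y"]
      by (subst inclusion_order_lub_iff)
        (simp_all add: fin_gen_span_Un span_subset_iff fin_gen_closed)
    then show "\<exists>s. least (inclusion_order fin_gen) s (Upper (inclusion_order fin_gen) {X, Y})"
      by blast
  next
    have "least (inclusion_order fin_gen) (span {}) (carrier (inclusion_order fin_gen))"
      unfolding least_def using fin_genI[of "{}"] span_subset_iff fin_gen_closed by auto
    then show "\<exists>x. least (inclusion_order fin_gen) x (carrier (inclusion_order fin_gen))" by blast
  qed
qed

end

section \<open>Bi-ideals and the tensor product\<close>

text \<open>
  Two \<open>{\<or>,0}\<close>-semilattices. Their bi-ideals form an algebraic closure system, whose unqualified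
  operator \<open>span\<close> is the bi-ideal generated by a set of pairs and whose set \<open>fin_gen\<close> is the carrier
  of the tensor product.
\<close>

locale semilattice_pair = A: zero_semilattice A + B: zero_semilattice B
  for A :: "'a gorder" and B :: "'b gorder"
begin

lemma bi_ideal_subset: "bi_ideal A B I \<Longrightarrow> I \<subseteq> carrier A \<times> carrier B"
  unfolding bi_ideal_def by blast

lemma bi_ideal_le:
  "\<lbrakk>bi_ideal A B I; (a, b) \<in> I; x \<in> carrier A; y \<in> carrier B; x \<sqsubseteq>\<^bsub>A\<^esub> a; y \<sqsubseteq>\<^bsub>B\<^esub> b\<rbrakk> \<Longrightarrow> (x, y) \<in> I"
  unfolding bi_ideal_def by blast

lemma bi_ideal_nabla: "bi_ideal A B I \<Longrightarrow> nabla A B \<subseteq> I"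
  unfolding bi_ideal_def by blast

lemma bi_ideal_bottom_left: "bi_ideal A B I \<Longrightarrow> b \<in> carrier B \<Longrightarrow> (\<bottom>\<^bsub>A\<^esub>, b) \<in> I"
  using bi_ideal_nabla unfolding nabla_def by blast

lemma bi_ideal_bottom_right: "bi_ideal A B I \<Longrightarrow> a \<in> carrier A \<Longrightarrow> (a, \<bottom>\<^bsub>B\<^esub>) \<in> I"
  using bi_ideal_nabla unfolding nabla_def by blast

lemma bi_ideal_join_left:
  "bi_ideal A B I \<Longrightarrow> (a, b) \<in> I \<Longrightarrow> (a', b) \<in> I \<Longrightarrow> (a \<squnion>\<^bsub>A\<^esub> a', b) \<in> I"
  unfolding bi_ideal_def by blast

lemma bi_ideal_join_right:
  "bi_ideal A B I \<Longrightarrow> (a, b) \<in> I \<Longrightarrow> (a, b') \<in> I \<Longrightarrow> (a, b \<squnion>\<^bsub>B\<^esub> b') \<in> I"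
  unfolding bi_ideal_def by blast

lemma bi_idealI:
  assumes "\<And>x y. (x, y) \<in> I \<Longrightarrow> x \<in> carrier A \<and> y \<in> carrier B"
    and "\<And>a b x y. \<lbrakk>(a, b) \<in> I; a \<in> carrier A; b \<in> carrier B; x \<in> carrier A; y \<in> carrier B;
      x \<sqsubseteq>\<^bsub>A\<^esub> a; y \<sqsubseteq>\<^bsub>B\<^esub> b\<rbrakk> \<Longrightarrow> (x, y) \<in> I"
    and "\<And>b. b \<in> carrier B \<Longrightarrow> (\<bottom>\<^bsub>A\<^esub>, b) \<in> I" "\<And>a. a \<in> carrier A \<Longrightarrow> (a, \<bottom>\<^bsub>B\<^esub>) \<in> I"
    and "\<And>a a' b. \<lbrakk>(a, b) \<in> I; (a', b) \<in> I; a \<in> carrier A; a' \<in> carrier A; b \<in> carrier B\<rbrakk> \<Longrightarrow>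
      (a \<squnion>\<^bsub>A\<^esub> a', b) \<in> I"
    and "\<And>a b b'. \<lbrakk>(a, b) \<in> I; (a, b') \<in> I; a \<in> carrier A; b \<in> carrier B; b' \<in> carrier B\<rbrakk> \<Longrightarrow>
      (a, b \<squnion>\<^bsub>B\<^esub> b') \<in> I"
  shows "bi_ideal A B I"
proof -
  have "I \<subseteq> carrier A \<times> carrier B" using assms(1) by auto
  moreover have "nabla A B \<subseteq> I" unfolding nabla_def using assms(3,4) by blast
  ultimately show ?thesis
    unfolding bi_ideal_def
  proof (intro conjI allI ballI impI)
    fix a b x y
    assume "x \<in> carrier A" "y \<in> carrier B" "(a, b) \<in> I \<and> x \<sqsubseteq>\<^bsub>A\<^esub> a \<and> y \<sqsubseteq>\<^bsub>B\<^esub> b"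
    then show "(x, y) \<in> I" using assms(1)[of a b] assms(2)[of a b x y] by simp
  next
    fix a a' b
    assume "(a, b) \<in> I \<and> (a', b) \<in> I"
    then show "(a \<squnion>\<^bsub>A\<^esub> a', b) \<in> I" using assms(1)[of a b] assms(1)[of a' b] assms(5) by simp
  next
    fix a b b'
    assume "(a, b) \<in> I \<and> (a, b') \<in> I"
    then show "(a, b \<squnion>\<^bsub>B\<^esub> b') \<in> I" using assms(1)[of a b] assms(1)[of a b'] assms(6) by simp
  qed
qed

end

sublocale semilattice_pair \<subseteq> algebraic_closure_system "carrier A \<times> carrier B" "bi_ideal A B"
proof
  show "X \<subseteq> carrier A \<times> carrier B" if "bi_ideal A B X" for X
    using that by (rule bi_ideal_subset)
  show "bi_ideal A B (carrier A \<times> carrier B)"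
    by (rule bi_idealI) auto
  show "bi_ideal A B (\<Inter>\<X>)" if ne: "\<X> \<noteq> {}" and \<X>: "\<And>X. X \<in> \<X> \<Longrightarrow> bi_ideal A B X" for \<X>
  proof (rule bi_idealI)
    show "x \<in> carrier A \<and> y \<in> carrier B" if "(x, y) \<in> \<Inter>\<X>" for x y
      using that ne bi_ideal_subset[OF \<X>] by blast
    show "(x, y) \<in> \<Inter>\<X>" if "(a, b) \<in> \<Inter>\<X>" "x \<in> carrier A" "y \<in> carrier B"
      "x \<sqsubseteq>\<^bsub>A\<^esub> a" "y \<sqsubseteq>\<^bsub>B\<^esub> b" for a b x y
      using that bi_ideal_le[OF \<X>] by blast
    show "(\<bottom>\<^bsub>A\<^esub>, b) \<in> \<Inter>\<X>" if "b \<in> carrier B" for b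
      using that bi_ideal_bottom_left[OF \<X>] by blast
    show "(a, \<bottom>\<^bsub>B\<^esub>) \<in> \<Inter>\<X>" if "a \<in> carrier A" for a
      using that bi_ideal_bottom_right[OF \<X>] by blast
    show "(a \<squnion>\<^bsub>A\<^esub> a', b) \<in> \<Inter>\<X>" if "(a, b) \<in> \<Inter>\<X>" "(a', b) \<in> \<Inter>\<X>" for a a' b
      using that bi_ideal_join_left[OF \<X>] by blast
    show "(a, b \<squnion>\<^bsub>B\<^esub> b') \<in> \<Inter>\<X>" if "(a, b) \<in> \<Inter>\<X>" "(a, b') \<in> \<Inter>\<X>" for a b b'
      using that bi_ideal_join_right[OF \<X>] by blast
  qed
  show "bi_ideal A B (\<Union>\<X>)"
    if *: "\<X> \<noteq> {}" "\<And>X. X \<in> \<X> \<Longrightarrow> bi_ideal A B X"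
      "\<And>X Y. X \<in> \<X> \<Longrightarrow> Y \<in> \<X> \<Longrightarrow> \<exists>Z\<in>\<X>. X \<union> Y \<subseteq> Z" for \<X>
  proof (rule bi_idealI)
    show "x \<in> carrier A \<and> y \<in> carrier B" if "(x, y) \<in> \<Union>\<X>" for x y
      using that bi_ideal_subset[OF *(2)] by blast
    show "(x, y) \<in> \<Union>\<X>" if "(a, b) \<in> \<Union>\<X>" "x \<in> carrier A" "y \<in> carrier B"
      "x \<sqsubseteq>\<^bsub>A\<^esub> a" "y \<sqsubseteq>\<^bsub>B\<^esub> b" for a b x y
      using that bi_ideal_le[OF *(2)] by blast
    show "(\<bottom>\<^bsub>A\<^esub>, b) \<in> \<Union>\<X>" if "b \<in> carrier B" for b
      using that *(1) bi_ideal_bottom_left[OF *(2)] by blast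
    show "(a, \<bottom>\<^bsub>B\<^esub>) \<in> \<Union>\<X>" if "a \<in> carrier A" for a
      using that *(1) bi_ideal_bottom_right[OF *(2)] by blast
    fix a a' b b'
    have dir: "\<exists>Z\<in>\<X>. p \<in> Z \<and> q \<in> Z" if pq: "p \<in> \<Union>\<X>" "q \<in> \<Union>\<X>" for p q
      using pq *(3) by (meson UnCI UnionE subsetD)
    show "(a \<squnion>\<^bsub>A\<^esub> a', b) \<in> \<Union>\<X>" if pq: "(a, b) \<in> \<Union>\<X>" "(a', b) \<in> \<Union>\<X>"
      using dir[OF pq] bi_ideal_join_left[OF *(2)] by blast
    show "(a, b \<squnion>\<^bsub>B\<^esub> b') \<in> \<Union>\<X>" if pq: "(a, b) \<in> \<Union>\<X>" "(a, b') \<in> \<Union>\<X>"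
      using dir[OF pq] bi_ideal_join_right[OF *(2)] by blast
  qed
qed

context semilattice_pair
begin

lemma tensor_eq: "tensor A B = inclusion_order fin_gen"
  unfolding tensor_def bi_ideal_lattice_def by (rule compacts_closed_lattice)

lemma carrier_tensor [simp]: "carrier (tensor A B) = fin_gen"
  by (simp add: tensor_eq)

lemma join_tensor:
  "H \<in> fin_gen \<Longrightarrow> K \<in> fin_gen \<Longrightarrow> H \<squnion>\<^bsub>tensor A B\<^esub> K = span (H \<union> K)"
  by (simp add: tensor_eq fin_gen_join)

lemma bottom_tensor: "\<bottom>\<^bsub>tensor A B\<^esub> = span {}"
  by (simp add: tensor_eq fin_gen_bottom)

lemma zero_semilattice_tensor: "zero_semilattice (tensor A B)"
  by (simp add: tensor_eq zero_semilattice_fin_gen)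

lemma le_tensor [simp]: "H \<sqsubseteq>\<^bsub>tensor A B\<^esub> K \<longleftrightarrow> H \<subseteq> K"
  by (simp add: tensor_eq)

lemma mem_pure_tensor:
  "(x, y) \<in> pure_tensor A B a b \<longleftrightarrow> x \<in> carrier A \<and> y \<in> carrier B \<and>
     (x = \<bottom>\<^bsub>A\<^esub> \<or> y = \<bottom>\<^bsub>B\<^esub> \<or> x \<sqsubseteq>\<^bsub>A\<^esub> a \<and> y \<sqsubseteq>\<^bsub>B\<^esub> b)"
  unfolding pure_tensor_def nabla_def by auto

text \<open>For \<open>a' \<le> a\<close> and \<open>b' \<le> b\<close>, the join of \<open>a' \<otimes> b\<close> and \<open>a \<otimes> b'\<close> is merely their union.\<close>

definition step_tensor :: "'a \<Rightarrow> 'a \<Rightarrow> 'b \<Rightarrow> 'b \<Rightarrow> ('a \<times> 'b) set" where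
  "step_tensor a' a b' b = pure_tensor A B a' b \<union> pure_tensor A B a b'"

lemma mem_step_tensor:
  "(x, y) \<in> step_tensor a' a b' b \<longleftrightarrow> x \<in> carrier A \<and> y \<in> carrier B \<and>
     (x = \<bottom>\<^bsub>A\<^esub> \<or> y = \<bottom>\<^bsub>B\<^esub> \<or> x \<sqsubseteq>\<^bsub>A\<^esub> a' \<and> y \<sqsubseteq>\<^bsub>B\<^esub> b \<or> x \<sqsubseteq>\<^bsub>A\<^esub> a \<and> y \<sqsubseteq>\<^bsub>B\<^esub> b')"
  unfolding step_tensor_def Un_iff mem_pure_tensor by blast

lemma bi_ideal_step_tensor:
  assumes car: "a' \<in> carrier A" "a \<in> carrier A" "b' \<in> carrier B" "b \<in> carrier B"
    and le: "a' \<sqsubseteq>\<^bsub>A\<^esub> a" "b' \<sqsubseteq>\<^bsub>B\<^esub> b"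
  shows "bi_ideal A B (step_tensor a' a b' b)"
proof (rule bi_idealI)
  fix u v x y
  assume "(u, v) \<in> step_tensor a' a b' b" "u \<in> carrier A" "v \<in> carrier B" "x \<in> carrier A"
      "y \<in> carrier B" "x \<sqsubseteq>\<^bsub>A\<^esub> u" "y \<sqsubseteq>\<^bsub>B\<^esub> v"
  then show "(x, y) \<in> step_tensor a' a b' b"
    using car A.le_trans B.le_trans A.le_bottom_iff B.le_bottom_iff
    unfolding mem_step_tensor by metis
next
  fix u u' v
  assume *: "(u, v) \<in> step_tensor a' a b' b" "(u', v) \<in> step_tensor a' a b' b"
    and c: "u \<in> carrier A" "u' \<in> carrier A" "v \<in> carrier B"
  have le_a: "w \<sqsubseteq>\<^bsub>A\<^esub> a" if "w \<sqsubseteq>\<^bsub>A\<^esub> a'" "w \<in> carrier A" for w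
    using that le car A.le_trans by blast
  show "(u \<squnion>\<^bsub>A\<^esub> u', v) \<in> step_tensor a' a b' b"
  proof (cases "u = \<bottom>\<^bsub>A\<^esub> \<or> u' = \<bottom>\<^bsub>A\<^esub>")
    case True
    then show ?thesis
      using * c A.bottom_join A.join_commute[of _ "\<bottom>\<^bsub>A\<^esub>"] by auto
  next
    case False
    then show ?thesis
      using * c car A.join_le le_a unfolding mem_step_tensor by (meson A.join_closed)
  qed
next
  fix u v v'
  assume *: "(u, v) \<in> step_tensor a' a b' b" "(u, v') \<in> step_tensor a' a b' b"
    and c: "u \<in> carrier A" "v \<in> carrier B" "v' \<in> carrier B"
  have le_b: "w \<sqsubseteq>\<^bsub>B\<^esub> b" if "w \<sqsubseteq>\<^bsub>B\<^esub> b'" "w \<in> carrier B" for w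
    using that le car B.le_trans by blast
  show "(u, v \<squnion>\<^bsub>B\<^esub> v') \<in> step_tensor a' a b' b"
  proof (cases "v = \<bottom>\<^bsub>B\<^esub> \<or> v' = \<bottom>\<^bsub>B\<^esub>")
    case True
    then show ?thesis
      using * c B.bottom_join B.join_commute[of _ "\<bottom>\<^bsub>B\<^esub>"] by auto
  next
    case False
    then show ?thesis
      using * c car B.join_le le_b unfolding mem_step_tensor by (meson B.join_closed)
  qed
qed (auto simp: mem_step_tensor)

lemma step_tensor_refl: "step_tensor a a b b = pure_tensor A B a b"
  unfolding step_tensor_def by simp

lemma bi_ideal_pure_tensor:
  "a \<in> carrier A \<Longrightarrow> b \<in> carrier B \<Longrightarrow> bi_ideal A B (pure_tensor A B a b)"
  using bi_ideal_step_tensor[of a a b b] by (simp add: step_tensor_refl)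

lemma pure_tensor_subset_iff:
  assumes "bi_ideal A B I" "a \<in> carrier A" "b \<in> carrier B"
  shows "pure_tensor A B a b \<subseteq> I \<longleftrightarrow> (a, b) \<in> I"
proof
  show "(a, b) \<in> I" if "pure_tensor A B a b \<subseteq> I"
    using that assms by (auto simp: mem_pure_tensor subset_iff)
  show "pure_tensor A B a b \<subseteq> I" if "(a, b) \<in> I"
    using that assms bi_ideal_le[OF assms(1) that] bi_ideal_bottom_left bi_ideal_bottom_right
    by (auto simp: mem_pure_tensor)
qed

lemma span_singleton:
  assumes "a \<in> carrier A" "b \<in> carrier B"
  shows "span {(a, b)} = pure_tensor A B a b"
proof (rule subset_antisym)
  show "span {(a, b)} \<subseteq> pure_tensor A B a b"
    using assms by (simp add: span_subset_iff bi_ideal_pure_tensor mem_pure_tensor)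
  have "bi_ideal A B (span {(a, b)})" using assms by (intro closed_span) auto
  then show "pure_tensor A B a b \<subseteq> span {(a, b)}"
    using assms span_superset[of "{(a, b)}"] by (simp add: pure_tensor_subset_iff)
qed

lemma pure_tensor_fin_gen:
  "a \<in> carrier A \<Longrightarrow> b \<in> carrier B \<Longrightarrow> pure_tensor A B a b \<in> fin_gen"
  using fin_genI[of "{(a, b)}"] by (simp add: span_singleton)

lemma step_tensor_eq_span:
  assumes "a' \<in> carrier A" "a \<in> carrier A" "b' \<in> carrier B" "b \<in> carrier B"
    and "a' \<sqsubseteq>\<^bsub>A\<^esub> a" "b' \<sqsubseteq>\<^bsub>B\<^esub> b"
  shows "step_tensor a' a b' b = span (pure_tensor A B a' b \<union> pure_tensor A B a b')"
  using span_closed[OF bi_ideal_step_tensor[OF assms]] by (simp add: step_tensor_def)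

lemma step_tensor_fin_gen:
  assumes "a' \<in> carrier A" "a \<in> carrier A" "b' \<in> carrier B" "b \<in> carrier B"
    and "a' \<sqsubseteq>\<^bsub>A\<^esub> a" "b' \<sqsubseteq>\<^bsub>B\<^esub> b"
  shows "step_tensor a' a b' b \<in> fin_gen"
  unfolding step_tensor_eq_span[OF assms] using assms
  by (simp add: fin_gen_span_Un pure_tensor_fin_gen)

lemma span_pure_tensor_left:
  assumes "a \<in> carrier A" "a' \<in> carrier A" "b \<in> carrier B"
  shows "span (pure_tensor A B a b \<union> pure_tensor A B a' b) = pure_tensor A B (a \<squnion>\<^bsub>A\<^esub> a') b"
proof (rule subset_antisym)
  show "span (pure_tensor A B a b \<union> pure_tensor A B a' b) \<subseteq> pure_tensor A B (a \<squnion>\<^bsub>A\<^esub> a') b"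
    using assms by (simp add: span_subset_iff bi_ideal_pure_tensor pure_tensor_subset_iff
        mem_pure_tensor A.join_left A.join_right)
  have cl: "bi_ideal A B (span (pure_tensor A B a b \<union> pure_tensor A B a' b))"
    using assms by (intro closed_span) (auto simp: mem_pure_tensor)
  have "(a, b) \<in> span (pure_tensor A B a b \<union> pure_tensor A B a' b)"
    "(a', b) \<in> span (pure_tensor A B a b \<union> pure_tensor A B a' b)"
    using assms span_superset[of "pure_tensor A B a b \<union> pure_tensor A B a' b"]
    by (auto simp: mem_pure_tensor)
  then show "pure_tensor A B (a \<squnion>\<^bsub>A\<^esub> a') b \<subseteq> span (pure_tensor A B a b \<union> pure_tensor A B a' b)"
    using assms cl by (simp add: pure_tensor_subset_iff bi_ideal_join_left)
qed

lemma span_pure_tensor_right: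
  assumes "a \<in> carrier A" "b \<in> carrier B" "b' \<in> carrier B"
  shows "span (pure_tensor A B a b \<union> pure_tensor A B a b') = pure_tensor A B a (b \<squnion>\<^bsub>B\<^esub> b')"
proof (rule subset_antisym)
  show "span (pure_tensor A B a b \<union> pure_tensor A B a b') \<subseteq> pure_tensor A B a (b \<squnion>\<^bsub>B\<^esub> b')"
    using assms by (simp add: span_subset_iff bi_ideal_pure_tensor pure_tensor_subset_iff
        mem_pure_tensor B.join_left B.join_right)
  have cl: "bi_ideal A B (span (pure_tensor A B a b \<union> pure_tensor A B a b'))"
    using assms by (intro closed_span) (auto simp: mem_pure_tensor)
  have "(a, b) \<in> span (pure_tensor A B a b \<union> pure_tensor A B a b')"
    "(a, b') \<in> span (pure_tensor A B a b \<union> pure_tensor A B a b')"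
    using assms span_superset[of "pure_tensor A B a b \<union> pure_tensor A B a b'"]
    by (auto simp: mem_pure_tensor)
  then show "pure_tensor A B a (b \<squnion>\<^bsub>B\<^esub> b') \<subseteq> span (pure_tensor A B a b \<union> pure_tensor A B a b')"
    using assms cl by (simp add: pure_tensor_subset_iff bi_ideal_join_right)
qed

text \<open>A homomorphism on a tensor product is determined by its values on pure tensors.\<close>

lemma join_zero_hom_eqI:
  assumes "f \<in> join_zero_hom (tensor A B) S" "g \<in> join_zero_hom (tensor A B) S"
    and eq: "\<And>a b. a \<in> carrier A \<Longrightarrow> b \<in> carrier B \<Longrightarrow>
      f (pure_tensor A B a b) = g (pure_tensor A B a b)"
  shows "f = g"
proof -
  have "f (span F) = g (span F)" if "finite F" "F \<subseteq> carrier A \<times> carrier B" for F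
    using that
  proof (induction F rule: finite_induct)
    case empty
    then show ?case using assms by (simp add: join_zero_hom_def bottom_tensor)
  next
    case (insert p F)
    obtain a b where p: "p = (a, b)" "a \<in> carrier A" "b \<in> carrier B" using insert.prems by auto
    have "span (insert p F) = pure_tensor A B a b \<squnion>\<^bsub>tensor A B\<^esub> span F"
    proof -
      have "span F \<in> fin_gen" using insert by (intro fin_genI) auto
      then have "pure_tensor A B a b \<squnion>\<^bsub>tensor A B\<^esub> span F = span (span {p} \<union> span F)"
        using p by (simp add: join_tensor pure_tensor_fin_gen span_singleton)
      then show ?thesis unfolding span_Un by simp
    qed
    then show ?case
      using assms insert p by (simp add: join_zero_hom_def pure_tensor_fin_gen fin_genI)
  qed
  then have "f H = g H" if "H \<in> carrier (tensor A B)" for H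
    using that by (auto elim: fin_genE)
  moreover have "f \<in> extensional (carrier (tensor A B))" "g \<in> extensional (carrier (tensor A B))"
    using assms(1,2) unfolding join_zero_hom_def PiE_def by blast+
  ultimately show ?thesis by (rule extensionalityI[rotated 2])
qed

end

section \<open>Congruences of a lattice\<close>

context zero_lattice
begin

lemma con_subset: "lattice_congruence L \<theta> \<Longrightarrow> \<theta> \<subseteq> carrier L \<times> carrier L"
  unfolding lattice_congruence_def equiv_def by blast

lemma con_carrier: "lattice_congruence L \<theta> \<Longrightarrow> (x, y) \<in> \<theta> \<Longrightarrow> x \<in> carrier L \<and> y \<in> carrier L"
  using con_subset by blast

lemma con_refl: "lattice_congruence L \<theta> \<Longrightarrow> x \<in> carrier L \<Longrightarrow> (x, x) \<in> \<theta>"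
  unfolding lattice_congruence_def equiv_def refl_on_def by blast

lemma con_sym: "lattice_congruence L \<theta> \<Longrightarrow> (x, y) \<in> \<theta> \<Longrightarrow> (y, x) \<in> \<theta>"
  unfolding lattice_congruence_def equiv_def by (meson symD)

lemma con_trans: "lattice_congruence L \<theta> \<Longrightarrow> (x, y) \<in> \<theta> \<Longrightarrow> (y, z) \<in> \<theta> \<Longrightarrow> (x, z) \<in> \<theta>"
  unfolding lattice_congruence_def equiv_def by (meson transD)

lemma con_join:
  "lattice_congruence L \<theta> \<Longrightarrow> (x, x') \<in> \<theta> \<Longrightarrow> (y, y') \<in> \<theta> \<Longrightarrow> (x \<squnion> y, x' \<squnion> y') \<in> \<theta>"
  unfolding lattice_congruence_def by blast

lemma con_meet:
  "lattice_congruence L \<theta> \<Longrightarrow> (x, x') \<in> \<theta> \<Longrightarrow> (y, y') \<in> \<theta> \<Longrightarrow> (x \<sqinter> y, x' \<sqinter> y') \<in> \<theta>"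
  unfolding lattice_congruence_def by blast

lemma con_join_right:
  "lattice_congruence L \<theta> \<Longrightarrow> (x, y) \<in> \<theta> \<Longrightarrow> t \<in> carrier L \<Longrightarrow> (x \<squnion> t, y \<squnion> t) \<in> \<theta>"
  by (simp add: con_join con_refl)

lemma con_meet_right:
  "lattice_congruence L \<theta> \<Longrightarrow> (x, y) \<in> \<theta> \<Longrightarrow> t \<in> carrier L \<Longrightarrow> (x \<sqinter> t, y \<sqinter> t) \<in> \<theta>"
  by (simp add: con_meet con_refl)

lemma lattice_congruenceI:
  assumes "\<And>x y. (x, y) \<in> \<theta> \<Longrightarrow> x \<in> carrier L \<and> y \<in> carrier L"
    and "\<And>x. x \<in> carrier L \<Longrightarrow> (x, x) \<in> \<theta>"
    and "\<And>x y. (x, y) \<in> \<theta> \<Longrightarrow> (y, x) \<in> \<theta>"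
    and "\<And>x y z. (x, y) \<in> \<theta> \<Longrightarrow> (y, z) \<in> \<theta> \<Longrightarrow> (x, z) \<in> \<theta>"
    and "\<And>x y t. (x, y) \<in> \<theta> \<Longrightarrow> t \<in> carrier L \<Longrightarrow> (x \<squnion> t, y \<squnion> t) \<in> \<theta>"
    and "\<And>x y t. (x, y) \<in> \<theta> \<Longrightarrow> t \<in> carrier L \<Longrightarrow> (x \<sqinter> t, y \<sqinter> t) \<in> \<theta>"
  shows "lattice_congruence L \<theta>"
proof -
  have "equiv (carrier L) \<theta>"
  proof (rule equivI)
    show "\<theta> \<subseteq> carrier L \<times> carrier L" using assms(1) by auto
    show "refl_on (carrier L) \<theta>" using assms(2) by (auto intro: refl_onI)
    show "sym \<theta>" using assms(3) by (rule symI)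
    show "trans \<theta>" using assms(4) by (rule transI)
  qed
  moreover have "(x \<squnion> y, x' \<squnion> y') \<in> \<theta>" "(x \<sqinter> y, x' \<sqinter> y') \<in> \<theta>"
    if *: "(x, x') \<in> \<theta>" "(y, y') \<in> \<theta>" for x x' y y'
  proof -
    have "y \<in> carrier L" "x' \<in> carrier L" using assms(1) * by blast+
    then have "(x \<squnion> y, x' \<squnion> y) \<in> \<theta>" "(y \<squnion> x', y' \<squnion> x') \<in> \<theta>"
      "(x \<sqinter> y, x' \<sqinter> y) \<in> \<theta>" "(y \<sqinter> x', y' \<sqinter> x') \<in> \<theta>"
      using assms(5,6) * by blast+
    then show "(x \<squnion> y, x' \<squnion> y') \<in> \<theta>" "(x \<sqinter> y, x' \<sqinter> y') \<in> \<theta>"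
      using assms(4) by (metis join_commute, metis meet_commute)
  qed
  ultimately show ?thesis unfolding lattice_congruence_def by blast
qed

end

sublocale zero_lattice \<subseteq>
  con: algebraic_closure_system "carrier L \<times> carrier L" "lattice_congruence L"
proof
  show "X \<subseteq> carrier L \<times> carrier L" if "lattice_congruence L X" for X
    using that by (rule con_subset)
  show "lattice_congruence L (carrier L \<times> carrier L)"
    by (rule lattice_congruenceI) auto
  show "lattice_congruence L (\<Inter>\<X>)"
    if ne: "\<X> \<noteq> {}" and \<X>: "\<And>X. X \<in> \<X> \<Longrightarrow> lattice_congruence L X" for \<X>
  proof (rule lattice_congruenceI)
    show "x \<in> carrier L \<and> y \<in> carrier L" if "(x, y) \<in> \<Inter>\<X>" for x y
      using that ne con_carrier[OF \<X>] by blast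
    show "(x, x) \<in> \<Inter>\<X>" if "x \<in> carrier L" for x
      using that con_refl[OF \<X>] by blast
    show "(y, x) \<in> \<Inter>\<X>" if "(x, y) \<in> \<Inter>\<X>" for x y
      using that con_sym[OF \<X>] by blast
    show "(x, z) \<in> \<Inter>\<X>" if "(x, y) \<in> \<Inter>\<X>" "(y, z) \<in> \<Inter>\<X>" for x y z
      using that con_trans[OF \<X>] by blast
    fix x y t assume "(x, y) \<in> \<Inter>\<X>" "t \<in> carrier L"
    then show "(x \<squnion> t, y \<squnion> t) \<in> \<Inter>\<X>" "(x \<sqinter> t, y \<sqinter> t) \<in> \<Inter>\<X>"
      using con_join_right[OF \<X>] con_meet_right[OF \<X>] by blast+
  qed
  show "lattice_congruence L (\<Union>\<X>)"
    if ne: "\<X> \<noteq> {}" and \<X>: "\<And>X. X \<in> \<X> \<Longrightarrow> lattice_congruence L X"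
      and dir: "\<And>X Y. X \<in> \<X> \<Longrightarrow> Y \<in> \<X> \<Longrightarrow> \<exists>Z\<in>\<X>. X \<union> Y \<subseteq> Z" for \<X>
  proof (rule lattice_congruenceI)
    show "x \<in> carrier L \<and> y \<in> carrier L" if "(x, y) \<in> \<Union>\<X>" for x y
      using that con_carrier[OF \<X>] by blast
    show "(x, x) \<in> \<Union>\<X>" if "x \<in> carrier L" for x
      using that ne con_refl[OF \<X>] by blast
    show "(y, x) \<in> \<Union>\<X>" if "(x, y) \<in> \<Union>\<X>" for x y
      using that con_sym[OF \<X>] by blast
    show "(x, z) \<in> \<Union>\<X>" if xy: "(x, y) \<in> \<Union>\<X>" and yz: "(y, z) \<in> \<Union>\<X>" for x y z
    proof -
      obtain Z where "Z \<in> \<X>" "(x, y) \<in> Z" "(y, z) \<in> Z"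
        using xy yz dir by (meson UnCI UnionE subsetD)
      then show ?thesis using con_trans[OF \<X>] by blast
    qed
    fix x y t assume "(x, y) \<in> \<Union>\<X>" "t \<in> carrier L"
    then show "(x \<squnion> t, y \<squnion> t) \<in> \<Union>\<X>" "(x \<sqinter> t, y \<sqinter> t) \<in> \<Union>\<X>"
      using con_join_right[OF \<X>] con_meet_right[OF \<X>] by blast+
  qed
qed

context zero_lattice
begin

lemma Con_eq: "Con L = con.closed_lattice"
  by (simp add: Con_def)

lemma Con_c_eq: "Con_c L = inclusion_order con.fin_gen"
  unfolding Con_c_def Con_eq by (rule con.compacts_closed_lattice)

lemma carrier_Con_c [simp]: "carrier (Con_c L) = con.fin_gen"
  by (simp add: Con_c_eq)

lemma le_Con_c [simp]: "\<alpha> \<sqsubseteq>\<^bsub>Con_c L\<^esub> \<beta> \<longleftrightarrow> \<alpha> \<subseteq> \<beta>"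
  by (simp add: Con_c_eq)

lemma join_Con_c:
  "\<alpha> \<in> con.fin_gen \<Longrightarrow> \<beta> \<in> con.fin_gen \<Longrightarrow> \<alpha> \<squnion>\<^bsub>Con_c L\<^esub> \<beta> = con.span (\<alpha> \<union> \<beta>)"
  by (simp add: Con_c_eq con.fin_gen_join)

lemma zero_semilattice_Con_c: "zero_semilattice (Con_c L)"
  by (simp add: Con_c_eq con.zero_semilattice_fin_gen)

text \<open>
  The least congruence is equality on the carrier.
\<close>

lemma con_span_empty: "con.span {} = Id_on (carrier L)"
proof -
  have "lattice_congruence L (Id_on (carrier L))"
    by (rule lattice_congruenceI) auto
  then have "con.span {} \<subseteq> Id_on (carrier L)" by (simp add: con.span_subset_iff)
  moreover have "Id_on (carrier L) \<subseteq> con.span {}"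
    using con_refl[OF con.closed_span[of "{}"]] by auto
  ultimately show ?thesis by blast
qed

lemma bottom_Con: "\<bottom>\<^bsub>Con L\<^esub> = Id_on (carrier L)"
  by (simp add: Con_eq con.bottom_closed_lattice con_span_empty)

lemma bottom_Con_c: "\<bottom>\<^bsub>Con_c L\<^esub> = Id_on (carrier L)"
  by (simp add: Con_c_eq con.fin_gen_bottom con_span_empty)

text \<open>A congruence relates two elements iff it collapses the interval that they span.\<close>

lemma con_mem_iff:
  assumes \<theta>: "lattice_congruence L \<theta>" and xy: "x \<in> carrier L" "y \<in> carrier L"
  shows "(x, y) \<in> \<theta> \<longleftrightarrow> (x \<sqinter> y, x \<squnion> y) \<in> \<theta>"
proof
  assume "(x, y) \<in> \<theta>"
  then have "(x \<sqinter> y, y \<sqinter> y) \<in> \<theta>" "(y \<squnion> y, x \<squnion> y) \<in> \<theta>"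
    using con_join con_meet con_refl con_sym \<theta> xy by meson+
  then show "(x \<sqinter> y, x \<squnion> y) \<in> \<theta>"
    using con_trans[OF \<theta>] xy by (simp add: join_idem meet_eqI)
next
  assume *: "(x \<sqinter> y, x \<squnion> y) \<in> \<theta>"
  have le: "(z, x \<squnion> y) \<in> \<theta>" if z: "z \<in> carrier L" "x \<sqinter> y \<sqsubseteq> z" "z \<sqsubseteq> x \<squnion> y" for z
  proof -
    have "z \<squnion> (x \<sqinter> y) = z" "z \<squnion> (x \<squnion> y) = x \<squnion> y"
      using z xy join_eqI[of "x \<sqinter> y" z] join_eqI[of z "x \<squnion> y"] join_commute[of z "x \<sqinter> y"] by simp_all
    then show ?thesis using con_join[OF \<theta> con_refl[OF \<theta> z(1)] *] by simp
  qed
  have "(x, x \<squnion> y) \<in> \<theta>" "(y, x \<squnion> y) \<in> \<theta>"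
    using le xy meet_left meet_right join_left join_right by auto
  then show "(x, y) \<in> \<theta>" using con_sym[OF \<theta>] con_trans[OF \<theta>] by blast
qed

text \<open>
  Congruences are determined by the intervals that they collapse; a set of intervals that is
  closed under concatenation and under joining or meeting both ends with a fixed element
  arises from a congruence.
\<close>

lemma interval_congruence:
  assumes refl: "\<And>x. x \<in> carrier L \<Longrightarrow> P x x"
    and trans: "\<And>x y z. \<lbrakk>x \<in> carrier L; y \<in> carrier L; z \<in> carrier L; x \<sqsubseteq> y; y \<sqsubseteq> z; P x y; P y z\<rbrakk> \<Longrightarrow> P x z"
    and join: "\<And>x y t. \<lbrakk>x \<in> carrier L; y \<in> carrier L; t \<in> carrier L; x \<sqsubseteq> y; P x y\<rbrakk> \<Longrightarrow> P (x \<squnion> t) (y \<squnion> t)"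
    and meet: "\<And>x y t. \<lbrakk>x \<in> carrier L; y \<in> carrier L; t \<in> carrier L; x \<sqsubseteq> y; P x y\<rbrakk> \<Longrightarrow> P (x \<sqinter> t) (y \<sqinter> t)"
  shows "lattice_congruence L {(x, y). x \<in> carrier L \<and> y \<in> carrier L \<and> P x (x \<squnion> y) \<and> P y (x \<squnion> y)}"
proof -
  have shrink: "P x y" if c: "x \<in> carrier L" "y \<in> carrier L" "z \<in> carrier L"
    and le: "x \<sqsubseteq> y" "y \<sqsubseteq> z" and P: "P x z" for x y z
    using meet[of x z y] c le P le_trans[of x y z] by (simp add: meet_eqI meet_eqI')
  have tr: "P x (x \<squnion> z)" if c: "x \<in> carrier L" "y \<in> carrier L" "z \<in> carrier L"
    and P: "P x (x \<squnion> y)" "P y (y \<squnion> z)" for x y z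
  proof -
    have "P (y \<squnion> x) ((y \<squnion> z) \<squnion> x)" using c P join[of y "y \<squnion> z" x] by (simp add: join_left)
    then have "P (x \<squnion> y) ((y \<squnion> z) \<squnion> x)" by (simp add: join_commute)
    moreover have "x \<squnion> y \<sqsubseteq> (y \<squnion> z) \<squnion> x"
      using c by (simp add: join_le_iff join_right le_joinI1 join_left)
    ultimately have "P x ((y \<squnion> z) \<squnion> x)"
      using c P(1) trans[of x "x \<squnion> y" "(y \<squnion> z) \<squnion> x"] by (simp add: join_left)
    moreover have "x \<squnion> z \<sqsubseteq> (y \<squnion> z) \<squnion> x"
      using c by (simp add: join_le_iff join_right le_joinI1)
    ultimately show ?thesis
      using c shrink[of x "x \<squnion> z" "(y \<squnion> z) \<squnion> x"] by (simp add: join_left)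
  qed
  show ?thesis
  proof (rule lattice_congruenceI; clarsimp)
    show "P x (x \<squnion> x)" if "x \<in> carrier L" for x using that refl by (simp add: join_idem)
    show "P y (y \<squnion> x) \<and> P x (y \<squnion> x)" if "P x (x \<squnion> y)" "P y (x \<squnion> y)" for x y
      using that by (simp add: join_commute)
    show "P x (x \<squnion> z) \<and> P z (x \<squnion> z)"
      if "x \<in> carrier L" "y \<in> carrier L" "z \<in> carrier L"
        "P x (x \<squnion> y)" "P y (x \<squnion> y)" "P y (y \<squnion> z)" "P z (y \<squnion> z)" for x y z
      using that tr[of x y z] tr[of z y x] by (simp add: join_commute)
    fix x y t assume c: "x \<in> carrier L" "y \<in> carrier L" "t \<in> carrier L"
      and P: "P x (x \<squnion> y)" "P y (x \<squnion> y)"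
    have eq: "(x \<squnion> t) \<squnion> (y \<squnion> t) = (x \<squnion> y) \<squnion> t"
      using c by (intro le_antisym)
        (simp_all add: join_le_iff join_left join_right le_joinI1 le_joinI2)
    show "P (x \<squnion> t) (x \<squnion> t \<squnion> (y \<squnion> t)) \<and> P (y \<squnion> t) (x \<squnion> t \<squnion> (y \<squnion> t))"
      unfolding eq using c P join by (simp add: join_left join_right)
    have le: "(x \<sqinter> t) \<squnion> (y \<sqinter> t) \<sqsubseteq> (x \<squnion> y) \<sqinter> t"
      using c by (simp add: join_le_iff join_left join_right meet_mono)
    have "P (x \<sqinter> t) ((x \<squnion> y) \<sqinter> t)" "P (y \<sqinter> t) ((x \<squnion> y) \<sqinter> t)"
      using c P meet by (simp_all add: join_left join_right)
    then show "P (x \<sqinter> t) ((x \<sqinter> t) \<squnion> (y \<sqinter> t)) \<and> P (y \<sqinter> t) ((x \<sqinter> t) \<squnion> (y \<sqinter> t))"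
      using c le shrink[OF _ _ _ join_left le] shrink[OF _ _ _ join_right le] by simp
  qed
qed

text \<open>The join of two congruences is the transitive closure of their union.\<close>

lemma con_span_Un:
  assumes \<phi>: "lattice_congruence L \<phi>" and \<psi>: "lattice_congruence L \<psi>"
  shows "con.span (\<phi> \<union> \<psi>) = (\<phi> \<union> \<psi>)\<^sup>+"
proof (rule subset_antisym)
  have cl: "lattice_congruence L ((\<phi> \<union> \<psi>)\<^sup>+)"
  proof (rule lattice_congruenceI)
    show "x \<in> carrier L \<and> y \<in> carrier L" if "(x, y) \<in> (\<phi> \<union> \<psi>)\<^sup>+" for x y
      using trancl_subset_Sigma[of "\<phi> \<union> \<psi>" "carrier L"] con_subset \<phi> \<psi> that by blast
    show "(x, x) \<in> (\<phi> \<union> \<psi>)\<^sup>+" if "x \<in> carrier L" for x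
      using con_refl[OF \<phi> that] by blast
    have "sym (\<phi> \<union> \<psi>)" using con_sym[OF \<phi>] con_sym[OF \<psi>] by (auto intro!: symI)
    then show "(y, x) \<in> (\<phi> \<union> \<psi>)\<^sup>+" if "(x, y) \<in> (\<phi> \<union> \<psi>)\<^sup>+" for x y
      using that sym_trancl by (metis symD)
    show "(x, z) \<in> (\<phi> \<union> \<psi>)\<^sup>+" if "(x, y) \<in> (\<phi> \<union> \<psi>)\<^sup>+" "(y, z) \<in> (\<phi> \<union> \<psi>)\<^sup>+" for x y z
      using that by (rule trancl_trans)
    fix x y t assume xy: "(x, y) \<in> (\<phi> \<union> \<psi>)\<^sup>+" and t: "t \<in> carrier L"
    have step: "(u \<squnion> t, v \<squnion> t) \<in> \<phi> \<union> \<psi>" "(u \<sqinter> t, v \<sqinter> t) \<in> \<phi> \<union> \<psi>" if "(u, v) \<in> \<phi> \<union> \<psi>" for u v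
      using that \<phi> \<psi> t by (auto intro: con_join_right con_meet_right)
    from xy show "(x \<squnion> t, y \<squnion> t) \<in> (\<phi> \<union> \<psi>)\<^sup>+"
      by (induction rule: trancl_induct) (simp_all only: r_into_trancl step(1) trancl_into_trancl[OF _ step(1)])
    from xy show "(x \<sqinter> t, y \<sqinter> t) \<in> (\<phi> \<union> \<psi>)\<^sup>+"
      by (induction rule: trancl_induct) (simp_all only: r_into_trancl step(2) trancl_into_trancl[OF _ step(2)])
  qed
  have "\<phi> \<union> \<psi> \<subseteq> (\<phi> \<union> \<psi>)\<^sup>+" by (rule subrelI) (rule r_into_trancl)
  then show "con.span (\<phi> \<union> \<psi>) \<subseteq> (\<phi> \<union> \<psi>)\<^sup>+"
    unfolding con.span_subset_iff[OF cl] .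
  have U: "\<phi> \<union> \<psi> \<subseteq> carrier L \<times> carrier L" using con_subset \<phi> \<psi> by simp
  show "(\<phi> \<union> \<psi>)\<^sup>+ \<subseteq> con.span (\<phi> \<union> \<psi>)"
  proof clarify
    fix x y assume "(x, y) \<in> (\<phi> \<union> \<psi>)\<^sup>+"
    then show "(x, y) \<in> con.span (\<phi> \<union> \<psi>)"
    proof (induction rule: trancl_induct)
      case (base y)
      then show ?case by (rule subsetD[OF con.span_superset])
    next
      case (step y z)
      then show ?case
        using con_trans[OF con.closed_span[OF U]] subsetD[OF con.span_superset] by metis
    qed
  qed
qed

text \<open>
  Congruence lattices are distributive: a chain of steps from \<open>\<phi>\<close> and \<open>\<psi>\<close> that connects \<open>x\<close> to
  \<open>y\<close> can be pushed into the interval between \<open>x \<sqinter> y\<close> and \<open>x \<squnion> y\<close>, all of which lies in one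
  class of \<open>\<theta>\<close>.
\<close>

lemma con_distrib:
  assumes \<theta>: "lattice_congruence L \<theta>" and \<phi>: "lattice_congruence L \<phi>" and \<psi>: "lattice_congruence L \<psi>"
  shows "\<theta> \<inter> con.span (\<phi> \<union> \<psi>) \<subseteq> con.span ((\<theta> \<inter> \<phi>) \<union> (\<theta> \<inter> \<psi>))"
proof clarify
  fix x y assume xy: "(x, y) \<in> \<theta>" and "(x, y) \<in> con.span (\<phi> \<union> \<psi>)"
  then have chain: "(x, y) \<in> (\<phi> \<union> \<psi>)\<^sup>+" by (simp add: con_span_Un[OF \<phi> \<psi>])
  have [simp]: "x \<in> carrier L" "y \<in> carrier L" using con_carrier[OF \<theta> xy] by auto
  define \<sigma> where "\<sigma> = con.span ((\<theta> \<inter> \<phi>) \<union> (\<theta> \<inter> \<psi>))"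
  have \<sigma>: "lattice_congruence L \<sigma>"
    unfolding \<sigma>_def by (rule con.closed_span) (use con_subset \<phi> \<psi> in blast)
  have sub: "\<theta> \<inter> (\<phi> \<union> \<psi>) \<subseteq> \<sigma>"
    unfolding \<sigma>_def using con.span_superset[of "(\<theta> \<inter> \<phi>) \<union> (\<theta> \<inter> \<psi>)"] by blast
  define m where "m z = (z \<squnion> (x \<sqinter> y)) \<sqinter> (x \<squnion> y)" for z
  have m_\<theta>: "(m z, x \<squnion> y) \<in> \<theta>" if z: "z \<in> carrier L" for z
  proof -
    have "(x \<sqinter> y, x \<squnion> y) \<in> \<theta>" using xy by (simp flip: con_mem_iff[OF \<theta>])
    then have "((z \<squnion> (x \<sqinter> y)) \<sqinter> (x \<squnion> y), (z \<squnion> (x \<squnion> y)) \<sqinter> (x \<squnion> y)) \<in> \<theta>"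
      using con_join[OF \<theta> con_refl[OF \<theta> z]] con_meet_right[OF \<theta>] by simp
    moreover have "(z \<squnion> (x \<squnion> y)) \<sqinter> (x \<squnion> y) = x \<squnion> y"
      using z by (intro meet_eqI') (auto intro: join_right)
    ultimately show ?thesis unfolding m_def by simp
  qed
  have step: "(m u, m v) \<in> \<sigma>" if uv: "(u, v) \<in> \<phi> \<union> \<psi>" for u v
  proof -
    have c: "u \<in> carrier L" "v \<in> carrier L" using uv con_carrier[OF \<phi>] con_carrier[OF \<psi>] by blast+
    have "(m u, m v) \<in> \<phi> \<union> \<psi>"
      unfolding m_def
      using uv con_meet_right[OF \<phi> con_join_right[OF \<phi>]] con_meet_right[OF \<psi> con_join_right[OF \<psi>]]
      by (elim UnE) simp_all
    moreover have "(m u, m v) \<in> \<theta>"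
      using m_\<theta> c con_sym[OF \<theta>] con_trans[OF \<theta>] by blast
    ultimately show ?thesis using sub by blast
  qed
  from chain have "(m x, m y) \<in> \<sigma>"
    by (induction rule: trancl_induct) (rule step, assumption, rule con_trans[OF \<sigma>], assumption, rule step)
  moreover have "x \<squnion> (x \<sqinter> y) = x" "y \<squnion> (x \<sqinter> y) = y"
    using join_eqI[of "x \<sqinter> y" x] join_eqI[of "x \<sqinter> y" y] join_commute
    by (simp_all add: meet_left meet_right)
  then have "m x = x" "m y = y"
    unfolding m_def by (simp_all add: meet_eqI join_left join_right)
  ultimately show "(x, y) \<in> con.span ((\<theta> \<inter> \<phi>) \<union> (\<theta> \<inter> \<psi>))" unfolding \<sigma>_def by simp
qed

end

section \<open>Separating a pair of compact congruences from a bi-ideal\<close>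

text \<open>
  The form in which distributivity is used below: replacing \<open>\<phi>\<close> by its part inside \<open>\<alpha>\<close> does not
  spoil an inclusion of \<open>\<alpha>\<close> in a join.
\<close>

lemma (in zero_lattice) con_distrib_absorb:
  assumes \<alpha>: "lattice_congruence L \<alpha>" and \<phi>: "lattice_congruence L \<phi>"
    and Y: "Y \<subseteq> carrier L \<times> carrier L" and sub: "\<alpha> \<subseteq> con.span (\<phi> \<union> Y)"
  shows "\<alpha> \<subseteq> con.span ((\<alpha> \<inter> \<phi>) \<union> Y)"
proof -
  have "con.span (\<phi> \<union> Y) \<subseteq> con.span (\<phi> \<union> con.span Y)"
    using con.span_superset by (intro con.span_mono) blast
  then have "\<alpha> \<subseteq> \<alpha> \<inter> con.span (\<phi> \<union> con.span Y)" using sub by blast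
  also have "\<dots> \<subseteq> con.span ((\<alpha> \<inter> \<phi>) \<union> (\<alpha> \<inter> con.span Y))"
    by (rule con_distrib[OF \<alpha> \<phi> con.closed_span[OF Y]])
  also have "\<dots> \<subseteq> con.span (con.span (\<alpha> \<inter> \<phi>) \<union> con.span Y)"
    using con.span_superset by (intro con.span_mono) blast
  also have "\<dots> = con.span ((\<alpha> \<inter> \<phi>) \<union> Y)" by (rule con.span_Un)
  finally show ?thesis .
qed

text \<open>
  Two lattices with zero; names prefixed by \<open>CC\<close> refer to bi-ideals of the semilattices of compact
  congruences.
\<close>

locale lattice_pair = A: zero_lattice A + B: zero_lattice B
  for A :: "'a gorder" and B :: "'b gorder"

sublocale lattice_pair \<subseteq> semilattice_pair A B ..

sublocale lattice_pair \<subseteq> CC: semilattice_pair "Con_c A" "Con_c B"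
  by (intro semilattice_pair.intro A.zero_semilattice_Con_c B.zero_semilattice_Con_c)

context lattice_pair
begin

text \<open>
  Congruences, generated congruences, and compact congruences of the two factors.
\<close>

abbreviation "congA \<equiv> lattice_congruence A"
abbreviation "congB \<equiv> lattice_congruence B"
abbreviation "spanA \<equiv> A.con.span"
abbreviation "spanB \<equiv> B.con.span"
abbreviation "ConcA \<equiv> A.con.fin_gen"
abbreviation "ConcB \<equiv> B.con.fin_gen"

text \<open>
  A bi-ideal \<open>J\<close> of compact congruences extends to pairs of arbitrary congruences: \<open>(\<gamma>, \<delta>)\<close>
  belongs to the extension iff all pairs of compact congruences below it belong to \<open>J\<close>. The
  extension lives on distributive lattices, where meets are available.
\<close>

definition below :: "(('a \<times> 'a) set \<times> ('b \<times> 'b) set) set \<Rightarrow> ('a \<times> 'a) set \<Rightarrow> ('b \<times> 'b) set \<Rightarrow> bool" where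
  "below J \<gamma> \<delta> \<longleftrightarrow> (\<forall>\<alpha>\<in>ConcA. \<forall>\<beta>\<in>ConcB. \<alpha> \<subseteq> \<gamma> \<longrightarrow> \<beta> \<subseteq> \<delta> \<longrightarrow> (\<alpha>, \<beta>) \<in> J)"

lemma below_mono: "below J \<gamma> \<delta> \<Longrightarrow> \<gamma>' \<subseteq> \<gamma> \<Longrightarrow> \<delta>' \<subseteq> \<delta> \<Longrightarrow> below J \<gamma>' \<delta>'"
  unfolding below_def by (meson subset_trans)

lemma below_join_left:
  assumes J: "bi_ideal (Con_c A) (Con_c B) J" and c: "congA \<gamma>" "congA \<gamma>'"
    and b: "below J \<gamma> \<delta>" "below J \<gamma>' \<delta>"
  shows "below J (spanA (\<gamma> \<union> \<gamma>')) \<delta>"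
  unfolding below_def
proof (intro ballI impI)
  fix \<alpha> \<beta>
  assume \<alpha>: "\<alpha> \<in> ConcA" "\<alpha> \<subseteq> spanA (\<gamma> \<union> \<gamma>')" and \<beta>: "\<beta> \<in> ConcB" "\<beta> \<subseteq> \<delta>"
  obtain F where F: "finite F" "\<alpha> = spanA F" "F \<subseteq> \<alpha>" using \<alpha>(1) by (rule A.con.fin_genE)
  have U: "\<gamma> \<union> \<gamma>' \<subseteq> carrier A \<times> carrier A" using c A.con_subset by simp
  have "F \<subseteq> spanA (\<gamma> \<union> \<gamma>')" using F(3) \<alpha>(2) by (rule subset_trans)
  then obtain G where G: "finite G" "G \<subseteq> \<gamma> \<union> \<gamma>'" "F \<subseteq> spanA G"
    using A.con.span_finitary[OF U F(1)] by metis
  have fg: "spanA (G \<inter> \<gamma>) \<in> ConcA" "spanA (G \<inter> \<gamma>') \<in> ConcA"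
    using G U by (auto intro!: A.con.fin_genI)
  moreover have "spanA (G \<inter> \<gamma>) \<subseteq> \<gamma>" "spanA (G \<inter> \<gamma>') \<subseteq> \<gamma>'"
    using c by (simp_all add: A.con.span_subset_iff)
  ultimately have "(spanA (G \<inter> \<gamma>), \<beta>) \<in> J" "(spanA (G \<inter> \<gamma>'), \<beta>) \<in> J"
    using b \<beta> unfolding below_def by blast+
  then have J': "(spanA (spanA (G \<inter> \<gamma>) \<union> spanA (G \<inter> \<gamma>')), \<beta>) \<in> J"
    using CC.bi_ideal_join_left[OF J] fg by (simp flip: A.join_Con_c)
  have "(G \<inter> \<gamma>) \<union> (G \<inter> \<gamma>') = G" using G(2) by blast
  then have eq: "spanA (spanA (G \<inter> \<gamma>) \<union> spanA (G \<inter> \<gamma>')) = spanA G"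
    unfolding A.con.span_Un by simp
  have "G \<subseteq> carrier A \<times> carrier A" using G(2) U by (rule subset_trans)
  then have "\<alpha> \<subseteq> spanA G"
    unfolding F(2) using G(3) by (simp add: A.con.span_subset_iff A.con.closed_span)
  then show "(\<alpha>, \<beta>) \<in> J"
    using CC.bi_ideal_le[OF J J'] \<alpha>(1) \<beta>(1) unfolding eq by simp
qed

lemma below_join_right:
  assumes J: "bi_ideal (Con_c A) (Con_c B) J" and c: "congB \<delta>" "congB \<delta>'"
    and b: "below J \<gamma> \<delta>" "below J \<gamma> \<delta>'"
  shows "below J \<gamma> (spanB (\<delta> \<union> \<delta>'))"
  unfolding below_def
proof (intro ballI impI)
  fix \<alpha> \<beta>
  assume \<alpha>: "\<alpha> \<in> ConcA" "\<alpha> \<subseteq> \<gamma>" and \<beta>: "\<beta> \<in> ConcB" "\<beta> \<subseteq> spanB (\<delta> \<union> \<delta>')"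
  obtain F where F: "finite F" "\<beta> = spanB F" "F \<subseteq> \<beta>" using \<beta>(1) by (rule B.con.fin_genE)
  have U: "\<delta> \<union> \<delta>' \<subseteq> carrier B \<times> carrier B" using c B.con_subset by simp
  have "F \<subseteq> spanB (\<delta> \<union> \<delta>')" using F(3) \<beta>(2) by (rule subset_trans)
  then obtain G where G: "finite G" "G \<subseteq> \<delta> \<union> \<delta>'" "F \<subseteq> spanB G"
    using B.con.span_finitary[OF U F(1)] by metis
  have fg: "spanB (G \<inter> \<delta>) \<in> ConcB" "spanB (G \<inter> \<delta>') \<in> ConcB"
    using G U by (auto intro!: B.con.fin_genI)
  moreover have "spanB (G \<inter> \<delta>) \<subseteq> \<delta>" "spanB (G \<inter> \<delta>') \<subseteq> \<delta>'"
    using c by (simp_all add: B.con.span_subset_iff)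
  ultimately have "(\<alpha>, spanB (G \<inter> \<delta>)) \<in> J" "(\<alpha>, spanB (G \<inter> \<delta>')) \<in> J"
    using b \<alpha> unfolding below_def by blast+
  then have J': "(\<alpha>, spanB (spanB (G \<inter> \<delta>) \<union> spanB (G \<inter> \<delta>'))) \<in> J"
    using CC.bi_ideal_join_right[OF J] fg by (simp flip: B.join_Con_c)
  have "(G \<inter> \<delta>) \<union> (G \<inter> \<delta>') = G" using G(2) by blast
  then have eq: "spanB (spanB (G \<inter> \<delta>) \<union> spanB (G \<inter> \<delta>')) = spanB G"
    unfolding B.con.span_Un by simp
  have "G \<subseteq> carrier B \<times> carrier B" using G(2) U by (rule subset_trans)
  then have "\<beta> \<subseteq> spanB G"
    unfolding F(2) using G(3) by (simp add: B.con.span_subset_iff B.con.closed_span)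
  then show "(\<alpha>, \<beta>) \<in> J"
    using CC.bi_ideal_le[OF J J'] \<beta>(1) \<alpha>(1) unfolding eq by simp
qed

text \<open>
  The combinatorial core. Let \<open>F \<subseteq> J\<close> be finite, and suppose that no \<open>X \<subseteq> F\<close> separates \<open>(\<alpha>, \<beta>)\<close>
  from \<open>F\<close>: always \<open>\<alpha>\<close> is below the join of the first components in \<open>X\<close>, or \<open>\<beta>\<close> is below the join
  of the second components outside \<open>X\<close>. Then \<open>(\<alpha>, \<beta>)\<close> belongs to the extension of \<open>J\<close>. The induction
  needs parameters \<open>\<gamma>\<close> and \<open>\<delta>\<close> added to these joins, with \<open>(\<gamma>, \<beta>)\<close> and \<open>(\<alpha>, \<delta>)\<close> in the extension.
  A further pair \<open>(\<sigma>, \<tau>)\<close> is used twice: enlarging \<open>\<gamma>\<close> by \<open>\<alpha> \<inter> \<sigma>\<close> and cutting \<open>\<beta>\<close> down to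
  \<open>\<beta>' = \<beta> \<inter> (\<delta> \<squnion> \<tau>)\<close> yields \<open>(\<alpha>, \<beta>')\<close>, and then \<open>\<beta>'\<close> can take the place of \<open>\<delta>\<close>.
\<close>

lemma below_if_no_separation:
  assumes J: "bi_ideal (Con_c A) (Con_c B) J" and "finite F" "F \<subseteq> J"
    and "congA \<alpha>" "congB \<beta>" "congA \<gamma>" "congB \<delta>" "below J \<gamma> \<beta>" "below J \<alpha> \<delta>"
    and "\<And>X. X \<subseteq> F \<Longrightarrow> \<alpha> \<subseteq> spanA (\<gamma> \<union> \<Union>(fst ` X)) \<or> \<beta> \<subseteq> spanB (\<delta> \<union> \<Union>(snd ` (F - X)))"
  shows "below J \<alpha> \<beta>"
  using assms(2-)
proof (induction F arbitrary: \<alpha> \<beta> \<gamma> \<delta> rule: finite_induct)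
  case empty
  from empty.prems(8)[of "{}"] have "\<alpha> \<subseteq> \<gamma> \<or> \<beta> \<subseteq> \<delta>"
    using empty.prems by (simp add: A.con.span_closed B.con.span_closed)
  then show ?case using below_mono empty.prems(6,7) by blast
next
  case (insert s F)
  note \<alpha> = \<open>congA \<alpha>\<close> and \<beta> = \<open>congB \<beta>\<close> and \<gamma> = \<open>congA \<gamma>\<close> and \<delta> = \<open>congB \<delta>\<close>
  obtain \<sigma> \<tau> where s: "s = (\<sigma>, \<tau>)" by (cases s)
  have \<sigma>\<tau>: "(\<sigma>, \<tau>) \<in> J" and "F \<subseteq> J" using insert.prems(1) s by auto
  have FU: "F \<subseteq> ConcA \<times> ConcB" and "\<sigma> \<in> ConcA" "\<tau> \<in> ConcB"
    using CC.bi_ideal_subset[OF J] insert.prems(1) s by auto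
  then have \<sigma>: "congA \<sigma>" and \<tau>: "congB \<tau>"
    by (simp_all add: A.con.fin_gen_closed B.con.fin_gen_closed)
  have b_\<sigma>\<tau>: "below J \<sigma> \<tau>"
    unfolding below_def using CC.bi_ideal_le[OF J \<sigma>\<tau>] by simp
  have cF: "fst p \<subseteq> carrier A \<times> carrier A \<and> snd p \<subseteq> carrier B \<times> carrier B" if "p \<in> F" for p
    using subsetD[OF FU that] A.con_subset[OF A.con.fin_gen_closed, of "fst p"]
      B.con_subset[OF B.con.fin_gen_closed, of "snd p"] by (simp add: mem_Times_iff)
  have UA: "\<Union>(fst ` X) \<subseteq> carrier A \<times> carrier A" if "X \<subseteq> F" for X
    by (rule UN_least) (use cF that in blast)
  have UB: "\<Union>(snd ` (F - X)) \<subseteq> carrier B \<times> carrier B" for X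
    by (rule UN_least) (use cF in blast)
  define \<gamma>' where "\<gamma>' = spanA (\<gamma> \<union> (\<alpha> \<inter> \<sigma>))"
  define \<beta>' where "\<beta>' = \<beta> \<inter> spanB (\<delta> \<union> \<tau>)"
  have c: "congA (\<alpha> \<inter> \<sigma>)" "congB (spanB (\<delta> \<union> \<tau>))"
    using \<alpha> \<sigma> \<delta> \<tau> A.con.closed_Int B.con.closed_span B.con_subset by simp_all
  then have \<gamma>': "congA \<gamma>'" and \<beta>': "congB \<beta>'"
    unfolding \<gamma>'_def \<beta>'_def using \<gamma> \<beta> A.con_subset A.con.closed_span B.con.closed_Int by simp_all
  have "below J (\<alpha> \<inter> \<sigma>) (spanB (\<delta> \<union> \<tau>))"
    using below_join_right[OF J \<delta> \<tau>] below_mono[OF \<open>below J \<alpha> \<delta>\<close>] below_mono[OF b_\<sigma>\<tau>] by simp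
  then have "below J (\<alpha> \<inter> \<sigma>) \<beta>'" unfolding \<beta>'_def by (rule below_mono) auto
  moreover have "below J \<gamma> \<beta>'" using \<open>below J \<gamma> \<beta>\<close> unfolding \<beta>'_def by (rule below_mono) auto
  ultimately have b\<gamma>'\<beta>': "below J \<gamma>' \<beta>'"
    unfolding \<gamma>'_def using below_join_left[OF J \<gamma> c(1)] by blast
  have b\<alpha>\<beta>': "below J \<alpha> \<beta>'"
  proof (rule insert.IH[OF \<open>F \<subseteq> J\<close> \<alpha> \<beta>' \<gamma>' \<delta> b\<gamma>'\<beta>' \<open>below J \<alpha> \<delta>\<close>])
    fix X assume X: "X \<subseteq> F"
    have "insert s F - insert s X = F - X" using \<open>s \<notin> F\<close> by blast
    then consider "\<alpha> \<subseteq> spanA (\<gamma> \<union> \<Union>(fst ` insert s X))" | "\<beta> \<subseteq> spanB (\<delta> \<union> \<Union>(snd ` (F - X)))"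
      using insert.prems(8)[of "insert s X"] X by auto
    then show "\<alpha> \<subseteq> spanA (\<gamma>' \<union> \<Union>(fst ` X)) \<or> \<beta>' \<subseteq> spanB (\<delta> \<union> \<Union>(snd ` (F - X)))"
    proof cases
      case 1
      have "\<gamma> \<union> \<Union>(fst ` insert s X) = \<sigma> \<union> (\<gamma> \<union> \<Union>(fst ` X))" unfolding s by auto
      then have "\<alpha> \<subseteq> spanA ((\<alpha> \<inter> \<sigma>) \<union> (\<gamma> \<union> \<Union>(fst ` X)))"
        using 1 A.con_subset[OF \<gamma>] UA[OF X] by (intro A.con_distrib_absorb[OF \<alpha> \<sigma>]) auto
      also have "\<dots> \<subseteq> spanA (\<gamma>' \<union> \<Union>(fst ` X))"
        unfolding \<gamma>'_def using A.con.span_superset[of "\<gamma> \<union> (\<alpha> \<inter> \<sigma>)"] by (intro A.con.span_mono) blast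
      finally show ?thesis ..
    next
      case 2
      then show ?thesis unfolding \<beta>'_def by blast
    qed
  qed
  show ?case
  proof (rule insert.IH[OF \<open>F \<subseteq> J\<close> \<alpha> \<beta> \<gamma> \<beta>' \<open>below J \<gamma> \<beta>\<close> b\<alpha>\<beta>'])
    fix X assume X: "X \<subseteq> F"
    then consider "\<alpha> \<subseteq> spanA (\<gamma> \<union> \<Union>(fst ` X))" | "\<beta> \<subseteq> spanB (\<delta> \<union> \<Union>(snd ` (insert s F - X)))"
      using insert.prems(8)[of X] by blast
    then show "\<alpha> \<subseteq> spanA (\<gamma> \<union> \<Union>(fst ` X)) \<or> \<beta> \<subseteq> spanB (\<beta>' \<union> \<Union>(snd ` (F - X)))"
    proof cases
      case 2
      have "\<delta> \<union> \<Union>(snd ` (insert s F - X)) \<subseteq> spanB (\<delta> \<union> \<tau>) \<union> \<Union>(snd ` (F - X))"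
        using B.con.span_superset[of "\<delta> \<union> \<tau>"] unfolding s by auto
      then have "\<beta> \<subseteq> spanB (spanB (\<delta> \<union> \<tau>) \<union> \<Union>(snd ` (F - X)))"
        using 2 B.con.span_mono by (meson subset_trans)
      then have "\<beta> \<subseteq> spanB (\<beta>' \<union> \<Union>(snd ` (F - X)))"
        unfolding \<beta>'_def by (rule B.con_distrib_absorb[OF \<beta> c(2) UB])
      then show ?thesis ..
    qed simp
  qed
qed

text \<open>
  By the previous lemma some \<open>X \<subseteq> F\<close> separates \<open>(\<alpha>, \<beta>)\<close> from \<open>F\<close>; then \<open>P\<close> is the join of
  the first components in \<open>X\<close>, and \<open>Q\<close> the join of the second components outside \<open>X\<close>.
\<close>

lemma separation:
  assumes J: "bi_ideal (Con_c A) (Con_c B) J" and F: "finite F" "F \<subseteq> J"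
    and \<alpha>: "\<alpha> \<in> ConcA" and \<beta>: "\<beta> \<in> ConcB" and notin: "(\<alpha>, \<beta>) \<notin> J"
  obtains P Q where "congA P" "congB Q" "\<not> \<alpha> \<subseteq> P" "\<not> \<beta> \<subseteq> Q"
    "\<And>\<sigma> \<tau>. (\<sigma>, \<tau>) \<in> F \<Longrightarrow> \<sigma> \<subseteq> P \<or> \<tau> \<subseteq> Q"
proof -
  have b1: "below J (spanA {}) \<beta>"
    unfolding below_def
  proof (intro ballI impI)
    fix \<alpha>' \<beta>' assume *: "\<alpha>' \<in> ConcA" "\<beta>' \<in> ConcB" "\<alpha>' \<subseteq> spanA {}"
    have "spanA {} \<subseteq> \<alpha>'" using * by (simp add: A.con.span_subset_iff A.con.fin_gen_closed)
    then have "\<alpha>' = \<bottom>\<^bsub>Con_c A\<^esub>" using * by (simp add: A.bottom_Con_c A.con_span_empty)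
    then show "(\<alpha>', \<beta>') \<in> J" using CC.bi_ideal_bottom_left[OF J] * by simp
  qed
  have b2: "below J \<alpha> (spanB {})"
    unfolding below_def
  proof (intro ballI impI)
    fix \<alpha>' \<beta>' assume *: "\<alpha>' \<in> ConcA" "\<beta>' \<in> ConcB" "\<beta>' \<subseteq> spanB {}"
    have "spanB {} \<subseteq> \<beta>'" using * by (simp add: B.con.span_subset_iff B.con.fin_gen_closed)
    then have "\<beta>' = \<bottom>\<^bsub>Con_c B\<^esub>" using * by (simp add: B.bottom_Con_c B.con_span_empty)
    then show "(\<alpha>', \<beta>') \<in> J" using CC.bi_ideal_bottom_right[OF J] * by simp
  qed
  have "\<exists>X\<subseteq>F. \<not> \<alpha> \<subseteq> spanA (spanA {} \<union> \<Union>(fst ` X)) \<and> \<not> \<beta> \<subseteq> spanB (spanB {} \<union> \<Union>(snd ` (F - X)))"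
  proof (rule ccontr)
    assume "\<not> ?thesis"
    then have *: "\<alpha> \<subseteq> spanA (spanA {} \<union> \<Union>(fst ` X)) \<or> \<beta> \<subseteq> spanB (spanB {} \<union> \<Union>(snd ` (F - X)))"
      if "X \<subseteq> F" for X using that by blast
    have "below J \<alpha> \<beta>"
      by (rule below_if_no_separation[OF J F A.con.fin_gen_closed[OF \<alpha>] B.con.fin_gen_closed[OF \<beta>]
          A.con.closed_span[OF empty_subsetI] B.con.closed_span[OF empty_subsetI] b1 b2 *])
    then show False using \<alpha> \<beta> notin unfolding below_def by blast
  qed
  then obtain X where X: "X \<subseteq> F" "\<not> \<alpha> \<subseteq> spanA (spanA {} \<union> \<Union>(fst ` X))"
    "\<not> \<beta> \<subseteq> spanB (spanB {} \<union> \<Union>(snd ` (F - X)))" by blast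
  show thesis
  proof (rule that)
    have FU: "F \<subseteq> ConcA \<times> ConcB" using F CC.bi_ideal_subset[OF J] by auto
    have cF: "fst p \<subseteq> carrier A \<times> carrier A \<and> snd p \<subseteq> carrier B \<times> carrier B" if "p \<in> F" for p
      using subsetD[OF FU that] A.con_subset[OF A.con.fin_gen_closed, of "fst p"]
        B.con_subset[OF B.con.fin_gen_closed, of "snd p"] by (simp add: mem_Times_iff)
    have "\<Union>(fst ` X) \<subseteq> carrier A \<times> carrier A"
      by (rule UN_least) (use cF X(1) in blast)
    then have "spanA {} \<union> \<Union>(fst ` X) \<subseteq> carrier A \<times> carrier A"
      using A.con.span_subset_carrier[of "{}"] by simp
    then show "congA (spanA (spanA {} \<union> \<Union>(fst ` X)))" by (rule A.con.closed_span)
    have "\<Union>(snd ` (F - X)) \<subseteq> carrier B \<times> carrier B"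
      by (rule UN_least) (use cF in blast)
    then have "spanB {} \<union> \<Union>(snd ` (F - X)) \<subseteq> carrier B \<times> carrier B"
      using B.con.span_subset_carrier[of "{}"] by simp
    then show "congB (spanB (spanB {} \<union> \<Union>(snd ` (F - X))))" by (rule B.con.closed_span)
    fix \<sigma> \<tau> assume \<sigma>\<tau>: "(\<sigma>, \<tau>) \<in> F"
    have "\<sigma> \<subseteq> \<Union>(fst ` X)" if "(\<sigma>, \<tau>) \<in> X" using that by force
    moreover have "\<tau> \<subseteq> \<Union>(snd ` (F - X))" if "(\<sigma>, \<tau>) \<notin> X" using that \<sigma>\<tau> by force
    ultimately show "\<sigma> \<subseteq> spanA (spanA {} \<union> \<Union>(fst ` X)) \<or> \<tau> \<subseteq> spanB (spanB {} \<union> \<Union>(snd ` (F - X)))"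
      using A.con.span_superset[of "spanA {} \<union> \<Union>(fst ` X)"]
        B.con.span_superset[of "spanB {} \<union> \<Union>(snd ` (F - X))"] by blast
  qed (use X in auto)
qed

end

section \<open>The congruence \<open>\<alpha> \<odot> \<beta>\<close>\<close>

text \<open>
  A family of intervals of \<open>T\<close> indexed by the intervals of \<open>L\<close>: to \<open>x \<le> y\<close> belongs the interval
  from \<open>f x \<squnion> g y\<close> to \<open>f y\<close>. If \<open>f\<close> and \<open>g\<close> preserve joins, \<open>g \<le> f\<close>, and meets with values of \<open>f\<close>
  can be computed in \<open>L\<close>, the intervals of \<open>L\<close> whose companion is collapsed by \<open>\<psi>\<close> are those collapsed
  by a congruence of \<open>L\<close>.
\<close>

lemma slice_congruence:
  fixes L :: "'a gorder" and T :: "'b gorder"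
  assumes "zero_lattice L" and "zero_lattice T" and \<psi>: "lattice_congruence T \<psi>"
    and f [simp]: "\<And>x. x \<in> carrier L \<Longrightarrow> f x \<in> carrier T"
    and g [simp]: "\<And>x. x \<in> carrier L \<Longrightarrow> g x \<in> carrier T"
    and f_join: "\<And>x y. x \<in> carrier L \<Longrightarrow> y \<in> carrier L \<Longrightarrow> f (x \<squnion>\<^bsub>L\<^esub> y) = f x \<squnion>\<^bsub>T\<^esub> f y"
    and g_join: "\<And>x y. x \<in> carrier L \<Longrightarrow> y \<in> carrier L \<Longrightarrow> g (x \<squnion>\<^bsub>L\<^esub> y) = g x \<squnion>\<^bsub>T\<^esub> g y"
    and g_le_f: "\<And>x. x \<in> carrier L \<Longrightarrow> g x \<sqsubseteq>\<^bsub>T\<^esub> f x"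
    and distrib: "\<And>x y z. \<lbrakk>x \<in> carrier L; y \<in> carrier L; z \<in> carrier L; x \<sqsubseteq>\<^bsub>L\<^esub> y\<rbrakk> \<Longrightarrow>
      (f x \<squnion>\<^bsub>T\<^esub> g y) \<sqinter>\<^bsub>T\<^esub> f z = f (x \<sqinter>\<^bsub>L\<^esub> z) \<squnion>\<^bsub>T\<^esub> g (y \<sqinter>\<^bsub>L\<^esub> z)"
  shows "\<exists>\<theta>. lattice_congruence L \<theta> \<and> (\<forall>x\<in>carrier L. \<forall>y\<in>carrier L.
    (x, y) \<in> \<theta> \<longleftrightarrow> (f (x \<sqinter>\<^bsub>L\<^esub> y) \<squnion>\<^bsub>T\<^esub> g (x \<squnion>\<^bsub>L\<^esub> y), f (x \<squnion>\<^bsub>L\<^esub> y)) \<in> \<psi>)"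
proof -
  interpret L: zero_lattice L by fact
  interpret T: zero_lattice T by fact
  define P where "P x y \<longleftrightarrow> (f x \<squnion>\<^bsub>T\<^esub> g y, f y) \<in> \<psi>" for x y
  define \<theta> where "\<theta> = {(x, y). x \<in> carrier L \<and> y \<in> carrier L \<and>
    P x (x \<squnion>\<^bsub>L\<^esub> y) \<and> P y (x \<squnion>\<^bsub>L\<^esub> y)}"
  have fg: "f x \<squnion>\<^bsub>T\<^esub> g x = f x" if "x \<in> carrier L" for x
    using that T.join_eqI[OF _ _ g_le_f] T.join_commute[of "f x"] by simp
  have refl: "P x x" if "x \<in> carrier L" for x
    unfolding P_def using that \<psi> by (simp add: fg T.con_refl)
  have "lattice_congruence L \<theta>"
    unfolding \<theta>_def
  proof (rule L.interval_congruence[of P])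
    fix x y z
    assume c [simp]: "x \<in> carrier L" "y \<in> carrier L" "z \<in> carrier L"
      and le: "x \<sqsubseteq>\<^bsub>L\<^esub> y" "y \<sqsubseteq>\<^bsub>L\<^esub> z" and P: "P x y" "P y z"
    have "g y \<squnion>\<^bsub>T\<^esub> g z = g z" using g_join[of y z] le(2) by (simp add: L.join_eqI)
    then have "(f x \<squnion>\<^bsub>T\<^esub> g y) \<squnion>\<^bsub>T\<^esub> g z = f x \<squnion>\<^bsub>T\<^esub> g z"
      using T.join_assoc[of "f x" "g y" "g z"] by simp
    then have "(f x \<squnion>\<^bsub>T\<^esub> g z, f y \<squnion>\<^bsub>T\<^esub> g z) \<in> \<psi>"
      using T.con_join_right[OF \<psi>, of _ _ "g z"] P(1) unfolding P_def by fastforce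
    then show "P x z" using T.con_trans[OF \<psi>] P(2) unfolding P_def by blast
  next
    fix x y t
    assume c [simp]: "x \<in> carrier L" "y \<in> carrier L" "t \<in> carrier L"
      and le: "x \<sqsubseteq>\<^bsub>L\<^esub> y" and P: "P x y"
    have "(f x \<squnion>\<^bsub>T\<^esub> g y) \<squnion>\<^bsub>T\<^esub> f t = f (x \<squnion>\<^bsub>L\<^esub> t) \<squnion>\<^bsub>T\<^esub> g (y \<squnion>\<^bsub>L\<^esub> t)"
      unfolding f_join[OF c(1,3)] g_join[OF c(2,3)]
      by (rule T.le_antisym)
        (simp_all add: T.join_le_iff T.join_left T.join_right T.le_joinI1 T.le_joinI2 g_le_f)
    then show "P (x \<squnion>\<^bsub>L\<^esub> t) (y \<squnion>\<^bsub>L\<^esub> t)"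
      using T.con_join_right[OF \<psi>, of _ _ "f t"] P unfolding P_def by (fastforce simp: f_join)
    have "f y \<sqinter>\<^bsub>T\<^esub> f t = f (y \<sqinter>\<^bsub>L\<^esub> t)"
      using distrib[of y y t] by (simp add: fg)
    then show "P (x \<sqinter>\<^bsub>L\<^esub> t) (y \<sqinter>\<^bsub>L\<^esub> t)"
      using T.con_meet_right[OF \<psi>, of _ _ "f t"] P distrib[of x y t] le unfolding P_def by fastforce
  qed (rule refl)
  moreover have "(x, y) \<in> \<theta> \<longleftrightarrow> (f (x \<sqinter>\<^bsub>L\<^esub> y) \<squnion>\<^bsub>T\<^esub> g (x \<squnion>\<^bsub>L\<^esub> y), f (x \<squnion>\<^bsub>L\<^esub> y)) \<in> \<psi>"
    if c: "x \<in> carrier L" "y \<in> carrier L" for x y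
  proof -
    have "x \<sqinter>\<^bsub>L\<^esub> y \<sqsubseteq>\<^bsub>L\<^esub> x \<squnion>\<^bsub>L\<^esub> y"
      using c by (simp add: L.le_joinI1 L.meet_left)
    then have "(x \<sqinter>\<^bsub>L\<^esub> y, x \<squnion>\<^bsub>L\<^esub> y) \<in> \<theta> \<longleftrightarrow> P (x \<sqinter>\<^bsub>L\<^esub> y) (x \<squnion>\<^bsub>L\<^esub> y)"
      unfolding \<theta>_def using c refl by (simp add: L.join_eqI)
    then show ?thesis
      unfolding L.con_mem_iff[OF \<open>lattice_congruence L \<theta>\<close> c] P_def .
  qed
  ultimately show ?thesis by blast
qed

text \<open>
  The hypothesis of the embedding theorem: the tensor product is a lattice.
\<close>

locale tensor_lattice = lattice_pair +
  assumes lattice_tensor: "lattice (tensor A B)"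

sublocale tensor_lattice \<subseteq> T: zero_lattice "tensor A B"
proof -
  interpret zero_semilattice "tensor A B" by (rule zero_semilattice_tensor)
  show "zero_lattice (tensor A B)"
    by (rule zero_lattice.intro[OF lattice_tensor]) unfold_locales
qed

context tensor_lattice
begin

text \<open>
  As before, now for congruences of the tensor product.
\<close>

abbreviation "congT \<equiv> lattice_congruence (tensor A B)"
abbreviation "spanT \<equiv> T.con.span"
abbreviation "ConcT \<equiv> T.con.fin_gen"
abbreviation "pure \<equiv> pure_tensor A B"

text \<open>
  Whenever the meet of two compact bi-ideals exists it is their intersection, because every pair
  in the intersection gives a pure tensor below both.
\<close>

lemma meet_tensor:
  assumes H: "H \<in> fin_gen" and K: "K \<in> fin_gen"
  shows "H \<sqinter>\<^bsub>tensor A B\<^esub> K = H \<inter> K"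
proof (rule subset_antisym)
  have M: "H \<sqinter>\<^bsub>tensor A B\<^esub> K \<in> fin_gen" using T.meet_closed[of H K] H K by simp
  show "H \<sqinter>\<^bsub>tensor A B\<^esub> K \<subseteq> H \<inter> K"
    using T.meet_left[of H K] T.meet_right[of H K] H K by simp
  show "H \<inter> K \<subseteq> H \<sqinter>\<^bsub>tensor A B\<^esub> K"
  proof clarify
    fix x y assume xy: "(x, y) \<in> H" "(x, y) \<in> K"
    then have c: "x \<in> carrier A" "y \<in> carrier B" using bi_ideal_subset[OF fin_gen_closed[OF H]] by auto
    have "pure x y \<subseteq> H" "pure x y \<subseteq> K"
      using xy c fin_gen_closed H K by (simp_all add: pure_tensor_subset_iff)
    then have "pure x y \<subseteq> H \<sqinter>\<^bsub>tensor A B\<^esub> K"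
      using T.meet_le[of "pure x y" H K] H K c by (simp add: pure_tensor_fin_gen)
    then show "(x, y) \<in> H \<sqinter>\<^bsub>tensor A B\<^esub> K"
      using M c fin_gen_closed by (simp add: pure_tensor_subset_iff)
  qed
qed

lemma step_tensor_Int_left:
  assumes "u \<in> carrier A" "v \<in> carrier A" "w \<in> carrier A" "y' \<in> carrier B" "y \<in> carrier B"
    and "u \<sqsubseteq>\<^bsub>A\<^esub> v" "y' \<sqsubseteq>\<^bsub>B\<^esub> y"
  shows "step_tensor u v y' y \<inter> pure w y = step_tensor (u \<sqinter>\<^bsub>A\<^esub> w) (v \<sqinter>\<^bsub>A\<^esub> w) y' y"
proof (rule Set.set_eqI)
  fix p :: "'a \<times> 'b"
  obtain a b where p: "p = (a, b)" by (cases p)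
  have "b \<sqsubseteq>\<^bsub>B\<^esub> y" if "b \<in> carrier B" "b \<sqsubseteq>\<^bsub>B\<^esub> y'"
    using that assms B.le_trans by blast
  then show "p \<in> step_tensor u v y' y \<inter> pure w y \<longleftrightarrow>
      p \<in> step_tensor (u \<sqinter>\<^bsub>A\<^esub> w) (v \<sqinter>\<^bsub>A\<^esub> w) y' y"
    unfolding p Int_iff mem_step_tensor mem_pure_tensor
    using assms A.le_meet_iff[of u w a] A.le_meet_iff[of v w a] by blast
qed

lemma step_tensor_Int_right:
  assumes "u \<in> carrier B" "v \<in> carrier B" "w \<in> carrier B" "x' \<in> carrier A" "x \<in> carrier A"
    and "u \<sqsubseteq>\<^bsub>B\<^esub> v" "x' \<sqsubseteq>\<^bsub>A\<^esub> x"
  shows "step_tensor x' x u v \<inter> pure x w = step_tensor x' x (u \<sqinter>\<^bsub>B\<^esub> w) (v \<sqinter>\<^bsub>B\<^esub> w)"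
proof (rule Set.set_eqI)
  fix p :: "'a \<times> 'b"
  obtain a b where p: "p = (a, b)" by (cases p)
  have "a \<sqsubseteq>\<^bsub>A\<^esub> x" if "a \<in> carrier A" "a \<sqsubseteq>\<^bsub>A\<^esub> x'"
    using that assms A.le_trans by blast
  then show "p \<in> step_tensor x' x u v \<inter> pure x w \<longleftrightarrow>
      p \<in> step_tensor x' x (u \<sqinter>\<^bsub>B\<^esub> w) (v \<sqinter>\<^bsub>B\<^esub> w)"
    unfolding p Int_iff mem_step_tensor mem_pure_tensor
    using assms B.le_meet_iff[of u w b] B.le_meet_iff[of v w b] by blast
qed

text \<open>
  The generators of \<open>\<alpha> \<odot> \<beta>\<close>: for intervals \<open>x' \<le> x\<close> collapsed by \<open>\<alpha>\<close> and \<open>y' \<le> y\<close> collapsed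
  by \<open>\<beta>\<close>, the interval from \<open>(x' \<otimes> y) \<squnion> (x \<otimes> y')\<close> to \<open>x \<otimes> y\<close>. Arbitrary pairs enter through
  the interval between their meet and their join.
\<close>

definition corner :: "'a \<Rightarrow> 'a \<Rightarrow> 'b \<Rightarrow> 'b \<Rightarrow> ('a \<times> 'b) set \<times> ('a \<times> 'b) set" where
  "corner x' x y' y = (step_tensor (x' \<sqinter>\<^bsub>A\<^esub> x) (x' \<squnion>\<^bsub>A\<^esub> x) (y' \<sqinter>\<^bsub>B\<^esub> y) (y' \<squnion>\<^bsub>B\<^esub> y),
     pure (x' \<squnion>\<^bsub>A\<^esub> x) (y' \<squnion>\<^bsub>B\<^esub> y))"

lemma corner_le:
  assumes "x' \<in> carrier A" "x \<in> carrier A" "x' \<sqsubseteq>\<^bsub>A\<^esub> x" "y' \<in> carrier B" "y \<in> carrier B" "y' \<sqsubseteq>\<^bsub>B\<^esub> y"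
  shows "corner x' x y' y = (step_tensor x' x y' y, pure x y)"
  using assms by (simp add: corner_def A.meet_eqI B.meet_eqI A.join_eqI B.join_eqI)

lemma meet_le_joinA: "x \<in> carrier A \<Longrightarrow> y \<in> carrier A \<Longrightarrow> x \<sqinter>\<^bsub>A\<^esub> y \<sqsubseteq>\<^bsub>A\<^esub> x \<squnion>\<^bsub>A\<^esub> y"
  by (simp add: A.le_joinI1 A.meet_left)

lemma meet_le_joinB: "x \<in> carrier B \<Longrightarrow> y \<in> carrier B \<Longrightarrow> x \<sqinter>\<^bsub>B\<^esub> y \<sqsubseteq>\<^bsub>B\<^esub> x \<squnion>\<^bsub>B\<^esub> y"
  by (simp add: B.le_joinI1 B.meet_left)

text \<open>
  With one interval fixed, the pairs whose corner is collapsed by a given congruence of the tensor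
  product form a congruence.
\<close>

lemma corner_slice_left:
  assumes \<psi>: "congT \<psi>" and y: "y' \<in> carrier B" "y \<in> carrier B"
  shows "\<exists>\<theta>. congA \<theta> \<and> (\<forall>x'\<in>carrier A. \<forall>x\<in>carrier A. (x', x) \<in> \<theta> \<longleftrightarrow> corner x' x y' y \<in> \<psi>)"
proof -
  define b' b where "b' = y' \<sqinter>\<^bsub>B\<^esub> y" and "b = y' \<squnion>\<^bsub>B\<^esub> y"
  have b [simp]: "b' \<in> carrier B" "b \<in> carrier B" and le: "b' \<sqsubseteq>\<^bsub>B\<^esub> b"
    unfolding b'_def b_def using y by (simp_all add: meet_le_joinB)
  have join: "pure u b \<squnion>\<^bsub>tensor A B\<^esub> pure v b' = step_tensor u v b' b"
    if "u \<in> carrier A" "v \<in> carrier A" "u \<sqsubseteq>\<^bsub>A\<^esub> v" for u v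
    using that le by (simp add: join_tensor pure_tensor_fin_gen step_tensor_eq_span)
  have "\<exists>\<theta>. congA \<theta> \<and> (\<forall>x'\<in>carrier A. \<forall>x\<in>carrier A. (x', x) \<in> \<theta> \<longleftrightarrow>
    (pure (x' \<sqinter>\<^bsub>A\<^esub> x) b \<squnion>\<^bsub>tensor A B\<^esub> pure (x' \<squnion>\<^bsub>A\<^esub> x) b', pure (x' \<squnion>\<^bsub>A\<^esub> x) b) \<in> \<psi>)"
  proof (rule slice_congruence[OF A.zero_lattice_axioms T.zero_lattice_axioms \<psi>,
        where f = "\<lambda>x. pure x b" and g = "\<lambda>x. pure x b'"])
    show "pure x b' \<sqsubseteq>\<^bsub>tensor A B\<^esub> pure x b" if "x \<in> carrier A" for x
      using that le by (simp add: pure_tensor_subset_iff bi_ideal_pure_tensor mem_pure_tensor)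
    show "(pure u b \<squnion>\<^bsub>tensor A B\<^esub> pure v b') \<sqinter>\<^bsub>tensor A B\<^esub> pure w b =
        pure (u \<sqinter>\<^bsub>A\<^esub> w) b \<squnion>\<^bsub>tensor A B\<^esub> pure (v \<sqinter>\<^bsub>A\<^esub> w) b'"
      if "u \<in> carrier A" "v \<in> carrier A" "w \<in> carrier A" "u \<sqsubseteq>\<^bsub>A\<^esub> v" for u v w
      using that le by (simp add: join A.meet_mono meet_tensor pure_tensor_fin_gen
          step_tensor_fin_gen step_tensor_Int_left)
  qed (simp_all add: join_tensor pure_tensor_fin_gen span_pure_tensor_left)
  then show ?thesis
    by (simp add: corner_def join meet_le_joinA flip: b'_def b_def)
qed

lemma corner_slice_right:
  assumes \<psi>: "congT \<psi>" and x: "x' \<in> carrier A" "x \<in> carrier A"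
  shows "\<exists>\<theta>. congB \<theta> \<and> (\<forall>y'\<in>carrier B. \<forall>y\<in>carrier B. (y', y) \<in> \<theta> \<longleftrightarrow> corner x' x y' y \<in> \<psi>)"
proof -
  define a' a where "a' = x' \<sqinter>\<^bsub>A\<^esub> x" and "a = x' \<squnion>\<^bsub>A\<^esub> x"
  have a [simp]: "a' \<in> carrier A" "a \<in> carrier A" and le: "a' \<sqsubseteq>\<^bsub>A\<^esub> a"
    unfolding a'_def a_def using x by (simp_all add: meet_le_joinA)
  have join: "pure a u \<squnion>\<^bsub>tensor A B\<^esub> pure a' v = step_tensor a' a u v"
    if "u \<in> carrier B" "v \<in> carrier B" "u \<sqsubseteq>\<^bsub>B\<^esub> v" for u v
    using that le by (simp add: join_tensor pure_tensor_fin_gen step_tensor_eq_span Un_commute)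
  have "\<exists>\<theta>. congB \<theta> \<and> (\<forall>y'\<in>carrier B. \<forall>y\<in>carrier B. (y', y) \<in> \<theta> \<longleftrightarrow>
    (pure a (y' \<sqinter>\<^bsub>B\<^esub> y) \<squnion>\<^bsub>tensor A B\<^esub> pure a' (y' \<squnion>\<^bsub>B\<^esub> y), pure a (y' \<squnion>\<^bsub>B\<^esub> y)) \<in> \<psi>)"
  proof (rule slice_congruence[OF B.zero_lattice_axioms T.zero_lattice_axioms \<psi>,
        where f = "\<lambda>y. pure a y" and g = "\<lambda>y. pure a' y"])
    show "pure a' y \<sqsubseteq>\<^bsub>tensor A B\<^esub> pure a y" if "y \<in> carrier B" for y
      using that le by (simp add: pure_tensor_subset_iff bi_ideal_pure_tensor mem_pure_tensor)
    show "(pure a u \<squnion>\<^bsub>tensor A B\<^esub> pure a' v) \<sqinter>\<^bsub>tensor A B\<^esub> pure a w =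
        pure a (u \<sqinter>\<^bsub>B\<^esub> w) \<squnion>\<^bsub>tensor A B\<^esub> pure a' (v \<sqinter>\<^bsub>B\<^esub> w)"
      if "u \<in> carrier B" "v \<in> carrier B" "w \<in> carrier B" "u \<sqsubseteq>\<^bsub>B\<^esub> v" for u v w
      using that le by (simp add: join B.meet_mono meet_tensor pure_tensor_fin_gen
          step_tensor_fin_gen step_tensor_Int_right)
  qed (simp_all add: join_tensor pure_tensor_fin_gen span_pure_tensor_right)
  then show ?thesis
    by (simp add: corner_def join meet_le_joinB flip: a'_def a_def)
qed

text \<open>
  The congruence \<open>\<psi>\<close> collapses all corners built from pairs in \<open>X\<close> and pairs in \<open>Y\<close>.
\<close>

definition collapses :: "(('a \<times> 'b) set \<times> ('a \<times> 'b) set) set \<Rightarrow> ('a \<times> 'a) set \<Rightarrow> ('b \<times> 'b) set \<Rightarrow> bool" where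
  "collapses \<psi> X Y \<longleftrightarrow> (\<forall>(x', x)\<in>X. \<forall>(y', y)\<in>Y. corner x' x y' y \<in> \<psi>)"

lemma collapses_mono: "collapses \<psi> X Y \<Longrightarrow> X' \<subseteq> X \<Longrightarrow> Y' \<subseteq> Y \<Longrightarrow> collapses \<psi> X' Y'"
  unfolding collapses_def by blast

text \<open>
  It suffices to collapse the corners of generators: apply the slices first on the left, with a
  generator fixed on the right, and then on the right.
\<close>

lemma collapses_span:
  assumes \<psi>: "congT \<psi>" and XY: "X \<subseteq> carrier A \<times> carrier A" "Y \<subseteq> carrier B \<times> carrier B"
    and "collapses \<psi> X Y"
  shows "collapses \<psi> (spanA X) (spanB Y)"
proof -
  have left: "corner x' x y' y \<in> \<psi>" if "(x', x) \<in> spanA X" "(y', y) \<in> Y" for x' x y' y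
  proof -
    have c: "y' \<in> carrier B" "y \<in> carrier B" using that XY by auto
    obtain \<theta> where \<theta>: "congA \<theta>" "\<forall>x'\<in>carrier A. \<forall>x\<in>carrier A. (x', x) \<in> \<theta> \<longleftrightarrow> corner x' x y' y \<in> \<psi>"
      using corner_slice_left[OF \<psi> c] by blast
    have "X \<subseteq> \<theta>" using \<open>collapses \<psi> X Y\<close> that(2) XY \<theta>(2) unfolding collapses_def by blast
    then have "spanA X \<subseteq> \<theta>" by (simp add: A.con.span_subset_iff \<theta>(1))
    then show ?thesis using that(1) \<theta> A.con_carrier[OF \<theta>(1)] by blast
  qed
  have "corner x' x y' y \<in> \<psi>" if "(x', x) \<in> spanA X" "(y', y) \<in> spanB Y" for x' x y' y
  proof -
    have c: "x' \<in> carrier A" "x \<in> carrier A" using that A.con.span_subset_carrier[OF XY(1)] by auto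
    obtain \<theta> where \<theta>: "congB \<theta>" "\<forall>y'\<in>carrier B. \<forall>y\<in>carrier B. (y', y) \<in> \<theta> \<longleftrightarrow> corner x' x y' y \<in> \<psi>"
      using corner_slice_right[OF \<psi> c] by blast
    have "Y \<subseteq> \<theta>" using left[OF that(1)] XY \<theta>(2) by blast
    then have "spanB Y \<subseteq> \<theta>" by (simp add: B.con.span_subset_iff \<theta>(1))
    then show ?thesis using that(2) \<theta> B.con_carrier[OF \<theta>(1)] by blast
  qed
  then show ?thesis unfolding collapses_def by blast
qed

end

subsection \<open>The congruences \<open>\<alpha> \<box> \<beta>\<close>\<close>

context tensor_lattice
begin

text \<open>One of the two halves of the symmetric condition that defines \<open>\<alpha> \<box> \<beta>\<close>.\<close>

definition covered :: "('a \<times> 'a) set \<Rightarrow> ('b \<times> 'b) set \<Rightarrow> ('a \<times> 'b) set \<Rightarrow> ('a \<times> 'b) set \<Rightarrow> bool" where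
  "covered \<alpha> \<beta> H K \<longleftrightarrow> (\<forall>x y. (x, y) \<in> H \<longrightarrow> (\<exists>x' y'. (x', y') \<in> K \<and> (x, x') \<in> \<alpha> \<and> (y, y') \<in> \<beta>))"

lemma box_iff_covered:
  assumes \<alpha>: "congA \<alpha>" and \<beta>: "congB \<beta>"
  shows "(H, K) \<in> box A B \<alpha> \<beta> \<longleftrightarrow>
    H \<in> fin_gen \<and> K \<in> fin_gen \<and> covered \<alpha> \<beta> H K \<and> covered \<alpha> \<beta> K H"
proof -
  have s: "(u, v) \<in> \<alpha> \<longleftrightarrow> (v, u) \<in> \<alpha>" "(p, q) \<in> \<beta> \<longleftrightarrow> (q, p) \<in> \<beta>" for u v p q
    using A.con_sym[OF \<alpha>] B.con_sym[OF \<beta>] by blast+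
  have "covered \<alpha> \<beta> K H \<longleftrightarrow> (\<forall>(x', y')\<in>K. \<exists>(x, y)\<in>H. (x, x') \<in> \<alpha> \<and> (y, y') \<in> \<beta>)"
    unfolding covered_def s(1)[of _ "_"] using s by fastforce
  moreover have "covered \<alpha> \<beta> H K \<longleftrightarrow> (\<forall>(x, y)\<in>H. \<exists>(x', y')\<in>K. (x, x') \<in> \<alpha> \<and> (y, y') \<in> \<beta>)"
    unfolding covered_def by fastforce
  ultimately show ?thesis unfolding box_def by simp
qed

lemma covered_subset:
  assumes \<alpha>: "congA \<alpha>" and \<beta>: "congB \<beta>" and "H \<subseteq> carrier A \<times> carrier B" "H \<subseteq> K"
  shows "covered \<alpha> \<beta> H K"
  unfolding covered_def using assms(3,4) A.con_refl[OF \<alpha>] B.con_refl[OF \<beta>] by blast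

lemma covered_trans:
  assumes \<alpha>: "congA \<alpha>" and \<beta>: "congB \<beta>" and "covered \<alpha> \<beta> H K" "covered \<alpha> \<beta> K M"
  shows "covered \<alpha> \<beta> H M"
  using assms(3,4) A.con_trans[OF \<alpha>] B.con_trans[OF \<beta>] unfolding covered_def by meson

lemma covered_Int:
  assumes \<alpha>: "congA \<alpha>" and \<beta>: "congB \<beta>" and K: "bi_ideal A B K" "bi_ideal A B M"
    and HK: "covered \<alpha> \<beta> H K" and M: "H \<subseteq> carrier A \<times> carrier B"
  shows "covered \<alpha> \<beta> (H \<inter> M) (K \<inter> M)"
  unfolding covered_def
proof (intro allI impI)
  fix x y assume xy: "(x, y) \<in> H \<inter> M"
  then obtain x' y' where 1: "(x', y') \<in> K" "(x, x') \<in> \<alpha>" "(y, y') \<in> \<beta>"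
    using HK unfolding covered_def by blast
  have c: "x \<in> carrier A" "y \<in> carrier B" "x' \<in> carrier A" "y' \<in> carrier B"
    using 1 A.con_carrier[OF \<alpha>] B.con_carrier[OF \<beta>] by auto
  have "(x' \<sqinter>\<^bsub>A\<^esub> x, y' \<sqinter>\<^bsub>B\<^esub> y) \<in> K"
    using bi_ideal_le[OF K(1) 1(1)] c by (simp add: A.meet_left B.meet_left)
  moreover have "(x' \<sqinter>\<^bsub>A\<^esub> x, y' \<sqinter>\<^bsub>B\<^esub> y) \<in> M"
    using bi_ideal_le[OF K(2), of x y] xy c by (simp add: A.meet_right B.meet_right)
  moreover have "(x, x' \<sqinter>\<^bsub>A\<^esub> x) \<in> \<alpha>" "(y, y' \<sqinter>\<^bsub>B\<^esub> y) \<in> \<beta>"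
    using A.con_meet_right[OF \<alpha> 1(2) c(1)] B.con_meet_right[OF \<beta> 1(3) c(2)] c
    by (simp_all add: A.meet_eqI B.meet_eqI)
  ultimately show "\<exists>x' y'. (x', y') \<in> K \<inter> M \<and> (x, x') \<in> \<alpha> \<and> (y, y') \<in> \<beta>" by blast
qed

text \<open>The pairs that are equivalent to some pair in a given bi-ideal form a bi-ideal.\<close>

lemma bi_ideal_saturation:
  assumes \<alpha>: "congA \<alpha>" and \<beta>: "congB \<beta>" and K: "bi_ideal A B K"
  shows "bi_ideal A B {(x, y). \<exists>x' y'. (x', y') \<in> K \<and> (x, x') \<in> \<alpha> \<and> (y, y') \<in> \<beta>}" (is "bi_ideal A B ?S")
proof (rule bi_idealI)
  show "x \<in> carrier A \<and> y \<in> carrier B" if "(x, y) \<in> ?S" for x y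
    using that A.con_carrier[OF \<alpha>] B.con_carrier[OF \<beta>] by auto
  show "(\<bottom>\<^bsub>A\<^esub>, b) \<in> ?S" if "b \<in> carrier B" for b
    using that bi_ideal_bottom_left[OF K that] A.con_refl[OF \<alpha> A.bottom_in] B.con_refl[OF \<beta> that] by blast
  show "(a, \<bottom>\<^bsub>B\<^esub>) \<in> ?S" if "a \<in> carrier A" for a
    using that bi_ideal_bottom_right[OF K that] A.con_refl[OF \<alpha> that] B.con_refl[OF \<beta> B.bottom_in] by blast
next
  fix a b x y
  assume "(a, b) \<in> ?S" and c: "a \<in> carrier A" "b \<in> carrier B" "x \<in> carrier A" "y \<in> carrier B"
    and le: "x \<sqsubseteq>\<^bsub>A\<^esub> a" "y \<sqsubseteq>\<^bsub>B\<^esub> b"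
  then obtain a' b' where 1: "(a', b') \<in> K" "(a, a') \<in> \<alpha>" "(b, b') \<in> \<beta>" by blast
  have c': "a' \<in> carrier A" "b' \<in> carrier B" using bi_ideal_subset[OF K] 1(1) by auto
  have "(a' \<sqinter>\<^bsub>A\<^esub> x, b' \<sqinter>\<^bsub>B\<^esub> y) \<in> K"
    using bi_ideal_le[OF K 1(1)] c c' by (simp add: A.meet_left B.meet_left)
  moreover have "(x, a' \<sqinter>\<^bsub>A\<^esub> x) \<in> \<alpha>" "(y, b' \<sqinter>\<^bsub>B\<^esub> y) \<in> \<beta>"
    using A.con_meet_right[OF \<alpha> 1(2) c(3)] B.con_meet_right[OF \<beta> 1(3) c(4)] c le
    by (simp_all add: A.meet_eqI' B.meet_eqI')
  ultimately show "(x, y) \<in> ?S" by blast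
next
  fix a a' b
  assume "(a, b) \<in> ?S" "(a', b) \<in> ?S" and c: "a \<in> carrier A" "a' \<in> carrier A" "b \<in> carrier B"
  then obtain u v u' v' where 1: "(u, v) \<in> K" "(a, u) \<in> \<alpha>" "(b, v) \<in> \<beta>"
    and 2: "(u', v') \<in> K" "(a', u') \<in> \<alpha>" "(b, v') \<in> \<beta>" by blast
  have c': "u \<in> carrier A" "v \<in> carrier B" "u' \<in> carrier A" "v' \<in> carrier B"
    using bi_ideal_subset[OF K] 1(1) 2(1) by auto
  have "(u, v \<sqinter>\<^bsub>B\<^esub> v') \<in> K" "(u', v \<sqinter>\<^bsub>B\<^esub> v') \<in> K"
    using bi_ideal_le[OF K 1(1)] bi_ideal_le[OF K 2(1)] c' by (simp_all add: B.meet_left B.meet_right)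
  then have "(u \<squnion>\<^bsub>A\<^esub> u', v \<sqinter>\<^bsub>B\<^esub> v') \<in> K" by (rule bi_ideal_join_left[OF K])
  moreover have "(a \<squnion>\<^bsub>A\<^esub> a', u \<squnion>\<^bsub>A\<^esub> u') \<in> \<alpha>" using A.con_join[OF \<alpha>] 1 2 by blast
  moreover have "(b, v \<sqinter>\<^bsub>B\<^esub> v') \<in> \<beta>"
    using B.con_meet[OF \<beta> 1(3) 2(3)] c by (simp add: B.meet_eqI)
  ultimately show "(a \<squnion>\<^bsub>A\<^esub> a', b) \<in> ?S" by blast
next
  fix a b b'
  assume "(a, b) \<in> ?S" "(a, b') \<in> ?S" and c: "a \<in> carrier A" "b \<in> carrier B" "b' \<in> carrier B"
  then obtain u v u' v' where 1: "(u, v) \<in> K" "(a, u) \<in> \<alpha>" "(b, v) \<in> \<beta>"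
    and 2: "(u', v') \<in> K" "(a, u') \<in> \<alpha>" "(b', v') \<in> \<beta>" by blast
  have c': "u \<in> carrier A" "v \<in> carrier B" "u' \<in> carrier A" "v' \<in> carrier B"
    using bi_ideal_subset[OF K] 1(1) 2(1) by auto
  have "(u \<sqinter>\<^bsub>A\<^esub> u', v) \<in> K" "(u \<sqinter>\<^bsub>A\<^esub> u', v') \<in> K"
    using bi_ideal_le[OF K 1(1)] bi_ideal_le[OF K 2(1)] c' by (simp_all add: A.meet_left A.meet_right)
  then have "(u \<sqinter>\<^bsub>A\<^esub> u', v \<squnion>\<^bsub>B\<^esub> v') \<in> K" by (rule bi_ideal_join_right[OF K])
  moreover have "(b \<squnion>\<^bsub>B\<^esub> b', v \<squnion>\<^bsub>B\<^esub> v') \<in> \<beta>" using B.con_join[OF \<beta>] 1 2 by blast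
  moreover have "(a, u \<sqinter>\<^bsub>A\<^esub> u') \<in> \<alpha>"
    using A.con_meet[OF \<alpha> 1(2) 2(2)] c by (simp add: A.meet_eqI)
  ultimately show "(a, b \<squnion>\<^bsub>B\<^esub> b') \<in> ?S" by blast
qed

text \<open>
  Hence it suffices to cover generators.
\<close>

lemma covered_span:
  assumes \<alpha>: "congA \<alpha>" and \<beta>: "congB \<beta>" and K: "bi_ideal A B K" and "covered \<alpha> \<beta> H K"
  shows "covered \<alpha> \<beta> (span H) K"
proof -
  have "H \<subseteq> {(x, y). \<exists>x' y'. (x', y') \<in> K \<and> (x, x') \<in> \<alpha> \<and> (y, y') \<in> \<beta>}"
    using assms(4) unfolding covered_def by auto
  then have "span H \<subseteq> {(x, y). \<exists>x' y'. (x', y') \<in> K \<and> (x, x') \<in> \<alpha> \<and> (y, y') \<in> \<beta>}"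
    by (simp add: span_subset_iff bi_ideal_saturation[OF \<alpha> \<beta> K])
  then show ?thesis unfolding covered_def by auto
qed

lemma covered_span_Un:
  assumes \<alpha>: "congA \<alpha>" and \<beta>: "congB \<beta>" and K: "K \<in> fin_gen" and M: "M \<in> fin_gen"
    and HK: "covered \<alpha> \<beta> H K"
  shows "covered \<alpha> \<beta> (span (H \<union> M)) (span (K \<union> M))"
proof (rule covered_span[OF \<alpha> \<beta>])
  show "bi_ideal A B (span (K \<union> M))" using fin_gen_span_Un[OF K M] by (rule fin_gen_closed)
  have MU: "M \<subseteq> carrier A \<times> carrier B" using bi_ideal_subset[OF fin_gen_closed[OF M]] .
  have "covered \<alpha> \<beta> M (span (K \<union> M))"
    using covered_subset[OF \<alpha> \<beta> MU] span_superset[of "K \<union> M"] by blast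
  moreover have "covered \<alpha> \<beta> H (span (K \<union> M))"
    using HK span_superset[of "K \<union> M"] unfolding covered_def by blast
  ultimately show "covered \<alpha> \<beta> (H \<union> M) (span (K \<union> M))"
    unfolding covered_def by blast
qed

lemma congruence_box:
  assumes \<alpha>: "congA \<alpha>" and \<beta>: "congB \<beta>"
  shows "congT (box A B \<alpha> \<beta>)"
proof (rule T.lattice_congruenceI; unfold box_iff_covered[OF \<alpha> \<beta>] carrier_tensor)
  show "H \<in> fin_gen \<and> H \<in> fin_gen \<and> covered \<alpha> \<beta> H H \<and> covered \<alpha> \<beta> H H" if "H \<in> fin_gen" for H
    using that covered_subset[OF \<alpha> \<beta> bi_ideal_subset[OF fin_gen_closed[OF that]]] by blast
next
  fix H K M
  assume *: "H \<in> fin_gen \<and> K \<in> fin_gen \<and> covered \<alpha> \<beta> H K \<and> covered \<alpha> \<beta> K H" "M \<in> fin_gen"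
  show "H \<squnion>\<^bsub>tensor A B\<^esub> M \<in> fin_gen \<and> K \<squnion>\<^bsub>tensor A B\<^esub> M \<in> fin_gen \<and>
    covered \<alpha> \<beta> (H \<squnion>\<^bsub>tensor A B\<^esub> M) (K \<squnion>\<^bsub>tensor A B\<^esub> M) \<and>
    covered \<alpha> \<beta> (K \<squnion>\<^bsub>tensor A B\<^esub> M) (H \<squnion>\<^bsub>tensor A B\<^esub> M)"
    using * by (simp add: join_tensor fin_gen_span_Un covered_span_Un[OF \<alpha> \<beta>])
  show "H \<sqinter>\<^bsub>tensor A B\<^esub> M \<in> fin_gen \<and> K \<sqinter>\<^bsub>tensor A B\<^esub> M \<in> fin_gen \<and>
    covered \<alpha> \<beta> (H \<sqinter>\<^bsub>tensor A B\<^esub> M) (K \<sqinter>\<^bsub>tensor A B\<^esub> M) \<and>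
    covered \<alpha> \<beta> (K \<sqinter>\<^bsub>tensor A B\<^esub> M) (H \<sqinter>\<^bsub>tensor A B\<^esub> M)"
    using * T.meet_closed[of H M] T.meet_closed[of K M]
    by (simp add: meet_tensor fin_gen_closed bi_ideal_subset covered_Int[OF \<alpha> \<beta>])
qed (use covered_trans[OF \<alpha> \<beta>] in blast)+

lemma box_subset_iff:
  assumes \<alpha>: "congA \<alpha>" and \<beta>: "congB \<beta>" and H: "H \<in> fin_gen" and K: "K \<in> fin_gen" and le: "H \<subseteq> K"
  shows "(H, K) \<in> box A B \<alpha> \<beta> \<longleftrightarrow> covered \<alpha> \<beta> K H"
  using covered_subset[OF \<alpha> \<beta> bi_ideal_subset[OF fin_gen_closed[OF H]] le] H K
  by (simp add: box_iff_covered[OF \<alpha> \<beta>])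

lemma box_mono: "\<alpha> \<subseteq> \<alpha>' \<Longrightarrow> \<beta> \<subseteq> \<beta>' \<Longrightarrow> box A B \<alpha> \<beta> \<subseteq> box A B \<alpha>' \<beta>'"
  unfolding box_def by (simp add: subset_iff) blast

lemma congA_Id: "congA (Id_on (carrier A))"
  using A.con.closed_span[of "{}"] by (simp add: A.con_span_empty)

lemma congB_Id: "congB (Id_on (carrier B))"
  using B.con.closed_span[of "{}"] by (simp add: B.con_span_empty)

lemma odot_eq:
  assumes \<alpha>: "congA \<alpha>" and \<beta>: "congB \<beta>"
  shows "odot A B \<alpha> \<beta> = box A B \<alpha> (Id_on (carrier B)) \<inter> box A B (Id_on (carrier A)) \<beta>"
  unfolding odot_def A.bottom_Con B.bottom_Con T.Con_eq
  by (rule T.con.meet_closed_lattice[OF congruence_box[OF \<alpha> congB_Id] congruence_box[OF congA_Id \<beta>]])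

lemma congruence_odot: "congA \<alpha> \<Longrightarrow> congB \<beta> \<Longrightarrow> congT (odot A B \<alpha> \<beta>)"
  by (simp add: odot_eq congruence_box congA_Id congB_Id T.con.closed_Int)

lemma corner_in_odot:
  assumes \<alpha>: "congA \<alpha>" and \<beta>: "congB \<beta>" and x: "(x', x) \<in> \<alpha>" and y: "(y', y) \<in> \<beta>"
  shows "corner x' x y' y \<in> odot A B \<alpha> \<beta>"
proof -
  define a' a b' b where "a' = x' \<sqinter>\<^bsub>A\<^esub> x" and "a = x' \<squnion>\<^bsub>A\<^esub> x"
    and "b' = y' \<sqinter>\<^bsub>B\<^esub> y" and "b = y' \<squnion>\<^bsub>B\<^esub> y"
  have c: "x' \<in> carrier A" "x \<in> carrier A" "y' \<in> carrier B" "y \<in> carrier B"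
    using A.con_carrier[OF \<alpha> x] B.con_carrier[OF \<beta> y] by auto
  then have c' [simp]: "a' \<in> carrier A" "a \<in> carrier A" "b' \<in> carrier B" "b \<in> carrier B"
    and le: "a' \<sqsubseteq>\<^bsub>A\<^esub> a" "b' \<sqsubseteq>\<^bsub>B\<^esub> b"
    unfolding a'_def a_def b'_def b_def by (simp_all add: meet_le_joinA meet_le_joinB)
  have ab: "(a', a) \<in> \<alpha>" "(b', b) \<in> \<beta>"
    using x y A.con_mem_iff[OF \<alpha>] B.con_mem_iff[OF \<beta>] c unfolding a'_def a_def b'_def b_def by blast+
  have fg: "step_tensor a' a b' b \<in> fin_gen" "pure a b \<in> fin_gen"
    using le by (simp_all add: step_tensor_fin_gen pure_tensor_fin_gen)
  have sub: "step_tensor a' a b' b \<subseteq> pure a b"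
    using le by (simp add: step_tensor_def pure_tensor_subset_iff bi_ideal_pure_tensor mem_pure_tensor)
  have "covered \<alpha> (Id_on (carrier B)) (pure a b) (step_tensor a' a b' b)"
    unfolding covered_def
  proof (intro allI impI)
    fix u v assume uv: "(u, v) \<in> pure a b"
    then have uvc: "u \<in> carrier A" "v \<in> carrier B" by (auto simp: mem_pure_tensor)
    show "\<exists>u' v'. (u', v') \<in> step_tensor a' a b' b \<and> (u, u') \<in> \<alpha> \<and> (v, v') \<in> Id_on (carrier B)"
    proof (cases "u = \<bottom>\<^bsub>A\<^esub> \<or> v = \<bottom>\<^bsub>B\<^esub>")
      case True
      then have "(u, v) \<in> step_tensor a' a b' b" using uvc unfolding mem_step_tensor by blast
      then show ?thesis using uvc A.con_refl[OF \<alpha>] by blast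
    next
      case False
      then have "u \<sqsubseteq>\<^bsub>A\<^esub> a" "v \<sqsubseteq>\<^bsub>B\<^esub> b" using uv by (auto simp: mem_pure_tensor)
      then have "(a' \<sqinter>\<^bsub>A\<^esub> u, v) \<in> step_tensor a' a b' b" "(a' \<sqinter>\<^bsub>A\<^esub> u, u) \<in> \<alpha>"
        using uvc A.con_meet_right[OF \<alpha> ab(1) uvc(1)]
        by (simp_all add: mem_step_tensor A.meet_left A.meet_eqI')
      then show ?thesis using uvc A.con_sym[OF \<alpha>] by blast
    qed
  qed
  moreover have "covered (Id_on (carrier A)) \<beta> (pure a b) (step_tensor a' a b' b)"
    unfolding covered_def
  proof (intro allI impI)
    fix u v assume uv: "(u, v) \<in> pure a b"
    then have uvc: "u \<in> carrier A" "v \<in> carrier B" by (auto simp: mem_pure_tensor)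
    show "\<exists>u' v'. (u', v') \<in> step_tensor a' a b' b \<and> (u, u') \<in> Id_on (carrier A) \<and> (v, v') \<in> \<beta>"
    proof (cases "u = \<bottom>\<^bsub>A\<^esub> \<or> v = \<bottom>\<^bsub>B\<^esub>")
      case True
      then have "(u, v) \<in> step_tensor a' a b' b" using uvc unfolding mem_step_tensor by blast
      then show ?thesis using uvc B.con_refl[OF \<beta>] by blast
    next
      case False
      then have "u \<sqsubseteq>\<^bsub>A\<^esub> a" "v \<sqsubseteq>\<^bsub>B\<^esub> b" using uv by (auto simp: mem_pure_tensor)
      then have "(u, b' \<sqinter>\<^bsub>B\<^esub> v) \<in> step_tensor a' a b' b" "(b' \<sqinter>\<^bsub>B\<^esub> v, v) \<in> \<beta>"
        using uvc B.con_meet_right[OF \<beta> ab(2) uvc(2)]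
        by (simp_all add: mem_step_tensor B.meet_left B.meet_eqI')
      then show ?thesis using uvc B.con_sym[OF \<beta>] by blast
    qed
  qed
  ultimately show ?thesis
    unfolding odot_eq[OF \<alpha> \<beta>] corner_def a'_def[symmetric] a_def[symmetric] b'_def[symmetric] b_def[symmetric]
    using fg sub by (simp add: box_subset_iff \<alpha> \<beta> congA_Id congB_Id)
qed

text \<open>A congruence collapses \<open>H \<subseteq> K\<close> as soon as \<open>H\<close> absorbs a generating set of \<open>K\<close> modulo it.\<close>

lemma con_absorb_generators:
  assumes \<psi>: "congT \<psi>" and H: "H \<in> fin_gen" and "finite F" "F \<subseteq> carrier A \<times> carrier B"
    and "\<And>x y. (x, y) \<in> F \<Longrightarrow> (H, span (H \<union> pure x y)) \<in> \<psi>"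
  shows "(H, span (H \<union> F)) \<in> \<psi>"
  using assms(3-)
proof (induction F rule: finite_induct)
  case empty
  show ?case using H T.con_refl[OF \<psi>] by (simp add: span_closed fin_gen_closed)
next
  case (insert p F)
  obtain x y where p: "p = (x, y)" "x \<in> carrier A" "y \<in> carrier B" using insert.prems(1) by auto
  have IH: "(H, span (H \<union> F)) \<in> \<psi>" and pxy: "(H, span (H \<union> pure x y)) \<in> \<psi>" using insert p by auto
  have fg: "span (H \<union> pure x y) \<in> fin_gen" "span (H \<union> F) \<in> fin_gen"
    using T.con_carrier[OF \<psi> IH] T.con_carrier[OF \<psi> pxy] by simp_all
  have "(H \<squnion>\<^bsub>tensor A B\<^esub> H, span (H \<union> pure x y) \<squnion>\<^bsub>tensor A B\<^esub> span (H \<union> F)) \<in> \<psi>"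
    by (rule T.con_join[OF \<psi> pxy IH])
  moreover have "span (H \<union> pure x y) \<squnion>\<^bsub>tensor A B\<^esub> span (H \<union> F) = span (H \<union> insert p F)"
  proof -
    have "span (H \<union> pure x y) = span (H \<union> {p})"
      using span_Un[of H "{p}"] span_closed[OF fin_gen_closed[OF H]] p by (simp add: span_singleton)
    moreover have "(H \<union> {p}) \<union> (H \<union> F) = H \<union> insert p F" by blast
    ultimately show ?thesis using fg by (simp only: join_tensor span_Un)
  qed
  ultimately show ?case using H T.join_idem[of H] by simp
qed

lemma collapsesD: "collapses \<psi> X Y \<Longrightarrow> (x', x) \<in> X \<Longrightarrow> (y', y) \<in> Y \<Longrightarrow> corner x' x y' y \<in> \<psi>"
  unfolding collapses_def by blast

text \<open>
  The congruence \<open>\<alpha> \<odot> \<beta>\<close> is generated by its corners. If \<open>H \<subseteq> K\<close> are identified by both boxes and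
  \<open>(x, y) \<in> K\<close>, then \<open>H\<close> contains \<open>(x', y)\<close> and \<open>(x, y')\<close> for some \<open>x' \<le> x\<close> and \<open>y' \<le> y\<close> with \<open>x'\<close>
  congruent to \<open>x\<close> and \<open>y'\<close> congruent to \<open>y\<close>; joining the corner of these with \<open>H\<close> shows that \<open>H\<close>
  absorbs \<open>x \<otimes> y\<close>.
\<close>

lemma odot_subset_iff:
  assumes \<alpha>: "congA \<alpha>" and \<beta>: "congB \<beta>" and \<psi>: "congT \<psi>"
  shows "odot A B \<alpha> \<beta> \<subseteq> \<psi> \<longleftrightarrow> collapses \<psi> \<alpha> \<beta>"
proof
  show "collapses \<psi> \<alpha> \<beta>" if "odot A B \<alpha> \<beta> \<subseteq> \<psi>"
    using that corner_in_odot[OF \<alpha> \<beta>] unfolding collapses_def by blast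
next
  assume coll: "collapses \<psi> \<alpha> \<beta>"
  have main: "(H, K) \<in> \<psi>" if H: "H \<in> fin_gen" and K: "K \<in> fin_gen" and le: "H \<subseteq> K"
    and HK: "(H, K) \<in> odot A B \<alpha> \<beta>" for H K
  proof -
    have cl: "bi_ideal A B H" "bi_ideal A B K" using H K fin_gen_closed by auto
    have cov: "covered \<alpha> (Id_on (carrier B)) K H" "covered (Id_on (carrier A)) \<beta> K H"
      using HK box_subset_iff[OF _ _ H K le] \<alpha> \<beta> congA_Id congB_Id unfolding odot_eq[OF \<alpha> \<beta>] by auto
    obtain F where F: "finite F" "F \<subseteq> carrier A \<times> carrier B" "K = span F" "F \<subseteq> K"
      using K by (rule fin_genE)
    have "(H, span (H \<union> pure x y)) \<in> \<psi>" if xy: "(x, y) \<in> F" for x y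
    proof -
      have xyK: "(x, y) \<in> K" using xy F by blast
      obtain u where u: "(u, y) \<in> H" "(x, u) \<in> \<alpha>" using xyK cov(1) unfolding covered_def by blast
      obtain v where v: "(x, v) \<in> H" "(y, v) \<in> \<beta>" using xyK cov(2) unfolding covered_def by blast
      have c [simp]: "x \<in> carrier A" "y \<in> carrier B" "u \<in> carrier A" "v \<in> carrier B"
        using A.con_carrier[OF \<alpha> u(2)] B.con_carrier[OF \<beta> v(2)] by auto
      have x': "(u \<sqinter>\<^bsub>A\<^esub> x, x) \<in> \<alpha>" and y': "(v \<sqinter>\<^bsub>B\<^esub> y, y) \<in> \<beta>"
        using A.con_sym[OF \<alpha> A.con_meet_right[OF \<alpha> u(2) c(1)]]
          B.con_sym[OF \<beta> B.con_meet_right[OF \<beta> v(2) c(2)]] by (simp_all add: A.meet_eqI B.meet_eqI)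
      define S where "S = step_tensor (u \<sqinter>\<^bsub>A\<^esub> x) x (v \<sqinter>\<^bsub>B\<^esub> y) y"
      have S: "(S, pure x y) \<in> \<psi>"
        using collapsesD[OF coll x' y'] unfolding S_def
        by (simp add: corner_le A.meet_right B.meet_right)
      have "(u \<sqinter>\<^bsub>A\<^esub> x, y) \<in> H" "(x, v \<sqinter>\<^bsub>B\<^esub> y) \<in> H"
        using bi_ideal_le[OF cl(1) u(1)] bi_ideal_le[OF cl(1) v(1)]
        by (simp_all add: A.meet_left B.meet_left)
      then have "S \<subseteq> H"
        unfolding S_def step_tensor_def using cl(1) by (simp add: pure_tensor_subset_iff)
      have "S \<in> fin_gen" using T.con_carrier[OF \<psi> S] by simp
      then have "S \<squnion>\<^bsub>tensor A B\<^esub> H = H" using \<open>S \<subseteq> H\<close> H by (intro T.join_eqI) simp_all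
      then have "(H, pure x y \<squnion>\<^bsub>tensor A B\<^esub> H) \<in> \<psi>"
        using T.con_join_right[OF \<psi> S, of H] H by simp
      then show ?thesis using H by (simp add: join_tensor pure_tensor_fin_gen Un_commute)
    qed
    then have "(H, span (H \<union> F)) \<in> \<psi>" using con_absorb_generators[OF \<psi> H F(1,2)] by blast
    moreover have "span (H \<union> F) = K"
    proof (rule subset_antisym)
      show "span (H \<union> F) \<subseteq> K" using le F(4) cl(2) by (simp add: span_subset_iff)
      show "K \<subseteq> span (H \<union> F)" unfolding F(3) by (rule span_mono) blast
    qed
    ultimately show ?thesis by simp
  qed
  show "odot A B \<alpha> \<beta> \<subseteq> \<psi>"
  proof clarify
    fix H K assume HK: "(H, K) \<in> odot A B \<alpha> \<beta>"
    have o: "congT (odot A B \<alpha> \<beta>)" by (rule congruence_odot[OF \<alpha> \<beta>])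
    have c: "H \<in> fin_gen" "K \<in> fin_gen" using T.con_carrier[OF o HK] by auto
    have "(H \<sqinter>\<^bsub>tensor A B\<^esub> K, H \<squnion>\<^bsub>tensor A B\<^esub> K) \<in> odot A B \<alpha> \<beta>"
      using HK T.con_mem_iff[OF o, of H K] c by simp
    moreover have "H \<sqinter>\<^bsub>tensor A B\<^esub> K \<subseteq> H \<squnion>\<^bsub>tensor A B\<^esub> K"
      using T.meet_left[of H K] T.join_left[of H K] c by simp
    ultimately have "(H \<sqinter>\<^bsub>tensor A B\<^esub> K, H \<squnion>\<^bsub>tensor A B\<^esub> K) \<in> \<psi>"
      using main T.meet_closed[of H K] T.join_closed[of H K] c by simp
    then show "(H, K) \<in> \<psi>" using T.con_mem_iff[OF \<psi>, of H K] c by simp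
  qed
qed

text \<open>
  The congruences \<open>P \<box> Q\<close> act as tests for the relation between the various \<open>\<alpha> \<odot> \<beta>\<close>.
\<close>

lemma odot_subset_box_iff:
  assumes \<alpha>: "congA \<alpha>" and \<beta>: "congB \<beta>" and P: "congA P" and Q: "congB Q"
  shows "odot A B \<alpha> \<beta> \<subseteq> box A B P Q \<longleftrightarrow> \<alpha> \<subseteq> P \<or> \<beta> \<subseteq> Q"
proof
  have Id: "Id_on (carrier A) \<subseteq> P" "Id_on (carrier B) \<subseteq> Q"
    using A.con_refl[OF P] B.con_refl[OF Q] by auto
  show "odot A B \<alpha> \<beta> \<subseteq> box A B P Q" if "\<alpha> \<subseteq> P \<or> \<beta> \<subseteq> Q"
    using that box_mono[of \<alpha> P, OF _ Id(2)] box_mono[of _ P \<beta> Q, OF Id(1)] unfolding odot_eq[OF \<alpha> \<beta>] by blast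
next
  assume sub: "odot A B \<alpha> \<beta> \<subseteq> box A B P Q"
  show "\<alpha> \<subseteq> P \<or> \<beta> \<subseteq> Q"
  proof (rule ccontr)
    assume "\<not> ?thesis"
    then obtain x' x y' y where x: "(x', x) \<in> \<alpha>" "(x', x) \<notin> P" and y: "(y', y) \<in> \<beta>" "(y', y) \<notin> Q"
      by auto
    define a' a b' b where "a' = x' \<sqinter>\<^bsub>A\<^esub> x" and "a = x' \<squnion>\<^bsub>A\<^esub> x"
      and "b' = y' \<sqinter>\<^bsub>B\<^esub> y" and "b = y' \<squnion>\<^bsub>B\<^esub> y"
    have c: "x' \<in> carrier A" "x \<in> carrier A" "y' \<in> carrier B" "y \<in> carrier B"
      using A.con_carrier[OF \<alpha> x(1)] B.con_carrier[OF \<beta> y(1)] by auto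
    then have c' [simp]: "a' \<in> carrier A" "a \<in> carrier A" "b' \<in> carrier B" "b \<in> carrier B"
      and le: "a' \<sqsubseteq>\<^bsub>A\<^esub> a" "b' \<sqsubseteq>\<^bsub>B\<^esub> b"
      unfolding a'_def a_def b'_def b_def by (simp_all add: meet_le_joinA meet_le_joinB)
    have ab: "(a', a) \<notin> P" "(b', b) \<notin> Q"
      using x y A.con_mem_iff[OF P] B.con_mem_iff[OF Q] c unfolding a'_def a_def b'_def b_def by blast+
    have "(step_tensor a' a b' b, pure a b) \<in> box A B P Q"
      using sub corner_in_odot[OF \<alpha> \<beta> x(1) y(1)] unfolding corner_def a'_def a_def b'_def b_def by blast
    then have "covered P Q (pure a b) (step_tensor a' a b' b)"
      unfolding box_iff_covered[OF P Q] by blast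
    moreover have "(a, b) \<in> pure a b" by (simp add: mem_pure_tensor)
    ultimately obtain u v where uv: "(u, v) \<in> step_tensor a' a b' b" "(a, u) \<in> P" "(b, v) \<in> Q"
      unfolding covered_def by blast
    then have uvc: "u \<in> carrier A" "v \<in> carrier B" by (auto simp: mem_step_tensor)
    have "u \<sqsubseteq>\<^bsub>A\<^esub> a' \<or> v \<sqsubseteq>\<^bsub>B\<^esub> b'"
      using uv(1) A.bottom_le B.bottom_le by (auto simp: mem_step_tensor)
    then show False
    proof
      assume "u \<sqsubseteq>\<^bsub>A\<^esub> a'"
      moreover have "a \<squnion>\<^bsub>A\<^esub> a' = a" using le A.join_eqI[of a' a] A.join_commute[of a a'] by simp
      ultimately have "(a, a') \<in> P" using A.con_join_right[OF P uv(2), of a'] uvc by (simp add: A.join_eqI)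
      then show False using ab(1) A.con_sym[OF P] by blast
    next
      assume "v \<sqsubseteq>\<^bsub>B\<^esub> b'"
      moreover have "b \<squnion>\<^bsub>B\<^esub> b' = b" using le B.join_eqI[of b' b] B.join_commute[of b b'] by simp
      ultimately have "(b, b') \<in> Q" using B.con_join_right[OF Q uv(3), of b'] uvc by (simp add: B.join_eqI)
      then show False using ab(2) B.con_sym[OF Q] by blast
    qed
  qed
qed

end

section \<open>The canonical homomorphism\<close>

context tensor_lattice
begin

text \<open>
  The corners of finitely many generators generate \<open>\<alpha> \<odot> \<beta>\<close>.
\<close>

lemma odot_fin_gen:
  assumes \<alpha>: "\<alpha> \<in> ConcA" and \<beta>: "\<beta> \<in> ConcB"
  shows "odot A B \<alpha> \<beta> \<in> ConcT"
proof -
  note cl = A.con.fin_gen_closed[OF \<alpha>] B.con.fin_gen_closed[OF \<beta>]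
  obtain X where X: "finite X" "X \<subseteq> carrier A \<times> carrier A" "\<alpha> = spanA X" "X \<subseteq> \<alpha>"
    using \<alpha> by (rule A.con.fin_genE)
  obtain Y where Y: "finite Y" "Y \<subseteq> carrier B \<times> carrier B" "\<beta> = spanB Y" "Y \<subseteq> \<beta>"
    using \<beta> by (rule B.con.fin_genE)
  define Z where "Z = (\<lambda>((x', x), (y', y)). corner x' x y' y) ` (X \<times> Y)"
  have Zin: "corner x' x y' y \<in> Z" if "(x', x) \<in> X" "(y', y) \<in> Y" for x' x y' y
    using that unfolding Z_def by force
  have "finite Z" unfolding Z_def using X Y by simp
  have Zsub: "Z \<subseteq> odot A B \<alpha> \<beta>"
    unfolding Z_def using subsetD[OF X(4)] subsetD[OF Y(4)]
    by (intro image_subsetI) (auto intro: corner_in_odot[OF cl])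
  have ZU: "Z \<subseteq> carrier (tensor A B) \<times> carrier (tensor A B)"
    using Zsub T.con_subset[OF congruence_odot[OF cl]] by (rule subset_trans)
  have cZ: "congT (spanT Z)" by (rule T.con.closed_span[OF ZU])
  have "collapses (spanT Z) X Y"
    unfolding collapses_def using Zin T.con.span_superset[of Z] by blast
  then have "odot A B \<alpha> \<beta> \<subseteq> spanT Z"
    unfolding odot_subset_iff[OF cl cZ] unfolding X(3) Y(3) by (rule collapses_span[OF cZ X(2) Y(2)])
  moreover have "spanT Z \<subseteq> odot A B \<alpha> \<beta>"
    using Zsub by (simp add: T.con.span_subset_iff congruence_odot[OF cl])
  ultimately have "odot A B \<alpha> \<beta> = spanT Z" by blast
  then show ?thesis using T.con.fin_genI[OF \<open>finite Z\<close> ZU] by simp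
qed

text \<open>The map \<open>(\<alpha>, \<beta>) \<mapsto> \<alpha> \<odot> \<beta>\<close> is monotone, join-preserving in each variable, and zero on the axes.\<close>

lemma bi_ideal_odot_below:
  assumes \<psi>: "congT \<psi>"
  shows "bi_ideal (Con_c A) (Con_c B) {(\<alpha>, \<beta>). \<alpha> \<in> ConcA \<and> \<beta> \<in> ConcB \<and> odot A B \<alpha> \<beta> \<subseteq> \<psi>}"
    (is "bi_ideal _ _ ?S")
proof -
  note cl = A.con.fin_gen_closed B.con.fin_gen_closed
  have S: "(\<alpha>, \<beta>) \<in> ?S \<longleftrightarrow> \<alpha> \<in> ConcA \<and> \<beta> \<in> ConcB \<and> collapses \<psi> \<alpha> \<beta>" for \<alpha> \<beta>
    using odot_subset_iff[OF cl \<psi>] by auto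
  have step: "step_tensor a a b' b = pure a b" "step_tensor a' a b b = pure a b"
    if "a' \<in> carrier A" "a \<in> carrier A" "b' \<in> carrier B" "b \<in> carrier B" "a' \<sqsubseteq>\<^bsub>A\<^esub> a" "b' \<sqsubseteq>\<^bsub>B\<^esub> b"
    for a' a b' b
    using that unfolding step_tensor_def
    by (auto simp: bi_ideal_pure_tensor pure_tensor_subset_iff mem_pure_tensor
        dest: A.le_trans[of _ a' a] B.le_trans[of _ b' b])
  show ?thesis
  proof (rule CC.bi_idealI; unfold S A.carrier_Con_c B.carrier_Con_c A.le_Con_c B.le_Con_c)
    show "\<bottom>\<^bsub>Con_c A\<^esub> \<in> ConcA \<and> \<beta> \<in> ConcB \<and> collapses \<psi> \<bottom>\<^bsub>Con_c A\<^esub> \<beta>" if \<beta>: "\<beta> \<in> ConcB" for \<beta>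
    proof -
      have "corner x x y' y \<in> \<psi>" if "x \<in> carrier A" "(y', y) \<in> \<beta>" for x y' y
      proof -
        have c: "y' \<in> carrier B" "y \<in> carrier B" using that B.con_carrier[OF cl(2)[OF \<beta>]] by auto
        then have "corner x x y' y = (pure x (y' \<squnion>\<^bsub>B\<^esub> y), pure x (y' \<squnion>\<^bsub>B\<^esub> y))"
          using that(1) step(1)[of x x] by (simp add: corner_def A.meet_eqI A.join_idem meet_le_joinB)
        then show ?thesis using c that(1) T.con_refl[OF \<psi>] by (simp add: pure_tensor_fin_gen)
      qed
      then have "collapses \<psi> \<bottom>\<^bsub>Con_c A\<^esub> \<beta>"
        unfolding collapses_def A.bottom_Con_c by auto
      then show ?thesis using \<beta> CC.A.bottom_in by simp
    qed
    show "\<alpha> \<in> ConcA \<and> \<bottom>\<^bsub>Con_c B\<^esub> \<in> ConcB \<and> collapses \<psi> \<alpha> \<bottom>\<^bsub>Con_c B\<^esub>" if \<alpha>: "\<alpha> \<in> ConcA" for \<alpha>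
    proof -
      have "corner x' x y y \<in> \<psi>" if "y \<in> carrier B" "(x', x) \<in> \<alpha>" for x' x y
      proof -
        have c: "x' \<in> carrier A" "x \<in> carrier A" using that A.con_carrier[OF cl(1)[OF \<alpha>]] by auto
        then have "corner x' x y y = (pure (x' \<squnion>\<^bsub>A\<^esub> x) y, pure (x' \<squnion>\<^bsub>A\<^esub> x) y)"
          using that(1) step(2)[of _ _ y y] by (simp add: corner_def B.meet_eqI B.join_idem meet_le_joinA)
        then show ?thesis using c that(1) T.con_refl[OF \<psi>] by (simp add: pure_tensor_fin_gen)
      qed
      then have "collapses \<psi> \<alpha> \<bottom>\<^bsub>Con_c B\<^esub>"
        unfolding collapses_def B.bottom_Con_c by auto
      then show ?thesis using \<alpha> CC.B.bottom_in by simp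
    qed
  next
    fix \<alpha> \<alpha>' \<beta>
    assume *: "\<alpha> \<in> ConcA \<and> \<beta> \<in> ConcB \<and> collapses \<psi> \<alpha> \<beta>" "\<alpha>' \<in> ConcA \<and> \<beta> \<in> ConcB \<and> collapses \<psi> \<alpha>' \<beta>"
    then have "collapses \<psi> (\<alpha> \<union> \<alpha>') \<beta>" unfolding collapses_def by blast
    then have "collapses \<psi> (spanA (\<alpha> \<union> \<alpha>')) (spanB \<beta>)"
      using * cl A.con_subset B.con_subset by (intro collapses_span[OF \<psi>]) auto
    then show "\<alpha> \<squnion>\<^bsub>Con_c A\<^esub> \<alpha>' \<in> ConcA \<and> \<beta> \<in> ConcB \<and> collapses \<psi> (\<alpha> \<squnion>\<^bsub>Con_c A\<^esub> \<alpha>') \<beta>"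
      using * by (simp add: A.join_Con_c A.con.fin_gen_span_Un B.con.span_closed cl)
  next
    fix \<alpha> \<beta> \<beta>'
    assume *: "\<alpha> \<in> ConcA \<and> \<beta> \<in> ConcB \<and> collapses \<psi> \<alpha> \<beta>" "\<alpha> \<in> ConcA \<and> \<beta>' \<in> ConcB \<and> collapses \<psi> \<alpha> \<beta>'"
    then have "collapses \<psi> \<alpha> (\<beta> \<union> \<beta>')" unfolding collapses_def by blast
    then have "collapses \<psi> (spanA \<alpha>) (spanB (\<beta> \<union> \<beta>'))"
      using * cl A.con_subset B.con_subset by (intro collapses_span[OF \<psi>]) auto
    then show "\<alpha> \<in> ConcA \<and> \<beta> \<squnion>\<^bsub>Con_c B\<^esub> \<beta>' \<in> ConcB \<and> collapses \<psi> \<alpha> (\<beta> \<squnion>\<^bsub>Con_c B\<^esub> \<beta>')"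
      using * by (simp add: B.join_Con_c B.con.fin_gen_span_Un A.con.span_closed cl)
  qed (use collapses_mono in blast)+
qed

text \<open>
  The join of all \<open>\<alpha> \<odot> \<beta>\<close> with \<open>(\<alpha>, \<beta>) \<in> I\<close>. It is unchanged when \<open>I\<close> is replaced by the bi-ideal
  that \<open>I\<close> generates.
\<close>

definition odots :: "(('a \<times> 'a) set \<times> ('b \<times> 'b) set) set \<Rightarrow> (('a \<times> 'b) set \<times> ('a \<times> 'b) set) set" where
  "odots I = spanT (\<Union>p\<in>I. odot A B (fst p) (snd p))"

lemma odots_carrier:
  assumes "I \<subseteq> ConcA \<times> ConcB"
  shows "(\<Union>p\<in>I. odot A B (fst p) (snd p)) \<subseteq> carrier (tensor A B) \<times> carrier (tensor A B)"
proof (rule UN_least)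
  fix p assume "p \<in> I"
  then have "fst p \<in> ConcA" "snd p \<in> ConcB" using assms by auto
  then show "odot A B (fst p) (snd p) \<subseteq> carrier (tensor A B) \<times> carrier (tensor A B)"
    by (intro T.con_subset congruence_odot A.con.fin_gen_closed B.con.fin_gen_closed)
qed

lemma congruence_odots: "I \<subseteq> ConcA \<times> ConcB \<Longrightarrow> congT (odots I)"
  unfolding odots_def by (rule T.con.closed_span[OF odots_carrier])

lemma odots_subset_iff: "congT \<psi> \<Longrightarrow> odots I \<subseteq> \<psi> \<longleftrightarrow> (\<forall>(\<alpha>, \<beta>)\<in>I. odot A B \<alpha> \<beta> \<subseteq> \<psi>)"
  unfolding odots_def by (simp add: T.con.span_subset_iff UN_subset_iff case_prod_beta)

lemma odots_span:
  assumes X: "X \<subseteq> ConcA \<times> ConcB"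
  shows "odots (CC.span X) = odots X"
proof (rule subset_antisym)
  let ?S = "{(\<alpha>, \<beta>). \<alpha> \<in> ConcA \<and> \<beta> \<in> ConcB \<and> odot A B \<alpha> \<beta> \<subseteq> odots X}"
  note c = congruence_odots[OF X]
  have "\<forall>(\<alpha>, \<beta>)\<in>X. odot A B \<alpha> \<beta> \<subseteq> odots X" using odots_subset_iff[OF c, of X] by simp
  then have "X \<subseteq> ?S" using X by auto
  then have "CC.span X \<subseteq> ?S" by (simp only: CC.span_subset_iff[OF bi_ideal_odot_below[OF c]])
  then show "odots (CC.span X) \<subseteq> odots X" unfolding odots_subset_iff[OF c] by blast
  show "odots X \<subseteq> odots (CC.span X)"
    unfolding odots_def by (rule T.con.span_mono) (use CC.span_superset in blast)
qed

lemma odots_fin_gen: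
  assumes "finite X" "X \<subseteq> ConcA \<times> ConcB"
  shows "odots X \<in> ConcT"
  unfolding odots_def using assms odot_fin_gen by (intro T.con.fin_gen_span_Union) auto

text \<open>
  The homomorphism \<open>\<epsilon>\<close>, undefined outside the tensor product of the semilattices of compact
  congruences.
\<close>

definition canonical_hom where
  "canonical_hom = restrict odots CC.fin_gen"

lemma CC_fin_genE:
  assumes "I \<in> CC.fin_gen"
  obtains X where "finite X" "X \<subseteq> ConcA \<times> ConcB" "I = CC.span X" "odots I = odots X"
  using assms odots_span by (auto elim!: CC.fin_genE)

lemma canonical_hom_in: "canonical_hom \<in> canonical_homs A B"
proof -
  have "canonical_hom (I \<squnion>\<^bsub>tensor (Con_c A) (Con_c B)\<^esub> J) =
      canonical_hom I \<squnion>\<^bsub>Con_c (tensor A B)\<^esub> canonical_hom J"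
    if IJ: "I \<in> CC.fin_gen" "J \<in> CC.fin_gen" for I J
  proof -
    obtain X where X: "finite X" "X \<subseteq> ConcA \<times> ConcB" "I = CC.span X" "odots I = odots X"
      using IJ(1) by (rule CC_fin_genE)
    obtain Y where Y: "finite Y" "Y \<subseteq> ConcA \<times> ConcB" "J = CC.span Y" "odots J = odots Y"
      using IJ(2) by (rule CC_fin_genE)
    have "odots (CC.span (I \<union> J)) = odots (X \<union> Y)"
      unfolding X(3) Y(3) CC.span_Un using X Y by (intro odots_span) auto
    also have "\<dots> = spanT (odots X \<union> odots Y)"
      unfolding odots_def T.con.span_Un by (simp add: UN_Un)
    finally show ?thesis
      using IJ X Y odots_fin_gen
      by (simp add: canonical_hom_def CC.join_tensor CC.fin_gen_span_Un T.join_Con_c)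
  qed
  moreover have "canonical_hom \<bottom>\<^bsub>tensor (Con_c A) (Con_c B)\<^esub> = \<bottom>\<^bsub>Con_c (tensor A B)\<^esub>"
    using CC.fin_genI[of "{}"] odots_span[of "{}"]
    by (simp add: canonical_hom_def CC.bottom_tensor T.bottom_Con_c odots_def T.con_span_empty)
  moreover have "canonical_hom \<in> CC.fin_gen \<rightarrow>\<^sub>E ConcT"
    unfolding canonical_hom_def using odots_fin_gen by (auto elim!: CC_fin_genE)
  moreover have "canonical_hom (pure_tensor (Con_c A) (Con_c B) \<alpha> \<beta>) = odot A B \<alpha> \<beta>"
    if \<alpha>: "\<alpha> \<in> ConcA" and \<beta>: "\<beta> \<in> ConcB" for \<alpha> \<beta>
  proof -
    have "odots {(\<alpha>, \<beta>)} = odot A B \<alpha> \<beta>"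
      using T.con.span_closed[OF congruence_odot] A.con.fin_gen_closed[OF \<alpha>] B.con.fin_gen_closed[OF \<beta>]
      by (simp add: odots_def)
    moreover have "odots (CC.span {(\<alpha>, \<beta>)}) = odots {(\<alpha>, \<beta>)}" using \<alpha> \<beta> by (intro odots_span) simp
    ultimately show ?thesis
      using \<alpha> \<beta> CC.pure_tensor_fin_gen[of \<alpha> \<beta>] CC.span_singleton[of \<alpha> \<beta>] by (simp add: canonical_hom_def)
  qed
  ultimately show ?thesis
    by (simp add: canonical_homs_def join_zero_hom_def)
qed

lemma canonical_homs_unique: "\<epsilon> \<in> canonical_homs A B \<Longrightarrow> \<epsilon> = canonical_hom"
  using canonical_hom_in unfolding canonical_homs_def
  by (intro CC.join_zero_hom_eqI[where S = "Con_c (tensor A B)"]) auto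

text \<open>
  A pair \<open>(\<alpha>, \<beta>)\<close> outside \<open>J\<close> is separated from the generators of \<open>J\<close> by congruences \<open>P\<close> and \<open>Q\<close>,
  so \<open>P \<box> Q\<close> lies above all generators of \<open>odots J\<close> but not above \<open>\<alpha> \<odot> \<beta>\<close>.
\<close>

lemma odots_reflects:
  assumes I: "I \<in> CC.fin_gen" and J: "J \<in> CC.fin_gen" and le: "odots I \<subseteq> odots J"
  shows "I \<subseteq> J"
proof clarify
  fix \<alpha> \<beta> assume in_I: "(\<alpha>, \<beta>) \<in> I"
  have IU: "I \<subseteq> ConcA \<times> ConcB" using CC.bi_ideal_subset[OF CC.fin_gen_closed[OF I]] by simp
  then have \<alpha>\<beta>: "\<alpha> \<in> ConcA" "\<beta> \<in> ConcB" using in_I by auto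
  obtain Y where Y: "finite Y" "Y \<subseteq> ConcA \<times> ConcB" "J = CC.span Y" "odots J = odots Y"
    using J by (rule CC_fin_genE)
  have YJ: "Y \<subseteq> J" unfolding Y(3) by (rule CC.span_superset)
  show "(\<alpha>, \<beta>) \<in> J"
  proof (rule ccontr)
    assume "(\<alpha>, \<beta>) \<notin> J"
    then obtain P Q where PQ: "congA P" "congB Q" "\<not> \<alpha> \<subseteq> P" "\<not> \<beta> \<subseteq> Q"
      and sep: "\<And>\<sigma> \<tau>. (\<sigma>, \<tau>) \<in> Y \<Longrightarrow> \<sigma> \<subseteq> P \<or> \<tau> \<subseteq> Q"
      using separation[OF CC.fin_gen_closed[OF J] Y(1) YJ \<alpha>\<beta>] by metis
    have box: "congT (box A B P Q)" by (rule congruence_box[OF PQ(1,2)])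
    have iff: "odot A B \<sigma> \<tau> \<subseteq> box A B P Q \<longleftrightarrow> \<sigma> \<subseteq> P \<or> \<tau> \<subseteq> Q" if "\<sigma> \<in> ConcA" "\<tau> \<in> ConcB" for \<sigma> \<tau>
      using that by (simp add: odot_subset_box_iff PQ A.con.fin_gen_closed B.con.fin_gen_closed)
    have "odots Y \<subseteq> box A B P Q"
      unfolding odots_subset_iff[OF box] using iff sep Y(2) by blast
    then have "odots I \<subseteq> box A B P Q" using le Y(4) by simp
    then have "odot A B \<alpha> \<beta> \<subseteq> box A B P Q"
      using in_I unfolding odots_subset_iff[OF box] by auto
    then show False using iff[OF \<alpha>\<beta>] PQ by blast
  qed
qed

lemma inj_canonical_hom: "inj_on canonical_hom CC.fin_gen"
  by (rule inj_onI) (simp add: canonical_hom_def odots_reflects subset_antisym)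

end

section \<open>Capped tensor products\<close>

context semilattice_pair
begin

text \<open>The union of \<open>\<nabla>\<close> with the lower sets of the elements of \<open>C\<close>.\<close>

definition capped_by :: "('a \<times> 'b) set \<Rightarrow> ('a \<times> 'b) set" where
  "capped_by C = nabla A B \<union> {(x, y). x \<in> carrier A \<and> y \<in> carrier B \<and>
     (\<exists>(c, d)\<in>C. x \<sqsubseteq>\<^bsub>A\<^esub> c \<and> y \<sqsubseteq>\<^bsub>B\<^esub> d)}"

lemma mem_capped_by:
  "(x, y) \<in> capped_by C \<longleftrightarrow> x \<in> carrier A \<and> y \<in> carrier B \<and>
     (x = \<bottom>\<^bsub>A\<^esub> \<or> y = \<bottom>\<^bsub>B\<^esub> \<or> (\<exists>c d. (c, d) \<in> C \<and> x \<sqsubseteq>\<^bsub>A\<^esub> c \<and> y \<sqsubseteq>\<^bsub>B\<^esub> d))"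
  unfolding capped_by_def nabla_def by auto

lemma capped_bi_idealE:
  assumes "capped_bi_ideal A B I"
  obtains C where "finite C" "C \<subseteq> carrier A \<times> carrier B" "I = capped_by C"
  using assms unfolding capped_bi_ideal_def capped_by_def by blast

text \<open>
  A least upper bound \<open>s\<close> of a set \<open>S\<close> of first (respectively second) components such that every
  bi-ideal that contains a row of pairs over \<open>S\<close> also contains the pair over \<open>s\<close>; this is what
  finite joins satisfy.
\<close>

definition lub_left :: "'a \<Rightarrow> 'a set \<Rightarrow> bool" where
  "lub_left s S \<longleftrightarrow> s \<in> carrier A \<and> (\<forall>x\<in>carrier A. s \<sqsubseteq>\<^bsub>A\<^esub> x \<longleftrightarrow> (\<forall>y\<in>S. y \<sqsubseteq>\<^bsub>A\<^esub> x)) \<and>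
    (\<forall>I. \<forall>b\<in>carrier B. bi_ideal A B I \<longrightarrow> (\<forall>y\<in>S. (y, b) \<in> I) \<longrightarrow> (s, b) \<in> I)"

lemma lub_leftD:
  assumes "lub_left s S"
  shows "s \<in> carrier A" "x \<in> carrier A \<Longrightarrow> s \<sqsubseteq>\<^bsub>A\<^esub> x \<longleftrightarrow> (\<forall>y\<in>S. y \<sqsubseteq>\<^bsub>A\<^esub> x)"
    "b \<in> carrier B \<Longrightarrow> bi_ideal A B I \<Longrightarrow> (\<And>y. y \<in> S \<Longrightarrow> (y, b) \<in> I) \<Longrightarrow> (s, b) \<in> I"
  using assms unfolding lub_left_def by simp_all

lemma finite_lub_left:
  assumes "finite S" "S \<subseteq> carrier A"
  shows "\<exists>s. lub_left s S"
  using assms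
proof (induction S rule: finite_induct)
  case empty
  show ?case
    unfolding lub_left_def
    by (rule exI[of _ "\<bottom>\<^bsub>A\<^esub>"]) (simp add: A.bottom_le bi_ideal_bottom_left)
next
  case (insert t S)
  then obtain s where "lub_left s S" by auto
  then have "lub_left (t \<squnion>\<^bsub>A\<^esub> s) (insert t S)"
    unfolding lub_left_def using insert.prems by (simp add: A.join_le_iff bi_ideal_join_left)
  then show ?case ..
qed

definition lub_right :: "'b \<Rightarrow> 'b set \<Rightarrow> bool" where
  "lub_right s S \<longleftrightarrow> s \<in> carrier B \<and> (\<forall>x\<in>carrier B. s \<sqsubseteq>\<^bsub>B\<^esub> x \<longleftrightarrow> (\<forall>y\<in>S. y \<sqsubseteq>\<^bsub>B\<^esub> x)) \<and>
    (\<forall>I. \<forall>a\<in>carrier A. bi_ideal A B I \<longrightarrow> (\<forall>y\<in>S. (a, y) \<in> I) \<longrightarrow> (a, s) \<in> I)"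

lemma lub_rightD:
  assumes "lub_right s S"
  shows "s \<in> carrier B" "x \<in> carrier B \<Longrightarrow> s \<sqsubseteq>\<^bsub>B\<^esub> x \<longleftrightarrow> (\<forall>y\<in>S. y \<sqsubseteq>\<^bsub>B\<^esub> x)"
    "a \<in> carrier A \<Longrightarrow> bi_ideal A B I \<Longrightarrow> (\<And>y. y \<in> S \<Longrightarrow> (a, y) \<in> I) \<Longrightarrow> (a, s) \<in> I"
  using assms unfolding lub_right_def by simp_all

lemma finite_lub_right:
  assumes "finite S" "S \<subseteq> carrier B"
  shows "\<exists>s. lub_right s S"
  using assms
proof (induction S rule: finite_induct)
  case empty
  show ?case
    unfolding lub_right_def
    by (rule exI[of _ "\<bottom>\<^bsub>B\<^esub>"]) (simp add: B.bottom_le bi_ideal_bottom_right)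
next
  case (insert t S)
  then obtain s where "lub_right s S" by auto
  then have "lub_right (t \<squnion>\<^bsub>B\<^esub> s) (insert t S)"
    unfolding lub_right_def using insert.prems by (simp add: B.join_le_iff bi_ideal_join_right)
  then show ?case ..
qed

end

text \<open>
  If two bi-ideals are capped by \<open>C\<close> and \<open>D\<close>, their intersection is generated by the componentwise
  meets of elements of \<open>C\<close> with elements of \<open>D\<close>, hence compact.
\<close>

lemma (in lattice_pair) lattice_tensor_if_capped:
  assumes capped: "capped_tensor A B"
  shows "lattice (tensor A B)"
proof -
  interpret T: zero_semilattice "tensor A B" by (rule zero_semilattice_tensor)
  have Int: "H \<inter> K \<in> fin_gen" if H: "H \<in> fin_gen" and K: "K \<in> fin_gen" for H K
  proof -
    have cap: "capped_bi_ideal A B H" "capped_bi_ideal A B K"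
      using capped H K unfolding capped_tensor_def by auto
    obtain C where C: "finite C" "C \<subseteq> carrier A \<times> carrier B" "H = capped_by C"
      using cap(1) by (rule capped_bi_idealE)
    obtain D where D: "finite D" "D \<subseteq> carrier A \<times> carrier B" "K = capped_by D"
      using cap(2) by (rule capped_bi_idealE)
    note C_iff = mem_capped_by[of _ _ C, folded C(3)] and D_iff = mem_capped_by[of _ _ D, folded D(3)]
    define E where "E = (\<lambda>(p, q). (fst p \<sqinter>\<^bsub>A\<^esub> fst q, snd p \<sqinter>\<^bsub>B\<^esub> snd q)) ` (C \<times> D)"
    have "finite E" unfolding E_def using C D by simp
    have cl: "bi_ideal A B (H \<inter> K)" using H K by (simp add: closed_Int fin_gen_closed)
    have EHK: "E \<subseteq> H \<inter> K"
    proof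
      fix e assume "e \<in> E"
      then obtain c d c' d' where e: "e = (c \<sqinter>\<^bsub>A\<^esub> c', d \<sqinter>\<^bsub>B\<^esub> d')" "(c, d) \<in> C" "(c', d') \<in> D"
        unfolding E_def by auto
      have car: "c \<in> carrier A" "d \<in> carrier B" "c' \<in> carrier A" "d' \<in> carrier B"
        using e C D by auto
      then have "(c, d) \<in> H" "(c', d') \<in> K" using e C_iff D_iff by blast+
      then show "e \<in> H \<inter> K"
        unfolding e(1) using car bi_ideal_le[OF fin_gen_closed[OF H]] bi_ideal_le[OF fin_gen_closed[OF K]]
        by (simp add: A.meet_left A.meet_right B.meet_left B.meet_right)
    qed
    have EU: "E \<subseteq> carrier A \<times> carrier B" using EHK bi_ideal_subset[OF cl] by (rule subset_trans)
    have clE: "bi_ideal A B (span E)" by (rule closed_span[OF EU])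
    have "H \<inter> K \<subseteq> span E"
    proof clarify
      fix x y assume xy: "(x, y) \<in> H" "(x, y) \<in> K"
      then have car: "x \<in> carrier A" "y \<in> carrier B" using C_iff by blast+
      show "(x, y) \<in> span E"
      proof (cases "x = \<bottom>\<^bsub>A\<^esub> \<or> y = \<bottom>\<^bsub>B\<^esub>")
        case True
        then show ?thesis
          using car bi_ideal_bottom_left[OF clE] bi_ideal_bottom_right[OF clE] by blast
      next
        case False
        then obtain c d c' d' where 1: "(c, d) \<in> C" "x \<sqsubseteq>\<^bsub>A\<^esub> c" "y \<sqsubseteq>\<^bsub>B\<^esub> d"
          and 2: "(c', d') \<in> D" "x \<sqsubseteq>\<^bsub>A\<^esub> c'" "y \<sqsubseteq>\<^bsub>B\<^esub> d'" using xy C_iff D_iff by meson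
        have car': "c \<in> carrier A" "d \<in> carrier B" "c' \<in> carrier A" "d' \<in> carrier B"
          using 1 2 C D by auto
        have "(c \<sqinter>\<^bsub>A\<^esub> c', d \<sqinter>\<^bsub>B\<^esub> d') \<in> E"
          unfolding E_def by (rule image_eqI[where x = "((c, d), (c', d'))"]) (use 1(1) 2(1) in simp_all)
        then have in_E: "(c \<sqinter>\<^bsub>A\<^esub> c', d \<sqinter>\<^bsub>B\<^esub> d') \<in> span E" using span_superset by blast
        then show ?thesis
          using bi_ideal_le[OF clE in_E car] A.meet_le[OF 1(2) 2(2)] B.meet_le[OF 1(3) 2(3)] car car'
          by simp
      qed
    qed
    moreover have "span E \<subseteq> H \<inter> K" using EHK by (simp only: span_subset_iff[OF cl])
    ultimately have "H \<inter> K = span E" by blast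
    then show ?thesis using fin_genI[OF \<open>finite E\<close> EU] by simp
  qed
  show ?thesis
  proof unfold_locales
    fix H K assume "H \<in> carrier (tensor A B)" "K \<in> carrier (tensor A B)"
    then have HK: "H \<in> fin_gen" "K \<in> fin_gen" by simp_all
    then have "greatest (tensor A B) (H \<inter> K) (Lower (tensor A B) {H, K})"
      unfolding tensor_eq by (subst inclusion_order_glb_iff) (auto simp: Int)
    then show "\<exists>s. greatest (tensor A B) s (Lower (tensor A B) {H, K})" by blast
  qed
qed

text \<open>A finite set of lower bounds of \<open>c\<close> that contains \<open>c\<close> and is closed under meets with \<open>G\<close>.\<close>

lemma (in zero_lattice) finite_meet_closure:
  assumes "finite G" "G \<subseteq> carrier L" "c \<in> carrier L"
  shows "\<exists>F. finite F \<and> F \<subseteq> carrier L \<and> c \<in> F \<and> (\<forall>f\<in>F. f \<sqsubseteq> c) \<and> (\<forall>f\<in>F. \<forall>g\<in>G. f \<sqinter> g \<in> F)"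
  using assms
proof (induction G rule: finite_induct)
  case empty
  then show ?case by (intro exI[of _ "{c}"]) simp
next
  case (insert t G)
  then obtain F where F: "finite F" "F \<subseteq> carrier L" "c \<in> F" "\<forall>f\<in>F. f \<sqsubseteq> c" "\<forall>f\<in>F. \<forall>g\<in>G. f \<sqinter> g \<in> F"
    by auto
  have t: "t \<in> carrier L" using insert.prems by simp
  have swap: "(f \<sqinter> t) \<sqinter> g = (f \<sqinter> g) \<sqinter> t" if "f \<in> F" "g \<in> G" for f g
  proof -
    have c: "f \<in> carrier L" "g \<in> carrier L" using that F insert.prems by auto
    then have "(f \<sqinter> t) \<sqinter> g = f \<sqinter> (t \<sqinter> g)" "(f \<sqinter> g) \<sqinter> t = f \<sqinter> (g \<sqinter> t)"
      using t by (simp_all add: meet_assoc)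
    then show ?thesis by (simp add: meet_commute)
  qed
  have idem: "(f \<sqinter> t) \<sqinter> t = f \<sqinter> t" if "f \<in> F" for f
    using that F t by (intro meet_eqI) (auto simp: meet_right)
  show ?case
  proof (intro exI[of _ "F \<union> (\<lambda>f. f \<sqinter> t) ` F"] conjI ballI)
    show "finite (F \<union> (\<lambda>f. f \<sqinter> t) ` F)" "c \<in> F \<union> (\<lambda>f. f \<sqinter> t) ` F" using F by auto
    show "F \<union> (\<lambda>f. f \<sqinter> t) ` F \<subseteq> carrier L" using F(2) t by auto
    show "f \<sqsubseteq> c" if f: "f \<in> F \<union> (\<lambda>f. f \<sqinter> t) ` F" for f
    proof -
      have "h \<sqinter> t \<sqsubseteq> c" if "h \<in> F" for h
        using that F(2,4) t insert.prems(2) le_trans[OF meet_left[of h t], of c] by auto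
      then show ?thesis using f F(4) by auto
    qed
    show "f \<sqinter> g \<in> F \<union> (\<lambda>f. f \<sqinter> t) ` F" if f: "f \<in> F \<union> (\<lambda>f. f \<sqinter> t) ` F" and g: "g \<in> insert t G" for f g
      using f g F(5) by (auto simp: swap idem)
  qed
qed

lemma (in zero_lattice) con_convex:
  assumes \<theta>: "lattice_congruence L \<theta>" and xz: "(x, z) \<in> \<theta>" and y: "y \<in> carrier L" "x \<sqsubseteq> y" "y \<sqsubseteq> z"
  shows "(x, y) \<in> \<theta>"
proof -
  have "x \<in> carrier L" "z \<in> carrier L" using con_carrier[OF \<theta> xz] by auto
  then show ?thesis
    using con_meet_right[OF \<theta> xz y(1)] y meet_eqI[of x y] meet_eqI'[of y z] by simp
qed

context tensor_lattice
begin

text \<open>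
  The conditions on a congruence \<open>\<psi>\<close> of the tensor product that amount to \<open>\<psi>\<close> lying above finitely
  many compact congruences of the form \<open>\<alpha> \<odot> \<beta>\<close>.
\<close>

definition odot_condition :: "((('a \<times> 'b) set \<times> ('a \<times> 'b) set) set \<Rightarrow> bool) \<Rightarrow> bool" where
  "odot_condition P \<longleftrightarrow> (\<exists>Z. finite Z \<and> Z \<subseteq> ConcA \<times> ConcB \<and>
     (\<forall>\<psi>. congT \<psi> \<longrightarrow> (P \<psi> \<longleftrightarrow> odots Z \<subseteq> \<psi>)))"

lemma odot_condition_cong:
  "odot_condition P \<Longrightarrow> (\<And>\<psi>. congT \<psi> \<Longrightarrow> P \<psi> \<longleftrightarrow> P' \<psi>) \<Longrightarrow> odot_condition P'"
  unfolding odot_condition_def by metis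

lemma odot_condition_ball:
  assumes "finite S" "\<And>s. s \<in> S \<Longrightarrow> odot_condition (P s)"
  shows "odot_condition (\<lambda>\<psi>. \<forall>s\<in>S. P s \<psi>)"
proof -
  have "\<exists>Z. \<forall>s\<in>S. finite (Z s) \<and> Z s \<subseteq> ConcA \<times> ConcB \<and>
      (\<forall>\<psi>. congT \<psi> \<longrightarrow> (P s \<psi> \<longleftrightarrow> odots (Z s) \<subseteq> \<psi>))"
    by (rule bchoice, unfold odot_condition_def[symmetric]) (use assms(2) in blast)
  then obtain Z where Z: "\<And>s. s \<in> S \<Longrightarrow> finite (Z s)" "\<And>s. s \<in> S \<Longrightarrow> Z s \<subseteq> ConcA \<times> ConcB"
    "\<And>s \<psi>. s \<in> S \<Longrightarrow> congT \<psi> \<Longrightarrow> P s \<psi> \<longleftrightarrow> odots (Z s) \<subseteq> \<psi>"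
    by metis
  have "(\<forall>s\<in>S. P s \<psi>) \<longleftrightarrow> odots (\<Union>(Z ` S)) \<subseteq> \<psi>" if \<psi>: "congT \<psi>" for \<psi>
    unfolding odots_subset_iff[OF \<psi>] using Z(3)[OF _ \<psi>] by (simp add: odots_subset_iff[OF \<psi>] cong: ball_cong)
  moreover have "finite (\<Union>(Z ` S))" "\<Union>(Z ` S) \<subseteq> ConcA \<times> ConcB" using Z(1,2) assms(1) by blast+
  ultimately show ?thesis unfolding odot_condition_def by blast
qed

text \<open>
  The single congruence needed is \<open>\<alpha> \<odot> \<beta>\<close> for the principal congruences \<open>\<alpha>\<close> and \<open>\<beta>\<close> generated by
  the two intervals.
\<close>

lemma odot_condition_corner:
  assumes x: "x' \<in> carrier A" "x \<in> carrier A" "x' \<sqsubseteq>\<^bsub>A\<^esub> x" and y: "y' \<in> carrier B" "y \<in> carrier B" "y' \<sqsubseteq>\<^bsub>B\<^esub> y"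
  shows "odot_condition (\<lambda>\<psi>. (step_tensor x' x y' y, pure x y) \<in> \<psi>)"
proof -
  define \<alpha> \<beta> where "\<alpha> = spanA {(x', x)}" and "\<beta> = spanB {(y', y)}"
  have fg: "\<alpha> \<in> ConcA" "\<beta> \<in> ConcB"
    unfolding \<alpha>_def \<beta>_def using x y by (simp_all add: A.con.fin_genI B.con.fin_genI)
  have "(step_tensor x' x y' y, pure x y) \<in> \<psi> \<longleftrightarrow> odots {(\<alpha>, \<beta>)} \<subseteq> \<psi>" if \<psi>: "congT \<psi>" for \<psi>
  proof -
    have "collapses \<psi> \<alpha> \<beta> \<longleftrightarrow> corner x' x y' y \<in> \<psi>"
    proof
      show "corner x' x y' y \<in> \<psi>" if "collapses \<psi> \<alpha> \<beta>"
        using collapsesD[OF that] A.con.span_superset[of "{(x', x)}"] B.con.span_superset[of "{(y', y)}"]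
        unfolding \<alpha>_def \<beta>_def by blast
      show "collapses \<psi> \<alpha> \<beta>" if "corner x' x y' y \<in> \<psi>"
        unfolding \<alpha>_def \<beta>_def using that x y
        by (intro collapses_span[OF \<psi>]) (simp_all add: collapses_def)
    qed
    then show ?thesis
      using fg by (simp add: odots_subset_iff \<psi> odot_subset_iff A.con.fin_gen_closed B.con.fin_gen_closed
          corner_le x y)
  qed
  then show ?thesis
    unfolding odot_condition_def using fg by (intro exI[of _ "{(\<alpha>, \<beta>)}"]) simp
qed

text \<open>
  The key step. Let \<open>H\<close> be the union of \<open>\<nabla>\<close> with finitely many \<open>a\<^sub>j \<otimes> b\<^sub>j\<close>. To collapse \<open>H\<close> with
  \<open>H \<squnion> (c \<otimes> d)\<close> one goes up through a finite set \<open>F\<close> of elements below \<open>c\<close> that contains \<open>c\<close> and is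
  closed under meets with the \<open>a\<^sub>j\<close>. For \<open>f \<in> F\<close>, let \<open>l f\<close> be the join of the elements of \<open>F\<close> strictly below \<open>f\<close>, and \<open>r f\<close>
  the join of the \<open>b\<^sub>j \<sqinter> d\<close> with \<open>f \<le> a\<^sub>j\<close>. Then \<open>H\<close> meets \<open>f \<otimes> d\<close> inside
  \<open>(l f \<otimes> d) \<squnion> (f \<otimes> r f)\<close>, so collapsing the interval from there to \<open>f \<otimes> d\<close> is necessary; doing
  so for all \<open>f \<in> F\<close> is sufficient.
\<close>

lemma odot_condition_pure:
  assumes capped: "capped_bi_ideal A B H" and H: "H \<in> fin_gen"
    and c: "c \<in> carrier A" and d: "d \<in> carrier B"
  shows "odot_condition (\<lambda>\<psi>. (H, span (H \<union> pure c d)) \<in> \<psi>)"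
proof -
  have clH: "bi_ideal A B H" by (rule fin_gen_closed[OF H])
  obtain C where C: "finite C" "C \<subseteq> carrier A \<times> carrier B" "H = capped_by C"
    using capped by (rule capped_bi_idealE)
  note H_iff = mem_capped_by[of _ _ C, folded C(3)]
  have fst_C: "fst ` C \<subseteq> carrier A" using C(2) by auto
  obtain F where F: "finite F" "F \<subseteq> carrier A" "c \<in> F" "\<forall>f\<in>F. f \<sqsubseteq>\<^bsub>A\<^esub> c"
    "\<forall>f\<in>F. \<forall>g\<in>fst ` C. f \<sqinter>\<^bsub>A\<^esub> g \<in> F"
    using A.finite_meet_closure[OF finite_imageI[OF C(1)] fst_C c] by (elim exE conjE) (rule that)
  define smaller where "smaller f = {g \<in> F. g \<sqsubseteq>\<^bsub>A\<^esub> f \<and> g \<noteq> f}" for f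
  define R where "R f = (\<lambda>p. snd p \<sqinter>\<^bsub>B\<^esub> d) ` {p \<in> C. f \<sqsubseteq>\<^bsub>A\<^esub> fst p}" for f
  have fin: "finite (smaller f)" "finite (R f)" for f
    unfolding smaller_def R_def using F(1) C(1) by simp_all
  have sub: "smaller f \<subseteq> carrier A" "R f \<subseteq> carrier B" for f
    using F(2) C(2) d unfolding smaller_def R_def by auto
  obtain l where "\<And>f. lub_left (l f) (smaller f)" using finite_lub_left[OF fin(1) sub(1)] by metis
  note l = lub_leftD[OF this]
  obtain r where "\<And>f. lub_right (r f) (R f)" using finite_lub_right[OF fin(2) sub(2)] by metis
  note r = lub_rightD[OF this]
  have fc: "f \<in> carrier A" "f \<sqsubseteq>\<^bsub>A\<^esub> c" if "f \<in> F" for f using that F by auto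
  have l_le: "l f \<sqsubseteq>\<^bsub>A\<^esub> f" if "f \<in> F" for f
    using l(2)[OF fc(1)[OF that], of f] by (simp add: smaller_def)
  have r_le: "r f \<sqsubseteq>\<^bsub>B\<^esub> d" for f
  proof -
    have "y \<sqsubseteq>\<^bsub>B\<^esub> d" if "y \<in> R f" for y
      using that C(2) d B.meet_right unfolding R_def by auto
    then show ?thesis using r(2)[OF d, of f] by blast
  qed
  have smaller_le: "y \<sqsubseteq>\<^bsub>A\<^esub> l f" if "y \<in> smaller f" for y f
    using l(2)[OF l(1), of f f] l(1)[of f] that by simp
  have R_le: "y \<sqsubseteq>\<^bsub>B\<^esub> r f" if "y \<in> R f" for y f
    using r(2)[OF r(1), of f f] r(1)[of f] that by simp
  have f_r: "(f, r f) \<in> H" if f: "f \<in> F" for f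
  proof (rule r(3)[OF fc(1)[OF f] clH])
    fix y assume "y \<in> R f"
    then obtain a b where ab: "(a, b) \<in> C" "f \<sqsubseteq>\<^bsub>A\<^esub> a" "y = b \<sqinter>\<^bsub>B\<^esub> d" unfolding R_def by auto
    then have "b \<in> carrier B" using C(2) by auto
    then show "(f, y) \<in> H"
      unfolding H_iff using ab fc[OF f] d by (auto intro!: B.meet_left)
  qed
  define S where "S f = step_tensor (l f) f (r f) d" for f
  have S_fg: "S f \<in> fin_gen" if "f \<in> F" for f
    unfolding S_def using that l r d fc l_le r_le by (simp add: step_tensor_fin_gen)
  have Int_S: "H \<inter> pure f d \<subseteq> S f" if f: "f \<in> F" for f
  proof clarify
    fix x y assume xy: "(x, y) \<in> H" "(x, y) \<in> pure f d"
    have car: "x \<in> carrier A" "y \<in> carrier B" using xy(1) H_iff by blast+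
    show "(x, y) \<in> S f"
    proof (cases "x = \<bottom>\<^bsub>A\<^esub> \<or> y = \<bottom>\<^bsub>B\<^esub>")
      case True
      then show ?thesis using car unfolding S_def mem_step_tensor by blast
    next
      case False
      then obtain a b where ab: "(a, b) \<in> C" "x \<sqsubseteq>\<^bsub>A\<^esub> a" "y \<sqsubseteq>\<^bsub>B\<^esub> b" using xy(1) H_iff by meson
      have le: "x \<sqsubseteq>\<^bsub>A\<^esub> f" "y \<sqsubseteq>\<^bsub>B\<^esub> d" using xy(2) False unfolding mem_pure_tensor by blast+
      have car': "a \<in> carrier A" "b \<in> carrier B" using ab C(2) by auto
      have fa: "f \<sqinter>\<^bsub>A\<^esub> a \<in> F" using F(5) f ab(1) by force
      have x_le: "x \<sqsubseteq>\<^bsub>A\<^esub> f \<sqinter>\<^bsub>A\<^esub> a" using A.meet_le[OF le(1) ab(2)] car car' fc[OF f] by simp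
      show ?thesis
      proof (cases "f \<sqinter>\<^bsub>A\<^esub> a = f")
        case True
        then have "f \<sqsubseteq>\<^bsub>A\<^esub> a" using A.meet_right[of f a] car' fc[OF f] by simp
        then have "b \<sqinter>\<^bsub>B\<^esub> d \<in> R f" 
          unfolding R_def by (intro image_eqI[where x = "(a, b)"]) (use ab(1) in simp_all)
        then have "b \<sqinter>\<^bsub>B\<^esub> d \<sqsubseteq>\<^bsub>B\<^esub> r f" by (rule R_le)
        moreover have "y \<sqsubseteq>\<^bsub>B\<^esub> b \<sqinter>\<^bsub>B\<^esub> d" using B.meet_le[OF ab(3) le(2)] car car' d by simp
        ultimately have "y \<sqsubseteq>\<^bsub>B\<^esub> r f" using B.le_trans[of y "b \<sqinter>\<^bsub>B\<^esub> d" "r f"] car car' d r(1) by simp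
        then show ?thesis using le car unfolding S_def mem_step_tensor by blast
      next
        case False
        then have "f \<sqinter>\<^bsub>A\<^esub> a \<in> smaller f"
          unfolding smaller_def using fa A.meet_left[of f a] car' fc[OF f] by simp
        then have "f \<sqinter>\<^bsub>A\<^esub> a \<sqsubseteq>\<^bsub>A\<^esub> l f" by (rule smaller_le)
        then have "x \<sqsubseteq>\<^bsub>A\<^esub> l f" using A.le_trans[OF x_le] car car' fc[OF f] l(1) by simp
        then show ?thesis using le car unfolding S_def mem_step_tensor by blast
      qed
    qed
  qed
  have S_pure: "S f \<subseteq> pure f d" if f: "f \<in> F" for f
    unfolding S_def step_tensor_def using l_le[OF f] r_le[of f] fc[OF f] d l(1) r(1)
    by (simp add: pure_tensor_subset_iff bi_ideal_pure_tensor mem_pure_tensor)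
  have pure_fg: "pure f d \<in> fin_gen" if "f \<in> F" for f using fc[OF that] d by (simp add: pure_tensor_fin_gen)
  have "(H, span (H \<union> pure c d)) \<in> \<psi> \<longleftrightarrow> (\<forall>f\<in>F. (S f, pure f d) \<in> \<psi>)" if \<psi>: "congT \<psi>" for \<psi>
  proof
    assume HK: "(H, span (H \<union> pure c d)) \<in> \<psi>"
    have Kfg: "span (H \<union> pure c d) \<in> fin_gen" using T.con_carrier[OF \<psi> HK] by simp
    show "\<forall>f\<in>F. (S f, pure f d) \<in> \<psi>"
    proof
      fix f assume f: "f \<in> F"
      have "pure f d \<subseteq> pure c d"
        using fc[OF f] c d by (simp add: pure_tensor_subset_iff bi_ideal_pure_tensor mem_pure_tensor)
      also have "\<dots> \<subseteq> span (H \<union> pure c d)" using span_superset[of "H \<union> pure c d"] by blast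
      finally have "span (H \<union> pure c d) \<inter> pure f d = pure f d" by blast
      then have HI: "(H \<inter> pure f d, pure f d) \<in> \<psi>"
        using T.con_meet_right[OF \<psi> HK, of "pure f d"] pure_fg[OF f] H Kfg by (simp add: meet_tensor)
      have Ifg: "H \<inter> pure f d \<in> fin_gen" using T.con_carrier[OF \<psi> HI] by simp
      have "(H \<inter> pure f d) \<squnion>\<^bsub>tensor A B\<^esub> S f = S f"
        using Int_S[OF f] Ifg S_fg[OF f] by (intro T.join_eqI) simp_all
      moreover have "pure f d \<squnion>\<^bsub>tensor A B\<^esub> S f = pure f d"
        unfolding T.join_commute[of "pure f d"]
        using S_pure[OF f] pure_fg[OF f] S_fg[OF f] by (intro T.join_eqI) simp_all
      ultimately show "(S f, pure f d) \<in> \<psi>"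
        using T.con_join_right[OF \<psi> HI, of "S f"] S_fg[OF f] by simp
    qed
  next
    assume steps: "\<forall>f\<in>F. (S f, pure f d) \<in> \<psi>"
    have "(H, span (H \<union> pure f d)) \<in> \<psi>" if "f \<in> F" for f
      using that
    proof (induction "card (smaller f)" arbitrary: f rule: less_induct)
      case less
      note f = \<open>f \<in> F\<close>
      have IH: "(H, span (H \<union> pure g d)) \<in> \<psi>" if g: "g \<in> smaller f" for g
      proof (rule less.hyps)
        have gF: "g \<in> F" "g \<sqsubseteq>\<^bsub>A\<^esub> f" "g \<noteq> f" using g unfolding smaller_def by auto
        show "g \<in> F" by fact
        have "smaller g \<subset> smaller f"
        proof
          show "smaller g \<subseteq> smaller f"
          proof
            fix h assume "h \<in> smaller g"
            then have h: "h \<in> F" "h \<sqsubseteq>\<^bsub>A\<^esub> g" "h \<noteq> g" unfolding smaller_def by auto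
            have "h \<sqsubseteq>\<^bsub>A\<^esub> f" using A.le_trans[OF h(2) gF(2)] fc h(1) gF(1) f by blast
            moreover have "h \<noteq> f" using A.le_antisym[OF h(2)] gF h fc by blast
            ultimately show "h \<in> smaller f" unfolding smaller_def using h(1) by blast
          qed
          show "smaller g \<noteq> smaller f" using g unfolding smaller_def by blast
        qed
        then show "card (smaller g) < card (smaller f)" using fin(1) by (rule psubset_card_mono[rotated])
      qed
      define K where "K = span (H \<union> smaller f \<times> {d})"
      have HK: "(H, K) \<in> \<psi>"
        unfolding K_def by (rule con_absorb_generators[OF \<psi> H]) (use fin(1) sub(1) d IH in auto)
      have Kfg: "K \<in> fin_gen" using T.con_carrier[OF \<psi> HK] by simp
      note clK = fin_gen_closed[OF Kfg]
      have HK_sub: "H \<subseteq> K" and smK: "smaller f \<times> {d} \<subseteq> K"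
        unfolding K_def using span_superset[of "H \<union> smaller f \<times> {d}"] by auto
      have "(l f, d) \<in> K" using smK by (intro l(3)[OF d clK]) auto
      moreover have "(f, r f) \<in> K" using f_r[OF f] HK_sub by blast
      ultimately have SK: "S f \<subseteq> K"
        unfolding S_def step_tensor_def using clK l(1) r(1) d fc[OF f] by (simp add: pure_tensor_subset_iff)
      then have "S f \<squnion>\<^bsub>tensor A B\<^esub> K = K" using S_fg[OF f] Kfg by (intro T.join_eqI) simp_all
      then have "(K, span (pure f d \<union> K)) \<in> \<psi>"
        using T.con_join_right[OF \<psi> bspec[OF steps f], of K] Kfg pure_fg[OF f] by (simp add: join_tensor)
      then have big: "(H, span (pure f d \<union> K)) \<in> \<psi>" by (rule T.con_trans[OF \<psi> HK])
      show ?case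
      proof (rule T.con_convex[OF \<psi> big])
        show "span (H \<union> pure f d) \<in> carrier (tensor A B)" using H pure_fg[OF f] by (simp add: fin_gen_span_Un)
        show "H \<sqsubseteq>\<^bsub>tensor A B\<^esub> span (H \<union> pure f d)" using span_superset[of "H \<union> pure f d"] by simp
        have "span (H \<union> pure f d) \<subseteq> span (pure f d \<union> K)" by (rule span_mono) (use HK_sub in blast)
        then show "span (H \<union> pure f d) \<sqsubseteq>\<^bsub>tensor A B\<^esub> span (pure f d \<union> K)" by simp
      qed
    qed
    then show "(H, span (H \<union> pure c d)) \<in> \<psi>" using F(3) by blast
  qed
  moreover have "odot_condition (\<lambda>\<psi>. \<forall>f\<in>F. (S f, pure f d) \<in> \<psi>)"
    unfolding S_def by (rule odot_condition_ball[OF F(1)], rule odot_condition_corner)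
      (use l r d fc l_le r_le in auto)
  ultimately show ?thesis using odot_condition_cong by blast
qed

text \<open>
  Any principal congruence: pass to the interval from \<open>H \<sqinter> K\<close> to \<open>H \<squnion> K\<close> and absorb the generators
  of the upper end one at a time.
\<close>

lemma odot_condition_pair:
  assumes capped: "capped_tensor A B" and H: "H \<in> fin_gen" and K: "K \<in> fin_gen"
  shows "odot_condition (\<lambda>\<psi>. (H, K) \<in> \<psi>)"
proof -
  define M N where "M = H \<sqinter>\<^bsub>tensor A B\<^esub> K" and "N = H \<squnion>\<^bsub>tensor A B\<^esub> K"
  have MN: "M \<in> fin_gen" "N \<in> fin_gen" and le: "M \<subseteq> N"
    unfolding M_def N_def using T.meet_closed[of H K] T.join_closed[of H K]
      T.meet_left[of H K] T.join_left[of H K] H K by auto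
  obtain G where G: "finite G" "G \<subseteq> carrier A \<times> carrier B" "N = span G" "G \<subseteq> N"
    using MN(2) by (rule fin_genE)
  have cap: "capped_bi_ideal A B M" using capped MN(1) unfolding capped_tensor_def by simp
  have "odot_condition (\<lambda>\<psi>. \<forall>p\<in>G. (M, span (M \<union> pure (fst p) (snd p))) \<in> \<psi>)"
    by (rule odot_condition_ball[OF G(1)], rule odot_condition_pure[OF cap MN(1)]) (use G(2) in auto)
  moreover have "(\<forall>p\<in>G. (M, span (M \<union> pure (fst p) (snd p))) \<in> \<psi>) \<longleftrightarrow> (H, K) \<in> \<psi>"
    if \<psi>: "congT \<psi>" for \<psi>
  proof -
    have "(\<forall>p\<in>G. (M, span (M \<union> pure (fst p) (snd p))) \<in> \<psi>) \<longleftrightarrow> (M, N) \<in> \<psi>"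
    proof
      assume all: "\<forall>p\<in>G. (M, span (M \<union> pure (fst p) (snd p))) \<in> \<psi>"
      have "(M, span (M \<union> G)) \<in> \<psi>"
        by (rule con_absorb_generators[OF \<psi> MN(1) G(1,2)]) (use all in force)
      moreover have "span (M \<union> G) = N"
      proof (rule subset_antisym)
        show "span (M \<union> G) \<subseteq> N" using le G(4) fin_gen_closed[OF MN(2)] by (simp add: span_subset_iff)
        show "N \<subseteq> span (M \<union> G)" unfolding G(3) by (rule span_mono) blast
      qed
      ultimately show "(M, N) \<in> \<psi>" by simp
    next
      assume MN\<psi>: "(M, N) \<in> \<psi>"
      show "\<forall>p\<in>G. (M, span (M \<union> pure (fst p) (snd p))) \<in> \<psi>"
      proof
        fix p assume p: "p \<in> G"
        then have pc: "fst p \<in> carrier A" "snd p \<in> carrier B" using G(2) by auto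
        have "pure (fst p) (snd p) \<subseteq> N"
          using p G(4) pc fin_gen_closed[OF MN(2)] by (auto simp: pure_tensor_subset_iff)
        then have "span (M \<union> pure (fst p) (snd p)) \<subseteq> N"
          using le fin_gen_closed[OF MN(2)] by (simp add: span_subset_iff)
        then show "(M, span (M \<union> pure (fst p) (snd p))) \<in> \<psi>"
          using MN(1) pc span_superset[of "M \<union> pure (fst p) (snd p)"]
          by (intro T.con_convex[OF \<psi> MN\<psi>]) (simp_all add: fin_gen_span_Un pure_tensor_fin_gen)
      qed
    qed
    also have "\<dots> \<longleftrightarrow> (H, K) \<in> \<psi>"
      unfolding M_def N_def using T.con_mem_iff[OF \<psi>, of H K] H K by simp
    finally show ?thesis .
  qed
  ultimately show ?thesis by (rule odot_condition_cong)
qed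

lemma canonical_hom_surj:
  assumes capped: "capped_tensor A B" and \<theta>: "\<theta> \<in> ConcT"
  shows "\<theta> \<in> canonical_hom ` CC.fin_gen"
proof -
  obtain X where X: "finite X" "X \<subseteq> carrier (tensor A B) \<times> carrier (tensor A B)" "\<theta> = spanT X" "X \<subseteq> \<theta>"
    using \<theta> by (rule T.con.fin_genE)
  have "odot_condition (\<lambda>\<psi>. \<forall>p\<in>X. (fst p, snd p) \<in> \<psi>)"
    by (rule odot_condition_ball[OF X(1)], rule odot_condition_pair[OF capped]) (use X(2) in auto)
  then obtain Z where Z: "finite Z" "Z \<subseteq> ConcA \<times> ConcB"
    and iff: "\<And>\<psi>. congT \<psi> \<Longrightarrow> X \<subseteq> \<psi> \<longleftrightarrow> odots Z \<subseteq> \<psi>"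
    unfolding odot_condition_def prod.collapse subset_eq[of X, symmetric] by metis
  have "\<theta> = odots Z"
  proof (rule subset_antisym)
    have c: "congT (odots Z)" by (rule congruence_odots[OF Z(2)])
    then show "\<theta> \<subseteq> odots Z" unfolding X(3) T.con.span_subset_iff[OF c] iff[OF c] by blast
    have c': "congT \<theta>" by (rule T.con.fin_gen_closed[OF \<theta>])
    show "odots Z \<subseteq> \<theta>" using X(4) unfolding iff[OF c'] .
  qed
  moreover have "CC.span Z \<in> CC.fin_gen" using Z by (simp add: CC.fin_genI)
  ultimately show ?thesis
    using odots_span[OF Z(2)] by (auto simp: canonical_hom_def intro!: rev_image_eqI)
qed

end

theorem mainTheorem1:
  fixes A :: "'a gorder" and B :: "'b gorder"
  assumes "lattice A" and "weak_partial_order_bottom A"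
    and "lattice B" and "weak_partial_order_bottom B"
  shows
    "(lattice (tensor A B) \<longrightarrow>
        (\<exists>!\<epsilon>. \<epsilon> \<in> canonical_homs A B) \<and>
        (\<forall>\<epsilon> \<in> canonical_homs A B. inj_on \<epsilon> (carrier (tensor (Con_c A) (Con_c B))))) \<and>
     (capped_tensor A B \<longrightarrow>
        join_zero_isomorphic (tensor (Con_c A) (Con_c B)) (Con_c (tensor A B)))"
proof (intro conjI impI)
  interpret A: zero_lattice A using assms(1,2) by (rule zero_lattice.intro)
  interpret B: zero_lattice B using assms(3,4) by (rule zero_lattice.intro)
  interpret lattice_pair A B ..
  {
    assume "lattice (tensor A B)"
    then interpret tensor_lattice A B
      by (intro tensor_lattice.intro tensor_lattice_axioms.intro lattice_pair_axioms)
    show "\<exists>!\<epsilon>. \<epsilon> \<in> canonical_homs A B" using canonical_hom_in canonical_homs_unique by blast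
    show "\<forall>\<epsilon>\<in>canonical_homs A B. inj_on \<epsilon> (carrier (tensor (Con_c A) (Con_c B)))"
      using inj_canonical_hom canonical_homs_unique by auto
  }
  assume capped: "capped_tensor A B"
  then interpret tensor_lattice A B by (intro tensor_lattice.intro tensor_lattice_axioms.intro
      lattice_tensor_if_capped lattice_pair_axioms)
  have hom: "canonical_hom \<in> join_zero_hom (tensor (Con_c A) (Con_c B)) (Con_c (tensor A B))"
    using canonical_hom_in by (simp add: canonical_homs_def)
  then have "canonical_hom ` CC.fin_gen \<subseteq> ConcT" by (auto simp: join_zero_hom_def)
  then have "bij_betw canonical_hom CC.fin_gen ConcT"
    unfolding bij_betw_def using inj_canonical_hom canonical_hom_surj[OF capped] by blast
  then show "join_zero_isomorphic (tensor (Con_c A) (Con_c B)) (Con_c (tensor A B))"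
    unfolding join_zero_isomorphic_def using hom by (intro bexI[of _ canonical_hom]) simp_all
qed

end
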